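(* Let $A=R/I$, $R=K[[x,y,z]]$, be a local ring of type $(2,2)$ with maximal ideal $\mathfrak m$. If $I^*_2$ is square-free, then the Hilbert function of $A$ is strictly increasing, and thus the associated graded ring $gr_{\mathfrak m}(A)=\bigoplus_{t\ge0}\mathfrak m^t/\mathfrak m^{t+1}$ is Cohen-Macaulay.
   Context: $K$ is an algebraically closed field of characteristic zero, $R=K[[x,y,z]]$ with maximal ideal $\mathcal M=(x,y,z)$, $P=K[x,y,z]$. For nonzero $f\in R$, $\operatorname{order}(f)$ is the least degree $v$ of a monomial appearing in $f$, and $f^*\in P$ is the homogeneous component of degree $v$ of $f$ (its initial form). $I^*\subset P$ is the homogeneous ideal generated by the initial forms of the nonzero elements of $I$, and $I^*_2$ is its degree $2$ component. $I^*_2$ is square-free if it does not contain the square of a nonzero linear form. $A=R/I$ is of type $(2,2)$ if $I$ is generated by a regular sequence $\{f,g\}$ with $\operatorname{order}(f)=\operatorname{order}(g)=2$ and $g^*\notin(f^* )$. With $\mathfrak m=\mathcal M/I$, $HF_A(t)=\dim_K(\mathfrak m^t/\mathfrak m^{t+1})$. Such $A$ is one-dimensional Cohen-Macaulay; its multiplicity $e$ is the value of $HF_A(t)$ for all large $t$. Let $r$ be the least integer with $HF_A(r)=e$. $HF_A$ is strictly increasing if $HF_A(n)<HF_A(n+1)$ for all $n=0,\dots,r-1$. *)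

theory Defs
  imports
    "HOL-Algebra.Algebra"
    "HOL-Algebra.Algebraic_Closure_Type"
    "HOL-Computational_Algebra.Computational_Algebra"
    "HOL-Library.Extended_Nat"
begin

section \<open>Commutative algebra\<close>

definition regular_sequence :: "('a, 'm) ring_scheme \<Rightarrow> 'a list \<Rightarrow> bool" where
  "regular_sequence R xs \<longleftrightarrow>
     set xs \<subseteq> carrier R \<and>
     (\<forall>i<length xs. \<forall>a\<in>carrier R.
        xs ! i \<otimes>\<^bsub>R\<^esub> a \<in> Idl\<^bsub>R\<^esub> (set (take i xs)) \<longrightarrow> a \<in> Idl\<^bsub>R\<^esub> (set (take i xs))) \<and>
     Idl\<^bsub>R\<^esub> (set xs) \<noteq> carrier R"

definition ideal_depth :: "('a, 'm) ring_scheme \<Rightarrow> 'a set \<Rightarrow> enat" where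
  "ideal_depth R P = Sup {enat (length xs) | xs. regular_sequence R xs \<and> set xs \<subseteq> P}"

definition prime_height :: "('a, 'm) ring_scheme \<Rightarrow> 'a set \<Rightarrow> enat" where
  "prime_height R P = Sup {enat n | n. \<exists>p.
     (\<forall>i\<le>n. primeideal (p i) R) \<and> (\<forall>i<n. p i \<subset> p (Suc i)) \<and> p n = P}"

text \<open>The general (ungraded) notion. For a maximal ideal \<open>P\<close> of a Noetherian ring, the
  depth and the dimension of the localization at \<open>P\<close> are \<open>ideal_depth R P\<close> and
  \<open>prime_height R P\<close>, so this says that all localizations at maximal ideals are
  Cohen--Macaulay local rings.\<close>

definition cohen_macaulay_ring :: "('a, 'm) ring_scheme \<Rightarrow> bool" where
  "cohen_macaulay_ring R \<longleftrightarrow>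
     cring R \<and> noetherian_ring R \<and>
     (\<forall>P. maximalideal P R \<longrightarrow> ideal_depth R P = prime_height R P)"

fun ideal_power :: "('a, 'm) ring_scheme \<Rightarrow> 'a set \<Rightarrow> nat \<Rightarrow> 'a set" where
  "ideal_power R J 0 = carrier R"
| "ideal_power R J (Suc t) = J \<cdot>\<^bsub>R\<^esub> ideal_power R J t"

text \<open>The quotient of consecutive powers \<open>J\<^sup>t\<close> and \<open>J\<^sup>t\<^sup>+\<^sup>1\<close>, as a subset of the ring
  \<open>A Quot J\<^sup>t\<^sup>+\<^sup>1\<close>.\<close>

definition gr_piece :: "('a, 'm) ring_scheme \<Rightarrow> 'a set \<Rightarrow> nat \<Rightarrow> 'a set set" where
  "gr_piece A J t = (\<lambda>a. ideal_power A J (Suc t) +>\<^bsub>A\<^esub> a) ` ideal_power A J t"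

text \<open>The direct sum of the pieces. In the product, \<open>c i\<close> is a coset of \<open>J\<^sup>i\<^sup>+\<^sup>1\<close> and
  \<open>d (t - i)\<close> a coset of \<open>J\<^sup>t\<^sup>-\<^sup>i\<^sup>+\<^sup>1\<close>, and \<^const>\<open>rcoset_mult\<close> forms
  the coset of \<open>J\<^sup>t\<^sup>+\<^sup>1\<close> containing the products of their elements.\<close>

definition assoc_graded_ring :: "('a, 'm) ring_scheme \<Rightarrow> 'a set \<Rightarrow> (nat \<Rightarrow> 'a set) ring" where
  "assoc_graded_ring A J =
     \<lparr> carrier = {c. (\<forall>t. c t \<in> gr_piece A J t) \<and> finite {t. c t \<noteq> ideal_power A J (Suc t)}},
       monoid.mult = (\<lambda>c d t. finsum (A Quot ideal_power A J (Suc t))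
         (\<lambda>i. rcoset_mult A (ideal_power A J (Suc t)) (c i) (d (t - i))) {..t}),
       monoid.one = (\<lambda>t. if t = 0 then ideal_power A J (Suc 0) +>\<^bsub>A\<^esub> \<one>\<^bsub>A\<^esub> else ideal_power A J (Suc t)),
       ring.zero = (\<lambda>t. ideal_power A J (Suc t)),
       ring.add = (\<lambda>c d t. c t \<oplus>\<^bsub>A Quot ideal_power A J (Suc t)\<^esub> d t) \<rparr>"

text \<open>\<open>F\<close> is a subfield of \<open>A\<close>; it acts on the quotient of consecutive powers of \<open>J\<close>
  through its image in \<open>A Quot J\<^sup>t\<^sup>+\<^sup>1\<close>.\<close>

definition hilbert_function :: "('a, 'm) ring_scheme \<Rightarrow> 'a set \<Rightarrow> 'a set \<Rightarrow> nat \<Rightarrow> nat" where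
  "hilbert_function A F J t =
     ring.dim (A Quot ideal_power A J (Suc t))
       ((\<lambda>a. ideal_power A J (Suc t) +>\<^bsub>A\<^esub> a) ` F) (gr_piece A J t)"

text \<open>The multiplicity read off a Hilbert function that is eventually constant (as it is for
  one-dimensional rings).\<close>

definition hf_multiplicity :: "(nat \<Rightarrow> nat) \<Rightarrow> nat" where
  "hf_multiplicity H = (THE e. \<forall>\<^sub>F t in sequentially. H t = e)"

definition hf_strictly_increasing :: "(nat \<Rightarrow> nat) \<Rightarrow> bool" where
  "hf_strictly_increasing H \<longleftrightarrow>
     (let r = (LEAST n. H n = hf_multiplicity H) in \<forall>n<r. H n < H (Suc n))"


section \<open>Power series and polynomials in three variables\<close>

text \<open>\<open>K[[x,y,z]]\<close> is realized as \<open>K[[x]][[y]][[z]]\<close> and \<open>K[x,y,z]\<close> as \<open>K[x][y][z]\<close>, so the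
  outermost index is the exponent of \<open>z\<close>.\<close>

type_synonym 'k fps3 = "'k fps fps fps"
type_synonym 'k poly3 = "'k poly poly poly"

abbreviation fps3_ring :: "'k::field fps3 ring" where
  "fps3_ring \<equiv> ring_of_type_algebra"

abbreviation poly3_ring :: "'k::field poly3 ring" where
  "poly3_ring \<equiv> ring_of_type_algebra"

definition fps3_coeff :: "'k::field fps3 \<Rightarrow> nat \<Rightarrow> nat \<Rightarrow> nat \<Rightarrow> 'k" where
  "fps3_coeff f i j k = fps_nth (fps_nth (fps_nth f k) j) i"

definition poly3_coeff :: "'k::field poly3 \<Rightarrow> nat \<Rightarrow> nat \<Rightarrow> nat \<Rightarrow> 'k" where
  "poly3_coeff p i j k = poly.coeff (poly.coeff (poly.coeff p k) j) i"

definition monom3 :: "'k::field \<Rightarrow> nat \<Rightarrow> nat \<Rightarrow> nat \<Rightarrow> 'k poly3" where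
  "monom3 c i j k = monom (monom (monom c i) j) k"

definition fps3_const :: "'k::field \<Rightarrow> 'k fps3" where
  "fps3_const c = fps_const (fps_const (fps_const c))"

definition fps3_max_ideal :: "'k::field fps3 set" where
  "fps3_max_ideal = Idl\<^bsub>fps3_ring\<^esub> {fps_const (fps_const fps_X), fps_const fps_X, fps_X}"

text \<open>Meaningful for nonzero \<open>f\<close> only; likewise \<open>initial_form\<close>.\<close>

definition fps3_order :: "'k::field fps3 \<Rightarrow> nat" where
  "fps3_order f = (LEAST v. \<exists>i j k. i + j + k = v \<and> fps3_coeff f i j k \<noteq> 0)"

definition initial_form :: "'k::field fps3 \<Rightarrow> 'k poly3" where
  "initial_form f =
     (\<Sum>(i, j, k) \<in> {(i, j, k). i + j + k = fps3_order f}. monom3 (fps3_coeff f i j k) i j k)"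

definition homogeneous3 :: "nat \<Rightarrow> 'k::field poly3 \<Rightarrow> bool" where
  "homogeneous3 d p \<longleftrightarrow> (\<forall>i j k. poly3_coeff p i j k \<noteq> 0 \<longrightarrow> i + j + k = d)"

definition initial_ideal :: "'k::field fps3 set \<Rightarrow> 'k poly3 set" where
  "initial_ideal I = Idl\<^bsub>poly3_ring\<^esub> {initial_form f | f. f \<in> I \<and> f \<noteq> 0}"

definition initial_ideal_component :: "'k::field fps3 set \<Rightarrow> nat \<Rightarrow> 'k poly3 set" where
  "initial_ideal_component I d = {p \<in> initial_ideal I. homogeneous3 d p}"

definition square_free_forms :: "'k::field poly3 set \<Rightarrow> bool" where
  "square_free_forms V \<longleftrightarrow> \<not> (\<exists>l. homogeneous3 1 l \<and> l \<noteq> 0 \<and> l ^ 2 \<in> V)"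


section \<open>Quotients of the power series ring\<close>

text \<open>A property of the ideal \<open>I\<close> defining \<open>A = K[[x,y,z]]/I\<close>. That \<open>f\<close> and \<open>g\<close> are nonzero
  is part of \<open>regular_sequence\<close>.\<close>

definition type_2_2 :: "'k::field fps3 set \<Rightarrow> bool" where
  "type_2_2 I \<longleftrightarrow> (\<exists>f g.
     I = Idl\<^bsub>fps3_ring\<^esub> {f, g} \<and> regular_sequence fps3_ring [f, g] \<and>
     fps3_order f = 2 \<and> fps3_order g = 2 \<and>
     initial_form g \<notin> Idl\<^bsub>poly3_ring\<^esub> {initial_form f})"

definition quot_ring :: "'k::field fps3 set \<Rightarrow> 'k fps3 set ring" where
  "quot_ring I = fps3_ring Quot I"

definition quot_max_ideal :: "'k::field fps3 set \<Rightarrow> 'k fps3 set set" where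
  "quot_max_ideal I = (\<lambda>f. I +>\<^bsub>fps3_ring\<^esub> f) ` fps3_max_ideal"

definition quot_scalars :: "'k::field fps3 set \<Rightarrow> 'k fps3 set set" where
  "quot_scalars I = (\<lambda>c. I +>\<^bsub>fps3_ring\<^esub> fps3_const c) ` UNIV"

end

theory Submission
  imports Defs
begin

text \<open>
  Write \<open>P = K[x,y,z]\<close>, so that \<open>gr(A) = P/I\<^sup>*\<close>. It suffices to find a linear form \<open>l\<close> that is regular
  modulo \<open>I\<^sup>*\<close> and such that \<open>P/(I\<^sup>* + (l))\<close> vanishes in high degrees. Multiplication by \<open>l\<close> is then
  injective on \<open>gr(A)\<close>, so \<open>HF\<close> is nondecreasing; if \<open>HF(n) = HF(n+1)\<close>, it is onto from degree
  \<open>n\<close> to \<open>n+1\<close>, hence in all later degrees, and \<open>HF\<close> is constant from \<open>n\<close> on. As \<open>HF\<close> is bounded, any two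
  elements of \<open>P/I\<^sup>*\<close> are algebraically dependent over \<open>K\<close>, which bounds the depth and the height
  of every maximal ideal by one; both are attained because of \<open>l\<close>.

  To find \<open>l\<close>, consider the pencil spanned by \<open>f\<^sup>*\<close> and \<open>g\<^sup>*\<close>. If its members have no common factor, all
  syzygies are Koszul, \<open>I\<^sup>* = (f\<^sup>*, g\<^sup>*)\<close>, and any line missing the base points will do. Otherwise one may
  take \<open>f\<^sup>* = l m\<close> and \<open>g\<^sup>* = l n\<close>, where square-freeness says that \<open>l, m, n\<close> are independent. Lifting
  syzygies to power series gives \<open>I\<^sup>* = (l m, l n, h)\<close> with \<open>h\<close> in \<open>(m, n)\<close> not divisible by \<open>l\<close>,
  and this is \<open>(m, n) \<inter> (l, h)\<close>.
\<close>

section \<open>Coefficients and homogeneous components\<close>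

text \<open>The obstacle is that \<open>I^*\<close> need not be generated by the initial forms of
  \<open>f\<close> and \<open>g\<close>. If these are \<open>l m\<close> and \<open>l n\<close>,
  then \<open>n f - m g\<close> loses its cubic term, and correcting \<open>n\<close> and
  \<open>m\<close> to series \<open>A\<close> and \<open>B\<close> may push its leading form to
  higher and higher degree. The corrections must stop: otherwise completeness yields
  \<open>A f = B g\<close> with \<open>B\<close> of order one, while regularity makes
  \<open>B\<close> a multiple of \<open>f\<close>. The leading form at which they stop is
  \<open>h\<close>, and a second lifted syzygy shows that no further generators occur. Independence
  follows from square-freeness because a relation involving \<open>l\<close>, multiplied by
  \<open>l\<close>, writes \<open>l^2\<close> in terms of \<open>l m\<close> and \<open>l n\<close>.
  Geometrically \<open>(m, n) \<inter> (l, h)\<close> is a line together with lines in the plane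
  \<open>l = 0\<close>, and a parameter is a plane through the origin containing none of them.
  Cohen-Macaulayness is claimed at all maximal ideals, not only at the irrelevant one. The largest
  homogeneous ideal inside a maximal ideal helps to produce a smaller prime, and relations
  \<open>u(b) = a x\<close> modulo an ideal replace degree arguments for inhomogeneous
  elements.\<close>

definition scalar3 :: "'k::field \<Rightarrow> 'k poly3" where "scalar3 c = [:[:[:c:]:]:]"
definition var_x :: "'k::field poly3" where "var_x = [:[:[:0, 1:]:]:]"
definition var_y :: "'k::field poly3" where "var_y = [:[:0, 1:]:]"
definition var_z :: "'k::field poly3" where "var_z = [:0, 1:]"

definition exponents :: "nat \<Rightarrow> (nat \<times> nat \<times> nat) set" where
  "exponents n = {(i, j, k). i + j + k = n}"

definition fps3_comp :: "nat \<Rightarrow> 'k::field fps3 \<Rightarrow> 'k poly3" where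
  "fps3_comp n f = (\<Sum>(i, j, k)\<in>exponents n. monom3 (fps3_coeff f i j k) i j k)"

definition fps3_of_poly3 :: "'k::field poly3 \<Rightarrow> 'k fps3" where
  "fps3_of_poly3 p = Abs_fps (\<lambda>k. Abs_fps (\<lambda>j. Abs_fps (\<lambda>i. poly3_coeff p i j k)))"

text \<open>Taken through power series so that the product formula is proved only once, for
  \<open>fps3_comp\<close>.\<close>

definition poly3_comp :: "nat \<Rightarrow> 'k::field poly3 \<Rightarrow> 'k poly3" where
  "poly3_comp n p = fps3_comp n (fps3_of_poly3 p)"

lemma poly3_eqI: "(\<And>i j k. poly3_coeff p i j k = poly3_coeff q i j k) \<Longrightarrow> p = q"
  unfolding poly3_coeff_def by (intro poly_eqI) auto

lemma fps3_eqI: "(\<And>i j k. fps3_coeff f i j k = fps3_coeff g i j k) \<Longrightarrow> f = g"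
  unfolding fps3_coeff_def by (intro fps_ext) auto

lemma finite_exponents [simp]: "finite (exponents n)"
proof (rule finite_subset)
  show "exponents n \<subseteq> {..n} \<times> {..n} \<times> {..n}"
    by (auto simp: exponents_def)
qed simp

lemma poly3_coeff_simps [simp]:
  "poly3_coeff 0 i j k = 0"
  "poly3_coeff (p + q) i j k = poly3_coeff p i j k + poly3_coeff q i j k"
  "poly3_coeff (p - q) i j k = poly3_coeff p i j k - poly3_coeff q i j k"
  "poly3_coeff (- p) i j k = - poly3_coeff p i j k"
  by (auto simp: poly3_coeff_def)

lemma poly3_coeff_sum: "poly3_coeff (sum f A) i j k = (\<Sum>a\<in>A. poly3_coeff (f a) i j k)"
  by (simp add: poly3_coeff_def coeff_sum)

lemma poly3_coeff_mult:
  "poly3_coeff (p * q) i j k =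
    (\<Sum>c\<le>k. \<Sum>b\<le>j. \<Sum>a\<le>i. poly3_coeff p a b c * poly3_coeff q (i - a) (j - b) (k - c))"
  by (simp add: poly3_coeff_def coeff_mult coeff_sum)

lemma poly3_coeff_scalar [simp]:
  "poly3_coeff (scalar3 c) i j k = (if i = 0 \<and> j = 0 \<and> k = 0 then c else 0)"
  by (auto simp: scalar3_def poly3_coeff_def coeff_pCons split: nat.splits)

lemma poly3_coeff_var [simp]:
  "poly3_coeff var_x i j k = (if i = 1 \<and> j = 0 \<and> k = 0 then 1 else 0)"
  "poly3_coeff var_y i j k = (if i = 0 \<and> j = 1 \<and> k = 0 then 1 else 0)"
  "poly3_coeff var_z i j k = (if i = 0 \<and> j = 0 \<and> k = 1 then 1 else 0)"
  by (auto simp: var_x_def var_y_def var_z_def poly3_coeff_def coeff_pCons split: nat.splits)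

lemma scalar3_simps [simp]:
  "scalar3 0 = 0" "scalar3 1 = 1"
  by (simp_all add: scalar3_def one_pCons)

lemma scalar3_add: "scalar3 (a + b) = scalar3 a + scalar3 b"
  and scalar3_diff: "scalar3 (a - b) = scalar3 a - scalar3 b"
  and scalar3_minus: "scalar3 (- a) = - scalar3 a"
  and scalar3_mult: "scalar3 (a * b) = scalar3 a * scalar3 b"
  by (simp_all add: scalar3_def)

lemma scalar3_eq_iff [simp]: "scalar3 a = scalar3 b \<longleftrightarrow> a = b" "scalar3 a = 0 \<longleftrightarrow> a = 0"
  by (simp_all add: scalar3_def)

lemma poly3_coeff_monom3:
  "poly3_coeff (monom3 c a b d) i j k = (if i = a \<and> j = b \<and> k = d then c else 0)"
  by (auto simp: poly3_coeff_def monom3_def)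

lemma poly3_coeff_scalar_mult [simp]:
  "poly3_coeff (scalar3 c * p) i j k = c * poly3_coeff p i j k"
  by (simp add: scalar3_def poly3_coeff_def)

lemma fps3_coeff_simps [simp]:
  "fps3_coeff 0 i j k = 0"
  "fps3_coeff (f + g) i j k = fps3_coeff f i j k + fps3_coeff g i j k"
  "fps3_coeff (f - g) i j k = fps3_coeff f i j k - fps3_coeff g i j k"
  "fps3_coeff (- f) i j k = - fps3_coeff f i j k"
  by (auto simp: fps3_coeff_def)

lemma fps3_coeff_mult:
  "fps3_coeff (f * g) i j k =
    (\<Sum>c\<le>k. \<Sum>b\<le>j. \<Sum>a\<le>i. fps3_coeff f a b c * fps3_coeff g (i - a) (j - b) (k - c))"
  by (simp add: fps3_coeff_def fps_mult_nth fps_sum_nth atLeast0AtMost)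

lemma fps3_coeff_of_poly3 [simp]: "fps3_coeff (fps3_of_poly3 p) i j k = poly3_coeff p i j k"
  by (simp add: fps3_of_poly3_def fps3_coeff_def)

lemma poly3_coeff_fps3_comp:
  "poly3_coeff (fps3_comp n f) i j k = (if i + j + k = n then fps3_coeff f i j k else 0)"
proof -
  have "poly3_coeff (fps3_comp n f) i j k =
      (\<Sum>t\<in>exponents n. if t = (i, j, k) then fps3_coeff f i j k else 0)"
    unfolding fps3_comp_def poly3_coeff_sum
    by (rule sum.cong) (auto simp: poly3_coeff_monom3 split: if_splits)
  also have "\<dots> = (if (i, j, k) \<in> exponents n then fps3_coeff f i j k else 0)"
    by simp
  also have "\<dots> = (if i + j + k = n then fps3_coeff f i j k else 0)"
    by (simp add: exponents_def)
  finally show ?thesis .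
qed

lemma poly3_coeff_comp:
  "poly3_coeff (poly3_comp n p) i j k = (if i + j + k = n then poly3_coeff p i j k else 0)"
  by (simp add: poly3_comp_def poly3_coeff_fps3_comp)

lemma fps3_of_poly3_simps [simp]:
  "fps3_of_poly3 0 = 0"
  "fps3_of_poly3 (p + q) = fps3_of_poly3 p + fps3_of_poly3 q"
  "fps3_of_poly3 (p - q) = fps3_of_poly3 p - fps3_of_poly3 q"
  "fps3_of_poly3 (- p) = - fps3_of_poly3 p"
  "fps3_of_poly3 (p * q) = fps3_of_poly3 p * fps3_of_poly3 q"
  by (rule fps3_eqI; simp add: fps3_coeff_mult poly3_coeff_mult)+

lemma fps3_of_poly3_1: "fps3_of_poly3 (1 :: 'k::field poly3) = 1"
proof (rule fps3_eqI)
  fix i j k :: nat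
  have "fps3_coeff (1 :: 'k fps3) i j k = (if i = 0 \<and> j = 0 \<and> k = 0 then 1 else 0)"
    by (simp add: fps3_coeff_def)
  then show "fps3_coeff (fps3_of_poly3 (1 :: 'k poly3)) i j k = fps3_coeff 1 i j k"
    using poly3_coeff_scalar [of "1 :: 'k" i j k] by simp
qed

lemma fps3_comp_simps [simp]:
  "fps3_comp n 0 = 0"
  "fps3_comp n (f + g) = fps3_comp n f + fps3_comp n g"
  "fps3_comp n (f - g) = fps3_comp n f - fps3_comp n g"
  "fps3_comp n (- f) = - fps3_comp n f"
  by (rule poly3_eqI; simp add: poly3_coeff_fps3_comp)+

lemma poly3_comp_simps [simp]:
  "poly3_comp n 0 = 0"
  "poly3_comp n (p + q) = poly3_comp n p + poly3_comp n q"
  "poly3_comp n (p - q) = poly3_comp n p - poly3_comp n q"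
  "poly3_comp n (- p) = - poly3_comp n p"
  by (rule poly3_eqI; simp add: poly3_coeff_comp)+

lemma poly3_comp_sum: "poly3_comp n (sum f A) = (\<Sum>a\<in>A. poly3_comp n (f a))"
  by (induction A rule: infinite_finite_induct) auto

lemma fps3_comp_mult:
  "fps3_comp n (f * g) = (\<Sum>s\<le>n. fps3_comp s f * fps3_comp (n - s) g)"
proof (rule poly3_eqI)
  fix i j k :: nat
  let ?t = "\<lambda>a b c. fps3_coeff f a b c * fps3_coeff g (i - a) (j - b) (k - c)"
  have "poly3_coeff (\<Sum>s\<le>n. fps3_comp s f * fps3_comp (n - s) g) i j k =
     (\<Sum>s\<le>n. \<Sum>c\<le>k. \<Sum>b\<le>j. \<Sum>a\<le>i.
       if a + b + c = s \<and> (i - a) + (j - b) + (k - c) = n - s then ?t a b c else 0)"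
    unfolding poly3_coeff_sum poly3_coeff_mult poly3_coeff_fps3_comp
    by (intro sum.cong refl) auto
  \<comment> \<open>With the sum over \<open>s\<close> innermost, \<open>s = a + b + c\<close> is
    the only value that can contribute for a given triple.\<close>
  also have "\<dots> = (\<Sum>c\<le>k. \<Sum>b\<le>j. \<Sum>a\<le>i. \<Sum>s\<le>n.
       if a + b + c = s \<and> (i - a) + (j - b) + (k - c) = n - s then ?t a b c else 0)"
    by (subst sum.swap, rule sum.cong [OF refl], subst sum.swap, rule sum.cong [OF refl], rule sum.swap)
  also have "\<dots> = (\<Sum>c\<le>k. \<Sum>b\<le>j. \<Sum>a\<le>i. if i + j + k = n then ?t a b c else 0)"
  proof (intro sum.cong refl)
    fix c b a assume "c \<in> {..k}" "b \<in> {..j}" "a \<in> {..i}"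
    \<comment> \<open>The bounds on \<open>a\<close>, \<open>b\<close>, \<open>c\<close> make the
      truncated subtractions exact, so the second condition just says
      \<open>i + j + k = n\<close>.\<close>
    then have "(\<Sum>s\<le>n. if a + b + c = s \<and> (i - a) + (j - b) + (k - c) = n - s then ?t a b c else 0)
      = (\<Sum>s\<le>n. if s = a + b + c then if i + j + k = n then ?t a b c else 0 else 0)"
      by (intro sum.cong refl) auto
    also have "\<dots> = (if i + j + k = n then ?t a b c else 0)"
      using \<open>c \<in> {..k}\<close> \<open>b \<in> {..j}\<close> \<open>a \<in> {..i}\<close> by auto
    finally show "(\<Sum>s\<le>n. if a + b + c = s \<and> (i - a) + (j - b) + (k - c) = n - s then ?t a b c else 0)
      = (if i + j + k = n then ?t a b c else 0)" .
  qed
  also have "\<dots> = poly3_coeff (fps3_comp n (f * g)) i j k"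
    by (simp add: poly3_coeff_fps3_comp fps3_coeff_mult)
  finally show "poly3_coeff (fps3_comp n (f * g)) i j k =
    poly3_coeff (\<Sum>s\<le>n. fps3_comp s f * fps3_comp (n - s) g) i j k" by simp
qed

lemma poly3_comp_mult:
  "poly3_comp n (p * q) = (\<Sum>s\<le>n. poly3_comp s p * poly3_comp (n - s) q)"
  by (simp add: poly3_comp_def fps3_comp_mult)

lemma homogeneous3_iff_comp: "homogeneous3 n p \<longleftrightarrow> poly3_comp n p = p"
proof
  assume "homogeneous3 n p"
  then show "poly3_comp n p = p"
    by (intro poly3_eqI) (auto simp: poly3_coeff_comp homogeneous3_def)
next
  assume eq: "poly3_comp n p = p"
  show "homogeneous3 n p"
    unfolding homogeneous3_def
    by (subst eq [symmetric]) (auto simp: poly3_coeff_comp)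
qed

lemma homogeneous3_fps3_comp [simp]: "homogeneous3 n (fps3_comp n f)"
  by (auto simp: homogeneous3_def poly3_coeff_fps3_comp)

lemma homogeneous3_comp [simp]: "homogeneous3 n (poly3_comp n p)"
  by (simp add: poly3_comp_def)

lemma poly3_comp_homogeneous:
  "homogeneous3 n p \<Longrightarrow> poly3_comp m p = (if m = n then p else 0)"
  by (intro poly3_eqI) (auto simp: poly3_coeff_comp homogeneous3_def)

lemma homogeneous3_simps [simp]:
  "homogeneous3 n 0"
  "homogeneous3 n p \<Longrightarrow> homogeneous3 n q \<Longrightarrow> homogeneous3 n (p + q)"
  "homogeneous3 n p \<Longrightarrow> homogeneous3 n q \<Longrightarrow> homogeneous3 n (p - q)"
  "homogeneous3 n p \<Longrightarrow> homogeneous3 n (- p)"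
  "homogeneous3 n p \<Longrightarrow> homogeneous3 n (scalar3 c * p)"
  unfolding homogeneous3_def by (simp_all, force+)

lemma homogeneous3_scalar [simp]: "homogeneous3 0 (scalar3 c)"
  by (auto simp: homogeneous3_def)

lemma homogeneous3_one [simp]: "homogeneous3 0 1"
  using homogeneous3_scalar [of 1] by simp

lemma homogeneous3_0_eq: "homogeneous3 0 p \<Longrightarrow> p = scalar3 (poly3_coeff p 0 0 0)"
  by (rule poly3_eqI) (auto simp: homogeneous3_def)

lemma homogeneous3_sum:
  "(\<And>a. a \<in> A \<Longrightarrow> homogeneous3 n (f a)) \<Longrightarrow> homogeneous3 n (sum f A)"
  by (induction A rule: infinite_finite_induct) auto

text \<open>Serves to make cofactors homogeneous: if \<open>p * q\<close> is homogeneous,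
  \<open>p\<close> may be replaced by one of its components. The case \<open>n < d\<close> is
  separate because \<open>n - d\<close> would be truncated to \<open>0\<close>.\<close>

lemma poly3_comp_mult_homogeneous:
  assumes "homogeneous3 d q"
  shows "poly3_comp n (p * q) = (if d \<le> n then poly3_comp (n - d) p * q else 0)"
proof -
  have "poly3_comp n (p * q) = (\<Sum>s\<le>n. if s + d = n then poly3_comp (n - d) p * q else 0)"
    unfolding poly3_comp_mult poly3_comp_homogeneous [OF assms]
    by (intro sum.cong refl) auto
  also have "\<dots> = (\<Sum>s\<le>n. if s = n - d then if d \<le> n then poly3_comp (n - d) p * q else 0 else 0)"
    by (intro sum.cong refl) auto
  finally show ?thesis by simp
qed

lemma homogeneous3_mult:
  assumes "homogeneous3 m p" "homogeneous3 n q"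
  shows "homogeneous3 (m + n) (p * q)"
  using poly3_comp_mult_homogeneous [OF assms(2), of "m + n" p] assms(1)
  by (simp add: homogeneous3_iff_comp)

lemma homogeneous3_power: "homogeneous3 d p \<Longrightarrow> homogeneous3 (d * n) (p ^ n)"
proof (induction n)
  case 0
  then show ?case by simp
next
  case (Suc n)
  then show ?case using homogeneous3_mult [of d p "d * n" "p ^ n"] by simp
qed

lemma homogeneous3_vars [simp]:
  "homogeneous3 1 var_x" "homogeneous3 1 var_y" "homogeneous3 1 var_z"
  "homogeneous3 (Suc 0) var_x" "homogeneous3 (Suc 0) var_y" "homogeneous3 (Suc 0) var_z"
  by (auto simp: homogeneous3_def split: if_splits)

lemma homogeneous3_1_eq:
  assumes "homogeneous3 1 p"
  shows "p = scalar3 (poly3_coeff p 1 0 0) * var_x + scalar3 (poly3_coeff p 0 1 0) * var_y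
     + scalar3 (poly3_coeff p 0 0 1) * var_z"
proof (rule poly3_eqI)
  fix i j k :: nat
  have "i + j + k \<noteq> 1 \<or> i = 1 \<and> j = 0 \<and> k = 0 \<or> i = 0 \<and> j = 1 \<and> k = 0 \<or> i = 0 \<and> j = 0 \<and> k = 1"
    by arith
  then consider "i + j + k \<noteq> 1" | "i = 1" "j = 0" "k = 0" | "i = 0" "j = 1" "k = 0" | "i = 0" "j = 0" "k = 1"
    by blast
  then show "poly3_coeff p i j k = poly3_coeff (scalar3 (poly3_coeff p 1 0 0) * var_x
     + scalar3 (poly3_coeff p 0 1 0) * var_y + scalar3 (poly3_coeff p 0 0 1) * var_z) i j k"
    by cases (use assms in \<open>auto simp: homogeneous3_def\<close>)
qed

lemma poly3_eq_sum_comp: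
  obtains D where "p = (\<Sum>n\<le>D. poly3_comp n p)" "\<And>n. n > D \<Longrightarrow> poly3_comp n p = 0"
proof -
  let ?S = "{t. (\<lambda>(i, j, k). poly3_coeff p i j k) t \<noteq> 0}"
  have "?S \<subseteq> (\<Union>k\<le>degree p. \<Union>j\<le>degree (coeff p k). \<Union>i\<le>degree (coeff (coeff p k) j). {(i, j, k)})"
  proof
    fix t assume "t \<in> ?S"
    then obtain i j k where t: "t = (i, j, k)" and "coeff (coeff (coeff p k) j) i \<noteq> 0"
      by (cases t) (auto simp: poly3_coeff_def)
    then have "i \<le> degree (coeff (coeff p k) j)" "j \<le> degree (coeff p k)" "k \<le> degree p"
      using le_degree by (metis coeff_0)+
    then show "t \<in> (\<Union>k\<le>degree p. \<Union>j\<le>degree (coeff p k). \<Union>i\<le>degree (coeff (coeff p k) j). {(i, j, k)})"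
      using t by auto
  qed
  moreover have "finite \<dots>" by auto
  ultimately have "finite ?S" by (rule finite_subset)
  then have "finite ((\<lambda>(i, j, k). i + j + k) ` ?S)" by simp
  then obtain D where D: "\<forall>x\<in>(\<lambda>(i, j, k). i + j + k) ` ?S. x \<le> D"
    using finite_nat_set_iff_bounded_le by meson
  have D': "poly3_coeff p i j k \<noteq> 0 \<Longrightarrow> i + j + k \<le> D" for i j k
    using D by force
  show ?thesis
  proof (rule that)
    show "p = (\<Sum>n\<le>D. poly3_comp n p)"
      by (rule poly3_eqI) (use D' in \<open>auto simp: poly3_coeff_sum poly3_coeff_comp\<close>)
    show "\<And>n. n > D \<Longrightarrow> poly3_comp n p = 0"
      by (rule poly3_eqI) (use D' in \<open>force simp: poly3_coeff_comp\<close>)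
  qed
qed

section \<open>The order filtration\<close>

text \<open>A predicate instead of a comparison with \<open>fps3_order\<close>, so that the zero
  series has every order and sums need no case distinction.\<close>

definition ord_ge :: "nat \<Rightarrow> 'k::field fps3 \<Rightarrow> bool" where
  "ord_ge n f \<longleftrightarrow> (\<forall>i j k. i + j + k < n \<longrightarrow> fps3_coeff f i j k = 0)"

lemma ord_ge_iff_comp: "ord_ge n f \<longleftrightarrow> (\<forall>m<n. fps3_comp m f = 0)"
proof
  show "ord_ge n f \<Longrightarrow> \<forall>m<n. fps3_comp m f = 0"
    by (auto intro!: poly3_eqI simp: ord_ge_def poly3_coeff_fps3_comp)
  show "\<forall>m<n. fps3_comp m f = 0 \<Longrightarrow> ord_ge n f"
    unfolding ord_ge_def by (metis poly3_coeff_fps3_comp poly3_coeff_simps(1))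
qed

lemma ord_ge_simps [simp]:
  "ord_ge n 0"
  "ord_ge 0 f"
  "ord_ge n f \<Longrightarrow> ord_ge n g \<Longrightarrow> ord_ge n (f + g)"
  "ord_ge n f \<Longrightarrow> ord_ge n g \<Longrightarrow> ord_ge n (f - g)"
  "ord_ge n f \<Longrightarrow> ord_ge n (- f)"
  by (auto simp: ord_ge_def)

lemma ord_ge_mono: "ord_ge n f \<Longrightarrow> m \<le> n \<Longrightarrow> ord_ge m f"
  by (auto simp: ord_ge_def)

lemma ord_ge_Suc: "ord_ge (Suc n) f \<longleftrightarrow> ord_ge n f \<and> fps3_comp n f = 0"
  by (auto simp: ord_ge_iff_comp less_Suc_eq)

lemma ord_ge_mult:
  assumes "ord_ge a f" "ord_ge b g"
  shows "ord_ge (a + b) (f * g)"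
  unfolding ord_ge_iff_comp
proof (intro allI impI)
  fix m assume m: "m < a + b"
  show "fps3_comp m (f * g) = 0"
    unfolding fps3_comp_mult
  proof (rule sum.neutral, intro ballI)
    fix s assume "s \<in> {..m}"
    then have "s < a \<or> m - s < b" using m by auto
    then show "fps3_comp s f * fps3_comp (m - s) g = 0"
      using assms by (auto simp: ord_ge_iff_comp)
  qed
qed

lemma ord_ge_mult1: "ord_ge a f \<Longrightarrow> ord_ge a (f * g)"
  and ord_ge_mult2: "ord_ge a f \<Longrightarrow> ord_ge a (g * f)"
  using ord_ge_mult [of a f 0 g] ord_ge_mult [of 0 g a f] by auto

text \<open>Any other splitting of the degree \<open>a + b\<close> puts one factor below its order,
  where its component vanishes.\<close>

lemma fps3_comp_mult_leading:
  assumes "ord_ge a f" "ord_ge b g" "n = a + b"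
  shows "fps3_comp n (f * g) = fps3_comp a f * fps3_comp b g"
proof -
  have "fps3_comp n (f * g) = (\<Sum>s\<le>n. if s = a then fps3_comp a f * fps3_comp b g else 0)"
    unfolding fps3_comp_mult
  proof (rule sum.cong [OF refl])
    fix s assume "s \<in> {..n}"
    then consider "s < a" | "s = a" | "n - s < b" using assms(3) by force
    then show "fps3_comp s f * fps3_comp (n - s) g = (if s = a then fps3_comp a f * fps3_comp b g else 0)"
      by cases (use assms in \<open>auto simp: ord_ge_iff_comp\<close>)
  qed
  then show ?thesis using assms(3) by simp
qed

lemma fps3_comp_of_poly3: "fps3_comp n (fps3_of_poly3 p) = poly3_comp n p"
  by (simp add: poly3_comp_def)

lemma fps3_comp_of_homogeneous [simp]:
  "homogeneous3 n p \<Longrightarrow> fps3_comp n (fps3_of_poly3 p) = p"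
  by (simp add: fps3_comp_of_poly3 homogeneous3_iff_comp)

lemma ord_ge_of_homogeneous [simp]: "homogeneous3 n p \<Longrightarrow> ord_ge n (fps3_of_poly3 p)"
  by (simp add: ord_ge_iff_comp fps3_comp_of_poly3 poly3_comp_homogeneous)

lemma fps3_order_eqI:
  assumes "ord_ge n f" "fps3_comp n f \<noteq> 0"
  shows "fps3_order f = n"
  unfolding fps3_order_def
proof (rule Least_equality)
  obtain i j k where "poly3_coeff (fps3_comp n f) i j k \<noteq> 0"
    using assms(2) poly3_eqI [of "fps3_comp n f" 0] by auto
  then show "\<exists>i j k. i + j + k = n \<and> fps3_coeff f i j k \<noteq> 0"
    by (auto simp: poly3_coeff_fps3_comp split: if_splits)
  show "\<And>y. \<exists>i j k. i + j + k = y \<and> fps3_coeff f i j k \<noteq> 0 \<Longrightarrow> n \<le> y"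
    using assms(1) by (auto simp: ord_ge_def) (meson not_le)
qed

lemma initial_form_eq: "initial_form f = fps3_comp (fps3_order f) f"
  by (simp add: initial_form_def fps3_comp_def exponents_def)

lemma
  assumes "f \<noteq> 0"
  shows ord_ge_order: "ord_ge (fps3_order f) f"
    and initial_form_nonzero: "initial_form f \<noteq> 0"
proof -
  let ?P = "\<lambda>v. \<exists>i j k. i + j + k = v \<and> fps3_coeff f i j k \<noteq> 0"
  obtain i j k where "fps3_coeff f i j k \<noteq> 0"
    using assms fps3_eqI [of f 0] by auto
  then have ex: "?P (i + j + k)" by blast
  show "ord_ge (fps3_order f) f"
    unfolding ord_ge_def fps3_order_def using not_less_Least [of _ ?P] by blast
  have "?P (fps3_order f)"
    unfolding fps3_order_def by (rule LeastI [of ?P, OF ex])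
  then obtain i j k where "i + j + k = fps3_order f" "fps3_coeff f i j k \<noteq> 0" by blast
  then have "poly3_coeff (initial_form f) i j k \<noteq> 0"
    by (simp add: initial_form_eq poly3_coeff_fps3_comp)
  then show "initial_form f \<noteq> 0" by auto
qed

section \<open>Ideals and homomorphisms in type classes\<close>

text \<open>A notion for type classes, in which computations use plain \<open>+\<close> and
  \<open>*\<close>. The locale \<open>cring_quotient\<close> translates it to ideals of ring
  records.\<close>

definition is_ideal :: "'a::comm_ring_1 set \<Rightarrow> bool" where
  "is_ideal J \<longleftrightarrow> 0 \<in> J \<and> (\<forall>a\<in>J. \<forall>b\<in>J. a + b \<in> J) \<and> (\<forall>r. \<forall>a\<in>J. r * a \<in> J)"

lemma is_idealI:
  "0 \<in> J \<Longrightarrow> (\<And>a b. a \<in> J \<Longrightarrow> b \<in> J \<Longrightarrow> a + b \<in> J) \<Longrightarrow> (\<And>r a. a \<in> J \<Longrightarrow> r * a \<in> J) \<Longrightarrow> is_ideal J"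
  by (simp add: is_ideal_def)

lemma is_idealD:
  assumes "is_ideal J"
  shows "0 \<in> J" "a \<in> J \<Longrightarrow> b \<in> J \<Longrightarrow> a + b \<in> J" "a \<in> J \<Longrightarrow> r * a \<in> J" "a \<in> J \<Longrightarrow> a * r \<in> J"
    "a \<in> J \<Longrightarrow> - a \<in> J" "a \<in> J \<Longrightarrow> b \<in> J \<Longrightarrow> a - b \<in> J"
proof -
  show 1: "0 \<in> J" "a \<in> J \<Longrightarrow> b \<in> J \<Longrightarrow> a + b \<in> J" "a \<in> J \<Longrightarrow> r * a \<in> J" for a b r
    using assms by (auto simp: is_ideal_def)
  show "a \<in> J \<Longrightarrow> a * r \<in> J" using 1(3) by (simp add: mult.commute)
  show m: "a \<in> J \<Longrightarrow> - a \<in> J" for a using 1(3) [of a "-1"] by simp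
  show "a \<in> J \<Longrightarrow> b \<in> J \<Longrightarrow> a - b \<in> J" using 1(2) [of a "- b"] m by simp
qed

lemma is_ideal_sum: "is_ideal J \<Longrightarrow> (\<And>a. a \<in> A \<Longrightarrow> f a \<in> J) \<Longrightarrow> sum f A \<in> J"
  by (induction A rule: infinite_finite_induct) (auto intro: is_idealD)

lemma is_ideal_add_cancel:
  assumes "is_ideal J" "b \<in> J"
  shows "a + b \<in> J \<longleftrightarrow> a \<in> J" "b + a \<in> J \<longleftrightarrow> a \<in> J" "a - b \<in> J \<longleftrightarrow> a \<in> J" "b - a \<in> J \<longleftrightarrow> a \<in> J"
  using is_idealD [OF assms(1)] assms(2)
  by (metis add_diff_cancel_right' add.commute diff_add_cancel minus_diff_eq)+

definition is_ring_hom :: "('a::comm_ring_1 \<Rightarrow> 'b::comm_ring_1) \<Rightarrow> bool" where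
  "is_ring_hom h \<longleftrightarrow> h 1 = 1 \<and> (\<forall>a b. h (a + b) = h a + h b) \<and> (\<forall>a b. h (a * b) = h a * h b)"

lemma is_ring_homD:
  assumes "is_ring_hom h"
  shows "h 1 = 1" "h (a + b) = h a + h b" "h (a * b) = h a * h b" "h 0 = 0" "h (- a) = - h a"
    "h (a - b) = h a - h b" "h (a ^ n) = h a ^ n"
proof -
  show 1: "h 1 = 1" "h (a + b) = h a + h b" "h (a * b) = h a * h b" for a b
    using assms by (auto simp: is_ring_hom_def)
  show 0: "h 0 = 0" using 1(2) [of 0 0] by simp
  show m: "h (- a) = - h a" for a using 1(2) [of a "- a"] 0 by (simp add: minus_unique)
  show "h (a - b) = h a - h b" using 1(2) [of a "- b"] m by simp
  show "h (a ^ n) = h a ^ n" by (induction n) (simp_all add: 1)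
qed

lemma is_ring_hom_sum: "is_ring_hom h \<Longrightarrow> h (sum f A) = (\<Sum>a\<in>A. h (f a))"
  by (induction A rule: infinite_finite_induct) (auto simp: is_ring_homD)

lemma is_ring_hom_comp: "is_ring_hom g \<Longrightarrow> is_ring_hom h \<Longrightarrow> is_ring_hom (\<lambda>x. g (h x))"
  by (simp add: is_ring_hom_def)

lemma is_ring_hom_poly: "is_ring_hom (\<lambda>p. poly p e)"
  by (simp add: is_ring_hom_def)

lemma is_ring_hom_map_poly:
  assumes "is_ring_hom h"
  shows "is_ring_hom (map_poly h)"
proof -
  note h = is_ring_homD [OF assms]
  show ?thesis
    unfolding is_ring_hom_def
    by (auto simp: h poly_eq_iff coeff_map_poly coeff_mult is_ring_hom_sum [OF assms])
qed

lemma is_ring_hom_eval: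
  assumes "is_ring_hom h"
  shows "is_ring_hom (\<lambda>p. poly (map_poly h p) v)"
  by (rule is_ring_hom_comp [OF is_ring_hom_poly is_ring_hom_map_poly [OF assms]])

text \<open>\<open>p\<close> lies in the radical of \<open>J\<close>. That all three variables do is
  the form in which vanishing in high degrees will be checked.\<close>

definition nil_mod :: "'a::comm_ring_1 set \<Rightarrow> 'a \<Rightarrow> bool" where
  "nil_mod J p \<longleftrightarrow> (\<exists>n. p ^ n \<in> J)"

lemma nil_mod_in: "p \<in> J \<Longrightarrow> nil_mod J p"
  unfolding nil_mod_def by (rule exI [of _ 1]) simp

lemma nil_mod_power: "nil_mod J (p ^ m) \<Longrightarrow> nil_mod J p"
  unfolding nil_mod_def by (metis power_mult)

lemma nil_mod_mult: "is_ideal J \<Longrightarrow> nil_mod J p \<Longrightarrow> nil_mod J (r * p)"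
  unfolding nil_mod_def by (metis power_mult_distrib is_idealD(3))

text \<open>In each term of the binomial expansion of \<open>(p + q) ^ (m + n)\<close> either
  \<open>p\<close> has exponent at least \<open>m\<close> or \<open>q\<close> has exponent at least
  \<open>n\<close>.\<close>

lemma nil_mod_add:
  fixes p q :: "'a::comm_ring_1"
  assumes J: "is_ideal J" and "nil_mod J p" "nil_mod J q"
  shows "nil_mod J (p + q)"
proof -
  obtain m n where mn: "p ^ m \<in> J" "q ^ n \<in> J"
    using assms by (auto simp: nil_mod_def)
  have "(p + q) ^ (m + n) = (\<Sum>k\<le>m + n. of_nat (m + n choose k) * p ^ k * q ^ (m + n - k))"
    by (rule binomial_ring)
  also have "\<dots> \<in> J"
  proof (rule is_ideal_sum [OF J])
    fix k assume "k \<in> {..m + n}"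
    show "of_nat (m + n choose k) * p ^ k * q ^ (m + n - k) \<in> J"
    proof (cases "m \<le> k")
      case True
      then have "p ^ k = p ^ m * p ^ (k - m)" by (simp add: power_add [symmetric])
      then have "p ^ k \<in> J" using mn is_idealD(4) [OF J] by metis
      then show ?thesis using is_idealD(3,4) [OF J] by metis
    next
      case False
      then have "m + n - k = n + (m - k)" by simp
      then have "q ^ (m + n - k) = q ^ n * q ^ (m - k)" by (simp add: power_add)
      then have "q ^ (m + n - k) \<in> J" using mn is_idealD(4) [OF J] by metis
      then show ?thesis using is_idealD(3) [OF J] by metis
    qed
  qed
  finally show ?thesis by (auto simp: nil_mod_def)
qed

section \<open>Linear substitutions\<close>

lemma is_ring_hom_scalar3: "is_ring_hom scalar3"
  by (simp add: is_ring_hom_def scalar3_add scalar3_mult)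

text \<open>Evaluation proceeds from the innermost variable \<open>x\<close> outwards; this is the
  \<open>K\<close>-algebra endomorphism sending \<open>x\<close>, \<open>y\<close>, \<open>z\<close>
  to \<open>l\<close>, \<open>m\<close>, \<open>n\<close>.\<close>

definition subst3 :: "'k::field poly3 \<Rightarrow> 'k poly3 \<Rightarrow> 'k poly3 \<Rightarrow> 'k poly3 \<Rightarrow> 'k poly3" where
  "subst3 l m n p =
     poly (map_poly (\<lambda>q. poly (map_poly (\<lambda>r. poly (map_poly scalar3 r) l) q) m) p) n"

lemma is_ring_hom_subst3: "is_ring_hom (subst3 l m n)"
  unfolding subst3_def [abs_def]
  by (intro is_ring_hom_eval is_ring_hom_scalar3)

lemma subst3_simps [simp]:
  "subst3 l m n (scalar3 c) = scalar3 c"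
  "subst3 l m n var_x = l" "subst3 l m n var_y = m" "subst3 l m n var_z = n"
  by (simp_all add: subst3_def scalar3_def [of c] var_x_def var_y_def var_z_def map_poly_pCons one_pCons [symmetric])

lemma monom3_eq: "monom3 c i j k = scalar3 c * var_x ^ i * var_y ^ j * var_z ^ k"
proof (rule poly3_eqI)
  have z: "p * var_z ^ k = monom 1 k * p" for p :: "'a poly3" and k
    by (simp add: var_z_def monom_altdef mult.commute)
  have y: "var_y ^ j = [:monom 1 j:]" for j
    by (simp add: var_y_def monom_altdef poly_const_pow)
  have x: "var_x ^ j = [:[:monom 1 j:]:]" for j
    by (simp add: var_x_def monom_altdef poly_const_pow)
  have "scalar3 c * var_x ^ i * var_y ^ j * var_z ^ k = monom3 c i j k"
    unfolding z x y
    by (simp add: scalar3_def monom3_def smult_monom mult_monom)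
  then show "poly3_coeff (monom3 c i j k) a b d = poly3_coeff (scalar3 c * var_x ^ i * var_y ^ j * var_z ^ k) a b d" for a b d
    by simp
qed

lemma homogeneous3_eq_sum:
  assumes "homogeneous3 d p"
  shows "p = (\<Sum>(i, j, k)\<in>exponents d. scalar3 (poly3_coeff p i j k) * var_x ^ i * var_y ^ j * var_z ^ k)"
proof -
  have "p = poly3_comp d p" using assms by (simp add: homogeneous3_iff_comp)
  then show ?thesis
    unfolding poly3_comp_def fps3_comp_def monom3_eq by simp
qed

lemma subst3_homogeneous:
  assumes l: "homogeneous3 1 l" "homogeneous3 1 m" "homogeneous3 1 n" and p: "homogeneous3 d p"
  shows "homogeneous3 d (subst3 l m n p)"
proof -
  note h = is_ring_homD [OF is_ring_hom_subst3]
  have "subst3 l m n p = (\<Sum>(i, j, k)\<in>exponents d. scalar3 (poly3_coeff p i j k) * l ^ i * m ^ j * n ^ k)"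
    by (subst homogeneous3_eq_sum [OF p])
      (simp add: is_ring_hom_sum [OF is_ring_hom_subst3] h case_prod_unfold)
  moreover have "homogeneous3 d (scalar3 c * l ^ i * m ^ j * n ^ k)" if "i + j + k = d" for c i j k
  proof -
    have "homogeneous3 (0 + 1 * i + 1 * j + 1 * k) (scalar3 c * l ^ i * m ^ j * n ^ k)"
      by (intro homogeneous3_mult homogeneous3_power l homogeneous3_scalar)
    then show ?thesis using that by simp
  qed
  ultimately show ?thesis
    by (auto intro!: homogeneous3_sum simp: exponents_def)
qed

lemma poly3_hom_eqI:
  assumes g: "is_ring_hom g" and h: "is_ring_hom h"
    and eq: "\<And>c. g (scalar3 c) = h (scalar3 c)" "g var_x = h var_x" "g var_y = h var_y" "g var_z = h var_z"
  shows "g p = h p"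
proof -
  have *: "g (sum f A) = h (sum f A)" if "\<And>a. a \<in> A \<Longrightarrow> g (f a) = h (f a)" for f :: "'c \<Rightarrow> 'a poly3" and A
    using that by (simp add: is_ring_hom_sum [OF g] is_ring_hom_sum [OF h])
  obtain D where D: "p = (\<Sum>n\<le>D. poly3_comp n p)" by (rule poly3_eq_sum_comp)
  have "g (poly3_comp n p) = h (poly3_comp n p)" for n
    by (subst (1 2) homogeneous3_eq_sum [OF homogeneous3_comp], rule *)
      (auto simp: is_ring_homD [OF g] is_ring_homD [OF h] eq)
  then show ?thesis by (subst (1 2) D) (rule *)
qed

section \<open>Independent linear forms and changes of coordinates\<close>

definition lin_indep3 :: "'k::field poly3 \<Rightarrow> 'k poly3 \<Rightarrow> 'k poly3 \<Rightarrow> bool" where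
  "lin_indep3 l m n \<longleftrightarrow>
    (\<forall>a b c. scalar3 a * l + scalar3 b * m + scalar3 c * n = 0 \<longrightarrow> a = 0 \<and> b = 0 \<and> c = 0)"

text \<open>With constants fixed and degrees preserved in both directions, these are exactly the
  linear changes of coordinates.\<close>

definition graded_aut :: "('k::field poly3 \<Rightarrow> 'k poly3) \<Rightarrow> bool" where
  "graded_aut \<sigma> \<longleftrightarrow> is_ring_hom \<sigma> \<and> (\<forall>c. \<sigma> (scalar3 c) = scalar3 c) \<and> bij \<sigma> \<and>
     (\<forall>d p. homogeneous3 d (\<sigma> p) \<longleftrightarrow> homogeneous3 d p)"

text \<open>Gaussian elimination with unknowns indexed by \<open>A\<close> and equations indexed by
  \<open>J\<close>. It serves for linear forms in three variables and for the dimension count in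
  \<open>algebraic_dependence\<close>.\<close>

lemma underdetermined_system:
  fixes m :: "'a \<Rightarrow> 'b \<Rightarrow> 'k::field"
  assumes "finite J" "finite A" "card J < card A"
  shows "\<exists>c. (\<exists>i\<in>A. c i \<noteq> 0) \<and> (\<forall>j\<in>J. (\<Sum>i\<in>A. c i * m i j) = 0)"
  using assms
proof (induction J arbitrary: A m rule: finite_induct)
  case empty
  then have "\<exists>i. i \<in> A" by (metis card.empty equals0I less_irrefl)
  then show ?case by (intro exI [of _ "\<lambda>_. 1"]) auto
next
  case (insert j J)
  show ?case
  proof (cases "\<forall>i\<in>A. m i j = 0")
    case True
    have "card J < card A" using insert by simp
    from insert.IH [OF insert.prems(1) this, of m] True show ?thesis by auto
  next
    case False
    then obtain i0 where i0: "i0 \<in> A" "m i0 j \<noteq> 0" by auto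
    have "card J < card (A - {i0})" using insert i0 by simp
    \<comment> \<open>Equation \<open>j\<close> is solved for the unknown \<open>i0\<close>, and the
      result is substituted into the remaining equations.\<close>
    from insert.IH [OF _ this, of "\<lambda>i j'. m i j' - m i j / m i0 j * m i0 j'"] insert.prems
    obtain c where c: "\<exists>i\<in>A - {i0}. c i \<noteq> 0"
      "\<And>j'. j' \<in> J \<Longrightarrow> (\<Sum>i\<in>A - {i0}. c i * (m i j' - m i j / m i0 j * m i0 j')) = 0"
      by auto
    define s where "s = (\<Sum>i\<in>A - {i0}. c i * m i j)"
    \<comment> \<open>The value that equation \<open>j\<close> forces on the unknown
      \<open>i0\<close>.\<close>
    define c' where "c' = c(i0 := - s / m i0 j)"
    have sum: "(\<Sum>i\<in>A. c' i * m i j') = (\<Sum>i\<in>A - {i0}. c i * m i j') - s / m i0 j * m i0 j'" for j'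
    proof -
      have "(\<Sum>i\<in>A. c' i * m i j') = c' i0 * m i0 j' + (\<Sum>i\<in>A - {i0}. c' i * m i j')"
        by (rule sum.remove) (use insert.prems i0 in auto)
      also have "(\<Sum>i\<in>A - {i0}. c' i * m i j') = (\<Sum>i\<in>A - {i0}. c i * m i j')"
        by (rule sum.cong) (auto simp: c'_def)
      finally show ?thesis by (simp add: c'_def)
    qed
    have "(\<Sum>i\<in>A. c' i * m i j') = 0" if "j' \<in> J" for j'
    proof -
      have "0 = (\<Sum>i\<in>A - {i0}. c i * m i j' - c i * m i j * (m i0 j' / m i0 j))"
        using c(2) [OF that] by (simp add: algebra_simps)
      also have "\<dots> = (\<Sum>i\<in>A - {i0}. c i * m i j') - s * (m i0 j' / m i0 j)"
        by (simp add: sum_subtractf s_def sum_distrib_right sum_divide_distrib)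
      finally show ?thesis unfolding sum by simp
    qed
    moreover have "(\<Sum>i\<in>A. c' i * m i j) = 0"
      unfolding sum using i0 by (simp add: s_def)
    moreover have "\<exists>i\<in>A. c' i \<noteq> 0"
      using c(1) by (auto simp: c'_def)
    ultimately show ?thesis by blast
  qed
qed

text \<open>Four vectors in the three-dimensional space of linear forms are dependent, and
  independence of \<open>l\<close>, \<open>m\<close>, \<open>n\<close> makes the coefficient of
  \<open>v\<close> nonzero.\<close>

lemma lin_indep3_spans:
  assumes lin: "homogeneous3 1 l" "homogeneous3 1 m" "homogeneous3 1 n" "homogeneous3 1 v"
    and ind: "lin_indep3 l m n"
  shows "\<exists>a b c. v = scalar3 a * l + scalar3 b * m + scalar3 c * n"
proof -
  let ?w = "\<lambda>i::nat. if i = 0 then l else if i = 1 then m else if i = 2 then n else v"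
  let ?c = "\<lambda>p j. if j = (0::nat) then poly3_coeff p 1 0 0 else if j = 1 then poly3_coeff p 0 1 0
    else poly3_coeff p 0 0 1"
  obtain c where c: "\<exists>i\<in>{..<4}. c i \<noteq> 0" "\<And>j. j \<in> {..<3} \<Longrightarrow> (\<Sum>i\<in>{..<4}. c i * ?c (?w i) j) = 0"
    using underdetermined_system [of "{..<3::nat}" "{..<4::nat}" "\<lambda>i j. ?c (?w i) j"] by auto
  let ?s = "scalar3 (c 0) * l + scalar3 (c 1) * m + scalar3 (c 2) * n + scalar3 (c 3) * v"
  have "homogeneous3 1 ?s" using lin by (intro homogeneous3_simps)
  note h = homogeneous3_1_eq [OF this]
  have "poly3_coeff ?s 1 0 0 = 0" "poly3_coeff ?s 0 1 0 = 0" "poly3_coeff ?s 0 0 1 = 0"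
    using c(2) [of 0] c(2) [of 1] c(2) [of 2] by (simp_all add: eval_nat_numeral)
  then have s0: "?s = 0" using h by simp
  have "c 3 \<noteq> 0"
  proof
    assume c3: "c 3 = 0"
    then have "c 0 = 0 \<and> c 1 = 0 \<and> c 2 = 0"
      using ind s0 unfolding lin_indep3_def by simp
    then have "\<forall>i\<in>{..<4}. c i = 0" using c3 by (auto simp: eval_nat_numeral less_Suc_eq)
    then show False using c(1) by blast
  qed
  have "scalar3 (- 1 / c 3) * ?s = 0" using s0 by simp
  then have "scalar3 (- c 0 / c 3) * l + scalar3 (- c 1 / c 3) * m + scalar3 (- c 2 / c 3) * n + scalar3 (-1) * v = 0"
    using \<open>c 3 \<noteq> 0\<close> by (simp only: distrib_left mult.assoc [symmetric] scalar3_mult [symmetric]) simp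
  then have "v = scalar3 (- c 0 / c 3) * l + scalar3 (- c 1 / c 3) * m + scalar3 (- c 2 / c 3) * n"
    by (simp add: scalar3_minus)
  then show ?thesis by blast
qed

text \<open>Since \<open>l\<close>, \<open>m\<close>, \<open>n\<close> span the linear forms, the
  variables have linear preimages, and substituting these gives the inverse.\<close>

lemma graded_aut_subst3:
  assumes lin: "homogeneous3 1 l" "homogeneous3 1 m" "homogeneous3 1 n" and ind: "lin_indep3 l m n"
  shows "graded_aut (subst3 l m n)"
proof -
  note h = is_ring_homD [OF is_ring_hom_subst3]
  have "\<exists>w. homogeneous3 1 w \<and> subst3 l m n w = v" if v: "homogeneous3 1 v" for v
  proof -
    obtain a b c where "v = scalar3 a * l + scalar3 b * m + scalar3 c * n"
      using lin_indep3_spans [OF lin v ind] by blast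
    then show ?thesis
      by (intro exI [of _ "scalar3 a * var_x + scalar3 b * var_y + scalar3 c * var_z"]) (simp add: h)
  qed
  then obtain x y z where x: "homogeneous3 1 x" "subst3 l m n x = var_x"
    and y: "homogeneous3 1 y" "subst3 l m n y = var_y" and z: "homogeneous3 1 z" "subst3 l m n z = var_z"
    using homogeneous3_vars by metis
  let ?s = "subst3 l m n" and ?t = "subst3 x y z"
  have st: "?s (?t p) = p" for p
    by (rule poly3_hom_eqI [of "\<lambda>p. ?s (?t p)" "\<lambda>p. p"])
      (simp_all add: is_ring_hom_def h is_ring_homD [OF is_ring_hom_subst3] x y z)
  \<comment> \<open>Injectivity on linear forms is enough: it identifies \<open>?t l\<close> with
    \<open>var_x\<close>, as both are sent to \<open>l\<close>, and homomorphisms are compared on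
    variables.\<close>
  have inj: "v = w" if "homogeneous3 1 v" "homogeneous3 1 w" "?s v = ?s w" for v w
  proof -
    have hd: "homogeneous3 1 (v - w)" using that by simp
    have "?s (v - w) = 0" using that by (simp add: h)
    then have "scalar3 (poly3_coeff (v - w) 1 0 0) * l + scalar3 (poly3_coeff (v - w) 0 1 0) * m
        + scalar3 (poly3_coeff (v - w) 0 0 1) * n = 0"
      by (subst (asm) homogeneous3_1_eq [OF hd]) (simp only: h subst3_simps)
    then have "poly3_coeff (v - w) 1 0 0 = 0" "poly3_coeff (v - w) 0 1 0 = 0" "poly3_coeff (v - w) 0 0 1 = 0"
      using ind unfolding lin_indep3_def by blast+
    then have "v - w = 0" using homogeneous3_1_eq [OF hd] by simp
    then show ?thesis by simp
  qed
  have ts: "?t (?s p) = p" for p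
  proof (rule poly3_hom_eqI [of "\<lambda>p. ?t (?s p)" "\<lambda>p. p"])
    have "?t l = var_x" "?t m = var_y" "?t n = var_z"
      by (rule inj; simp add: st subst3_homogeneous [OF x(1) y(1) z(1), of 1, simplified] lin [simplified])+
    then show "?t (?s var_x) = var_x" "?t (?s var_y) = var_y" "?t (?s var_z) = var_z" by simp_all
  qed (simp_all add: is_ring_hom_def h is_ring_homD [OF is_ring_hom_subst3])
  have "bij ?s" by (rule o_bij [of ?t]) (simp_all add: fun_eq_iff st ts)
  moreover have "homogeneous3 d (?s p) \<longleftrightarrow> homogeneous3 d p" for d p
    using subst3_homogeneous [OF x(1) y(1) z(1), of d "?s p"] subst3_homogeneous [OF lin, of d p]
    by (auto simp: ts)
  ultimately show ?thesis
    by (simp add: graded_aut_def is_ring_hom_subst3)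
qed

section \<open>Pencils of conics\<close>

text \<open>Possible over any commutative ring because the divisor is monic. The coefficient rings
  to come are \<open>K[x]\<close> and \<open>K[x][y]\<close>.\<close>

lemma division_by_monic_quadratic:
  fixes a b :: "'a::comm_ring_1"
  shows "\<exists>q r s. p = [:b, a, 1:] * q + [:r, s:]"
proof (induction p)
  case 0
  show ?case by (intro exI [of _ 0]) simp
next
  case (pCons c p)
  then obtain q r s where p: "p = [:b, a, 1:] * q + [:r, s:]" by blast
  have "pCons c p = [:c:] + [:0, 1:] * p" by simp
  also have "\<dots> = [:b, a, 1:] * ([:0, 1:] * q + [:s:]) + [:c - s * b, r - s * a:]"
    unfolding p by (simp add: algebra_simps)
  finally show ?case by blast
qed

text \<open>\<open>v\<^sup>2 - a u v + b u\<^sup>2\<close> is the resultant of the two polynomials.\<close>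

lemma syzygy_of_resultant_nonzero:
  fixes a b u v :: "'a::idom"
  assumes res: "v ^ 2 - a * u * v + b * u ^ 2 \<noteq> 0"
    and eq: "\<alpha> * [:b, a, 1:] + \<beta> * [:v, u:] = 0"
  shows "\<exists>c. \<alpha> = c * [:v, u:] \<and> \<beta> = - c * [:b, a, 1:]"
proof -
  obtain q r0 r1 where q: "\<beta> = [:b, a, 1:] * q + [:r0, r1:]"
    using division_by_monic_quadratic by blast
  \<comment> \<open>With \<open>\<beta>\<close> reduced modulo the quadratic, the relation says that
    \<open>s\<close> times the quadratic is the remainder times \<open>[:v, u:]\<close>. Comparing
    degrees then forces \<open>s\<close> to be constant.\<close>
  define s where "s = - (\<alpha> + q * [:v, u:])"
  have "s * [:b, a, 1:] = [:r0, r1:] * [:v, u:]"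
  proof -
    have "- (x + q * z) * y = r * z" if "x * y + (y * q + r) * z = 0" for x y z r :: "'a poly"
    proof -
      have "(x + q * z) * y + r * z = 0" using that by (simp add: algebra_simps)
      then show ?thesis by (simp only: mult_minus_left add_eq_0_iff [symmetric]) (simp add: add_eq_0_iff)
    qed
    from this [OF eq [unfolded q]] show ?thesis unfolding s_def .
  qed
  then have s: "s * [:b, a, 1:] = [:r0 * v, r0 * u + r1 * v, r1 * u:]"
    by (simp add: algebra_simps)
  have "degree s = 0"
  proof (cases "s = 0")
    case False
    then have "degree (s * [:b, a, 1:]) = degree s + 2"
      by (subst degree_mult_eq) auto
    moreover have "degree [:r0 * v, r0 * u + r1 * v, r1 * u:] \<le> 2" by simp
    ultimately show ?thesis using s by simp
  qed simp
  then obtain s0 where s0: "s = [:s0:]" using degree_eq_zeroE by blast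
  have e: "s0 * b = r0 * v" "s0 * a = r0 * u + r1 * v" "s0 = r1 * u"
    using s unfolding s0 by (auto simp: mult.commute split: if_splits)
  \<comment> \<open>Eliminating \<open>s0\<close> and \<open>r0\<close> from the three coefficient
    equations leaves \<open>r1\<close> times the resultant.\<close>
  have "r1 * (v ^ 2 - a * u * v + b * u ^ 2) = 0"
  proof -
    have "r1 * (v ^ 2 - a * u * v + b * u ^ 2) = v * (r0 * u + r1 * v - s0 * a) + u * (s0 * b - r0 * v)"
      unfolding e(3) by (simp add: algebra_simps power2_eq_square)
    then show ?thesis using e by simp
  qed
  then have r1: "r1 = 0" using res by simp
  then have "r0 * u = 0" "r0 * v = 0" using e by auto
  then have "r0 = 0" using res by auto
  then have "s = 0" "\<beta> = [:b, a, 1:] * q" using r1 q s0 e by auto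
  then show ?thesis
    by (intro exI [of _ "- q"]) (auto simp: s_def algebra_simps add_eq_0_iff eq_neg_iff_add_eq_0 simp del: mult_pCons_left mult_pCons_right)
qed

text \<open>Division by \<open>y - e\<close> in every coefficient, where \<open>y\<close> is the
  inner variable. Consequently the kernel of the substitution \<open>y = e\<close> is generated by
  \<open>y - e\<close>.\<close>

lemma map_poly_eval_decomp:
  fixes p :: "'a::comm_ring_1 poly poly"
  shows "p = [:[:- e, 1:]:] * map_poly (\<lambda>q. synthetic_div q e) p + map_poly (\<lambda>q. [:poly q e:]) p"
proof (rule poly_eqI)
  fix n :: nat
  show "coeff p n = coeff ([:[:- e, 1:]:] * map_poly (\<lambda>q. synthetic_div q e) p + map_poly (\<lambda>q. [:poly q e:]) p) n"
    using synthetic_div_correct' [of e "coeff p n"] by (simp add: coeff_map_poly)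
qed

text \<open>A binary form of degree \<open>d\<close> is restricted to the line
  \<open>y = c x\<close>, where every monomial of that degree becomes a multiple of
  \<open>x ^ d\<close>.\<close>

lemma homogeneous_eval_monom:
  fixes q :: "'k::field poly poly"
  assumes "\<And>i j. i + j \<noteq> d \<Longrightarrow> coeff (coeff q j) i = 0"
  shows "\<exists>r. poly q [:0, c:] = monom r d"
proof -
  have cf: "coeff q j = (if j \<le> d then monom (coeff (coeff q j) (d - j)) (d - j) else 0)" for j
  proof (rule poly_eqI)
    fix i
    have nz: "coeff (coeff q j) i = 0 \<or> i + j = d"
      using assms by blast
    show "coeff (coeff q j) i = coeff (if j \<le> d then monom (coeff (coeff q j) (d - j)) (d - j) else 0) i"
      using nz by auto
  qed
  have "[:0, c:] = monom c 1" by (simp add: monom_altdef)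
  then have "poly q [:0, c:] = (\<Sum>j\<le>degree q. coeff q j * monom (c ^ j) j)"
    by (simp add: poly_altdef monom_power)
  also have "\<dots> = (\<Sum>j\<le>degree q. monom (if j \<le> d then coeff (coeff q j) (d - j) * c ^ j else 0) d)"
  proof (rule sum.cong [OF refl])
    fix j
    show "coeff q j * monom (c ^ j) j = monom (if j \<le> d then coeff (coeff q j) (d - j) * c ^ j else 0) d"
      by (subst cf) (simp add: mult_monom)
  qed
  also have "\<dots> = monom (\<Sum>j\<le>degree q. if j \<le> d then coeff (coeff q j) (d - j) * c ^ j else 0) d"
    by (rule monom_sum [symmetric])
  finally show ?thesis by blast
qed

text \<open>Comparing components of \<open>p * q\<close> in degree \<open>a + m\<close> for
  \<open>m \<noteq> b\<close> kills the component of degree \<open>m\<close> of \<open>q\<close>, as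
  polynomials form a domain.\<close>

lemma homogeneous3_factor:
  assumes "homogeneous3 a p" "homogeneous3 (a + b) (p * q)" "p \<noteq> 0"
  shows "homogeneous3 b q"
proof -
  have "poly3_comp m q = 0" if "m \<noteq> b" for m
  proof -
    have "poly3_comp (a + m) (q * p) = poly3_comp m q * p"
      using poly3_comp_mult_homogeneous [OF assms(1), of "a + m" q] by simp
    moreover have "poly3_comp (a + m) (q * p) = 0"
      using poly3_comp_homogeneous [OF assms(2), of "a + m"] that by (simp add: mult.commute)
    ultimately show ?thesis using assms(3) by simp
  qed
  note zero = this
  obtain D where D: "q = (\<Sum>n\<le>D. poly3_comp n q)" using poly3_eq_sum_comp by blast
  also have "\<dots> = (\<Sum>n\<le>D. if n = b then poly3_comp b q else 0)"
    by (rule sum.cong) (auto simp: zero)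
  finally have "q = (if b \<le> D then poly3_comp b q else 0)" by simp
  then have "q = poly3_comp b q \<or> q = 0" by presburger
  then show ?thesis by (metis homogeneous3_comp homogeneous3_simps(1))
qed

lemma homogeneous3_coeff_zero:
  "homogeneous3 d p \<Longrightarrow> i + j + k \<noteq> d \<Longrightarrow> coeff (coeff (coeff p k) j) i = 0"
  by (auto simp: homogeneous3_def poly3_coeff_def)

lemma homogeneous3_coeff_gt: "homogeneous3 d p \<Longrightarrow> d < k \<Longrightarrow> coeff p k = 0"
  by (intro poly_eqI) (auto intro: homogeneous3_coeff_zero)

lemma homogeneous3_coeff_top: "homogeneous3 d p \<Longrightarrow> coeff p d = [:[:poly3_coeff p 0 0 d:]:]"
proof (intro poly_eqI)
  fix j i assume "homogeneous3 d p"
  then show "coeff (coeff (coeff p d) j) i = coeff (coeff [:[:poly3_coeff p 0 0 d:]:] j) i"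
    using homogeneous3_coeff_zero [of d p i j d]
    by (auto simp: poly3_coeff_def coeff_pCons split: nat.splits)
qed

lemma homogeneous3_const_coeff:
  assumes "homogeneous3 (d + k) p"
  shows "homogeneous3 d [:coeff p k:]"
proof -
  have "coeff (coeff (coeff p k) j) i \<noteq> 0 \<Longrightarrow> i + j = d" for i j
    using homogeneous3_coeff_zero [OF assms, of i j k] by auto
  then show ?thesis
    by (auto simp: homogeneous3_def poly3_coeff_def coeff_pCons split: nat.splits)
qed

lemma quadratic_form_eq:
  assumes "homogeneous3 2 p"
  shows "p = [:coeff p 0, coeff p 1, [:[:poly3_coeff p 0 0 2:]:]:]"
proof (rule poly_eqI)
  fix n :: nat
  consider "n = 0" | "n = 1" | "n = 2" | "n > 2" by linarith
  then show "coeff p n = coeff [:coeff p 0, coeff p 1, [:[:poly3_coeff p 0 0 2:]:]:] n"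
  proof cases
    case 3
    then show ?thesis using homogeneous3_coeff_top [OF assms] by (simp add: numeral_2_eq_2)
  next
    case 4
    then obtain k where k: "n = Suc (Suc (Suc k))" by (metis less_natE numeral_2_eq_2 add_Suc)
    then show ?thesis using homogeneous3_coeff_gt [OF assms, of n] 4 by simp
  qed simp_all
qed

text \<open>A monomial of degree at least \<open>a + b + c\<close> is divisible by
  \<open>x ^ a\<close>, \<open>y ^ b\<close> or \<open>z ^ c\<close>.\<close>

lemma nil_mod_imp_high_degree:
  assumes J: "is_ideal J" and "nil_mod J var_x" "nil_mod J var_y" "nil_mod J var_z"
  shows "\<exists>T. \<forall>t\<ge>T. \<forall>p. homogeneous3 t p \<longrightarrow> p \<in> J"
proof -
  obtain a b c where abc: "var_x ^ a \<in> J" "var_y ^ b \<in> J" "var_z ^ c \<in> J"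
    using assms by (auto simp: nil_mod_def)
  have up: "v ^ m \<in> J" if "v ^ n \<in> J" "n \<le> m" for v m n
    using that is_idealD(4) [OF J, of "v ^ n" "v ^ (m - n)"] by (simp add: power_add [symmetric])
  show ?thesis
  proof (intro exI [of _ "a + b + c"] allI impI)
    fix t and p :: "'a poly3" assume t: "a + b + c \<le> t" "homogeneous3 t p"
    have "scalar3 e * var_x ^ i * var_y ^ j * var_z ^ k \<in> J" if "i + j + k = t" for e i j k
    proof -
      have "a \<le> i \<or> b \<le> j \<or> c \<le> k" using that t by linarith
      then have "var_x ^ i \<in> J \<or> var_y ^ j \<in> J \<or> var_z ^ k \<in> J" using up abc by blast
      then show ?thesis using is_idealD(3,4) [OF J] by metis
    qed
    then show "p \<in> J"
      by (subst homogeneous3_eq_sum [OF t(2)]) (auto intro!: is_ideal_sum [OF J] simp: exponents_def)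
  qed
qed

section \<open>Ideals with few generators and their linear parameters\<close>

definition ideal2 :: "'a::comm_ring_1 \<Rightarrow> 'a \<Rightarrow> 'a set" where
  "ideal2 f g = {p. \<exists>a b. p = a * f + b * g}"

definition ideal3 :: "'a::comm_ring_1 \<Rightarrow> 'a \<Rightarrow> 'a \<Rightarrow> 'a set" where
  "ideal3 f g h = {p. \<exists>a b c. p = a * f + b * g + c * h}"

lemma is_ideal_ideal3: "is_ideal (ideal3 f g h)"
proof (rule is_idealI)
  have "0 = 0 * f + 0 * g + 0 * h" by simp
  then show "0 \<in> ideal3 f g h" unfolding ideal3_def by blast
next
  fix p q assume "p \<in> ideal3 f g h" "q \<in> ideal3 f g h"
  then obtain a b c a' b' c' where "p = a * f + b * g + c * h" "q = a' * f + b' * g + c' * h"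
    unfolding ideal3_def by blast
  then have "p + q = (a + a') * f + (b + b') * g + (c + c') * h" by (simp add: algebra_simps)
  then show "p + q \<in> ideal3 f g h" unfolding ideal3_def by blast
next
  fix r p assume "p \<in> ideal3 f g h"
  then obtain a b c where "p = a * f + b * g + c * h" unfolding ideal3_def by blast
  then have "r * p = (r * a) * f + (r * b) * g + (r * c) * h" by (simp add: algebra_simps)
  then show "r * p \<in> ideal3 f g h" unfolding ideal3_def by blast
qed

lemma ideal2_eq_ideal3: "ideal2 f g = ideal3 f g 0"
  by (auto simp: ideal2_def ideal3_def)

lemma is_ideal_ideal2: "is_ideal (ideal2 f g)"
  by (simp add: ideal2_eq_ideal3 is_ideal_ideal3)

lemma is_ideal_plus_principal:
  assumes J: "is_ideal J"
  shows "is_ideal {p. \<exists>q. p - l * q \<in> J}"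
proof -
  have "\<exists>q. 0 - l * q \<in> J" using is_idealD(1) [OF J] by (intro exI [of _ 0]) simp
  moreover have "\<exists>q. a + b - l * q \<in> J" if "a - l * q \<in> J" "b - l * q' \<in> J" for a b q q'
    using is_idealD(2) [OF J that] by (intro exI [of _ "q + q'"]) (simp add: algebra_simps)
  moreover have "\<exists>q. r * a - l * q \<in> J" if "a - l * q \<in> J" for a q r
    using is_idealD(3) [OF J that, of r] by (intro exI [of _ "r * q"]) (simp add: algebra_simps)
  ultimately show ?thesis unfolding is_ideal_def by blast
qed

text \<open>\<open>l\<close> is regular modulo \<open>J\<close>, and \<open>P/(J + (l))\<close> vanishes in some degree. For a homogeneous ideal
  \<open>J\<close> this says that \<open>P/J\<close> is one-dimensional and Cohen--Macaulay with parameter \<open>l\<close>.\<close>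

definition linear_parameter :: "'k::field poly3 set \<Rightarrow> 'k poly3 \<Rightarrow> bool" where
  "linear_parameter J l \<longleftrightarrow> homogeneous3 1 l \<and> (\<forall>p. l * p \<in> J \<longrightarrow> p \<in> J) \<and>
     (\<exists>T. \<forall>t\<ge>T. \<forall>p. homogeneous3 t p \<longrightarrow> (\<exists>q. p - l * q \<in> J))"

lemma linear_parameterI:
  assumes J: "is_ideal J" and l: "homogeneous3 1 l" "\<And>p. l * p \<in> J \<Longrightarrow> p \<in> J"
    and nil: "nil_mod {p. \<exists>q. p - l * q \<in> J} var_x" "nil_mod {p. \<exists>q. p - l * q \<in> J} var_y"
      "nil_mod {p. \<exists>q. p - l * q \<in> J} var_z"
  shows "linear_parameter J l"
  using nil_mod_imp_high_degree [OF is_ideal_plus_principal [OF J] nil] l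
  unfolding linear_parameter_def by blast

text \<open>The resultant \<open>R\<close> with respect to \<open>z\<close> is a binary quartic in
  \<open>x\<close> and \<open>y\<close>. If it does not vanish on \<open>y = c x\<close>, then
  \<open>l = y - c x\<close> is a parameter: syzygies stay Koszul modulo \<open>l\<close>, and
  \<open>R\<close>, which lies in the ideal, becomes a nonzero multiple of
  \<open>x ^ 4\<close>.\<close>

lemma coprime_pencil_monic:
  fixes \<phi> \<gamma> :: "'k::{field, field_char_0} poly3"
  assumes \<phi>: "\<phi> = [:b, a, 1:]" "homogeneous3 2 \<phi>" and \<gamma>: "\<gamma> = [:v, u:]" "homogeneous3 2 \<gamma>"
    and res: "v ^ 2 - a * u * v + b * u ^ 2 \<noteq> 0"
  shows "\<exists>l. linear_parameter (ideal2 \<phi> \<gamma>) l"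
proof -
  define R where "R = v ^ 2 - a * u * v + b * u ^ 2"
  have "R \<noteq> 0" using res by (simp add: R_def)
  let ?e = "\<lambda>c::'k. [:0, c:]"
  \<comment> \<open>\<open>R\<close> has finitely many roots in \<open>K[x]\<close>, whereas there
    are infinitely many candidates \<open>c x\<close>.\<close>
  have "finite {x. poly R x = 0}" using \<open>R \<noteq> 0\<close> by (rule poly_roots_finite)
  moreover have "infinite (range ?e)"
    using infinite_UNIV_char_0 finite_imageD [of ?e UNIV] by (auto simp: inj_on_def)
  ultimately obtain c where c: "poly R (?e c) \<noteq> 0"
    by (metis (mono_tags, lifting) finite_subset image_subset_iff mem_Collect_eq)
  define J where "J = ideal2 \<phi> \<gamma>"
  have J: "is_ideal J" by (simp add: J_def is_ideal_ideal2)
  define l where "l = [:[:- ?e c, 1:]:]"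
  have l_eq: "l = var_y - scalar3 c * var_x"
    by (simp add: l_def var_y_def var_x_def scalar3_def)
  have l_hom: "homogeneous3 1 l"
    unfolding l_eq by (intro homogeneous3_simps homogeneous3_vars)
  \<comment> \<open>\<open>?\<rho>\<close> sets \<open>y = c x\<close>, and \<open>?s\<close> is a
    section of it that embeds \<open>K[x][z]\<close> into \<open>K[x][y][z]\<close>.\<close>
  let ?\<rho> = "map_poly (\<lambda>q. poly q (?e c))" and ?s = "map_poly (\<lambda>s::'k poly. [:s:])"
  have \<rho>: "is_ring_hom ?\<rho>" by (intro is_ring_hom_map_poly is_ring_hom_poly)
  note \<rho>D = is_ring_homD [OF \<rho>]
  have \<rho>s: "?\<rho> (?s p) = p" for p by (simp add: poly_eq_iff coeff_map_poly)
  have ker: "\<exists>q. p = l * q" if "?\<rho> p = 0" for p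
  proof -
    have "map_poly (\<lambda>q. [:poly q (?e c):]) p = 0"
    proof (rule poly_eqI)
      fix n
      have "poly (coeff p n) (?e c) = 0"
        using arg_cong [OF that, of "\<lambda>p. coeff p n"] by (simp add: coeff_map_poly)
      then show "coeff (map_poly (\<lambda>q. [:poly q (?e c):]) p) n = coeff 0 n"
        by (simp add: coeff_map_poly)
    qed
    then show ?thesis
      using map_poly_eval_decomp [of p "?e c"] by (auto simp: l_def)
  qed
  have \<rho>l: "?\<rho> l = 0" by (simp add: l_def map_poly_pCons)
  have \<rho>\<phi>: "?\<rho> \<phi> = [:poly b (?e c), poly a (?e c), 1:]" "?\<rho> \<gamma> = [:poly v (?e c), poly u (?e c):]"
    by (simp_all add: \<phi> \<gamma> map_poly_pCons)
  have regular: "p \<in> J" if lp: "l * p \<in> J" for p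
  proof -
    obtain \<alpha> \<beta> where \<alpha>\<beta>: "l * p = \<alpha> * \<phi> + \<beta> * \<gamma>" using lp unfolding J_def ideal2_def by blast
    have "?\<rho> \<alpha> * [:poly b (?e c), poly a (?e c), 1:] + ?\<rho> \<beta> * [:poly v (?e c), poly u (?e c):] = 0"
      using arg_cong [OF \<alpha>\<beta>, of ?\<rho>] unfolding \<rho>D \<rho>l \<rho>\<phi> by simp
    moreover have "poly v (?e c) ^ 2 - poly a (?e c) * poly u (?e c) * poly v (?e c) + poly b (?e c) * poly u (?e c) ^ 2 \<noteq> 0"
      using c by (simp add: R_def)
    ultimately obtain k where k: "?\<rho> \<alpha> = k * ?\<rho> \<gamma>" "?\<rho> \<beta> = - k * ?\<rho> \<phi>"
      unfolding \<rho>\<phi> using syzygy_of_resultant_nonzero by blast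
    \<comment> \<open>Subtracting the lifted Koszul syzygy makes both cofactors multiples of
      \<open>l\<close>. It contributes nothing to the combination, so \<open>l\<close> can be
      cancelled.\<close>
    have "?\<rho> (\<alpha> - ?s k * \<gamma>) = 0" "?\<rho> (\<beta> + ?s k * \<phi>) = 0"
      unfolding \<rho>D \<rho>s k by (simp_all del: mult_pCons_left mult_pCons_right)
    then obtain \<alpha>' \<beta>' where "\<alpha> - ?s k * \<gamma> = l * \<alpha>'" "\<beta> + ?s k * \<phi> = l * \<beta>'"
      using ker by metis
    then have "\<alpha> = ?s k * \<gamma> + l * \<alpha>'" "\<beta> = l * \<beta>' - ?s k * \<phi>"
      by (simp_all add: algebra_simps del: mult_pCons_left mult_pCons_right)
    then have "l * p = (?s k * \<gamma> + l * \<alpha>') * \<phi> + (l * \<beta>' - ?s k * \<phi>) * \<gamma>"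
      using \<alpha>\<beta> by metis
    also have "\<dots> = l * (\<alpha>' * \<phi> + \<beta>' * \<gamma>)"
      by (simp add: algebra_simps del: mult_pCons_left mult_pCons_right)
    finally have "l * p = l * (\<alpha>' * \<phi> + \<beta>' * \<gamma>)" .
    moreover have "l \<noteq> 0" by (simp add: l_def)
    ultimately have "p = \<alpha>' * \<phi> + \<beta>' * \<gamma>" using mult_cancel_left by blast
    then show ?thesis unfolding J_def ideal2_def by blast
  qed
  define J' where "J' = {p. \<exists>q. p - l * q \<in> J}"
  have J': "is_ideal J'" unfolding J'_def by (rule is_ideal_plus_principal [OF J])
  have "\<phi> = 1 * \<phi> + 0 * \<gamma>" "\<gamma> = 0 * \<phi> + 1 * \<gamma>" by simp_all
  then have J\<phi>\<gamma>: "\<phi> \<in> J" "\<gamma> \<in> J" unfolding J_def ideal2_def by blast+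
  have sub: "p \<in> J'" if "p \<in> J" for p
  proof -
    have "p - l * 0 \<in> J" using that by simp
    then show ?thesis unfolding J'_def by blast
  qed
  have "l - l * 1 \<in> J" using is_idealD(1) [OF J] by simp
  then have "l \<in> J'" unfolding J'_def by blast
  then have mem: "\<phi> \<in> J'" "\<gamma> \<in> J'" "l \<in> J'" using sub J\<phi>\<gamma> by blast+
  have aN: "[:a:] = [:coeff \<phi> 1:]" "[:b:] = [:coeff \<phi> 0:]" "[:u:] = [:coeff \<gamma> 1:]" "[:v:] = [:coeff \<gamma> 0:]"
    by (simp_all add: \<phi> \<gamma>)
  have hom: "homogeneous3 1 [:a:]" "homogeneous3 2 [:b:]" "homogeneous3 1 [:u:]" "homogeneous3 2 [:v:]"
    using homogeneous3_const_coeff [of 1 1 \<phi>] homogeneous3_const_coeff [of 2 0 \<phi>]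
      homogeneous3_const_coeff [of 1 1 \<gamma>] homogeneous3_const_coeff [of 2 0 \<gamma>] \<phi>(2) \<gamma>(2)
    unfolding aN by (metis add_0_right one_add_one)+
  have "homogeneous3 4 [:R:]"
  proof -
    have "[:R:] = [:v:] * [:v:] - [:a:] * [:u:] * [:v:] + [:b:] * ([:u:] * [:u:])"
      by (simp add: R_def power2_eq_square)
    moreover have "homogeneous3 (2 + 2) ([:v:] * [:v:])" "homogeneous3 (1 + 1 + 2) ([:a:] * [:u:] * [:v:])"
      "homogeneous3 (2 + (1 + 1)) ([:b:] * ([:u:] * [:u:]))"
      by (intro homogeneous3_mult hom)+
    ultimately show ?thesis
      using homogeneous3_simps(2,3) by (metis (no_types, lifting) numeral_Bit0 one_add_one)
  qed
  then obtain r where r: "poly R (?e c) = monom r 4" 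
    using homogeneous_eval_monom [of 4 R c] homogeneous3_coeff_zero [of 4 "[:R:]" _ _ 0] by auto
  then have "r \<noteq> 0" using c by auto
  \<comment> \<open>The resultant as an explicit combination of the two polynomials, which puts it
    into \<open>J'\<close>.\<close>
  have "[:R:] = [:u ^ 2:] * \<phi> - [:v, u:] * [:a * u - v, u:]"
    unfolding \<phi> R_def by (simp add: algebra_simps power2_eq_square)
  then have R: "[:R:] \<in> J'"
    using is_idealD(6) [OF J' is_idealD(3) [OF J' mem(1)] is_idealD(4) [OF J' mem(2)]] \<gamma>(1) by metis
  have "[:R:] = l * map_poly (\<lambda>q. synthetic_div q (?e c)) [:R:] + [:[:monom r 4:]:]"
    using map_poly_eval_decomp [of "[:R:]" "?e c"] by (simp add: l_def map_poly_pCons r)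
  then have "[:[:monom r 4:]:] = [:R:] - l * map_poly (\<lambda>q. synthetic_div q (?e c)) [:R:]"
    by (metis add_diff_cancel_left')
  then have "[:[:monom r 4:]:] \<in> J'"
    using is_idealD(6) [OF J' R is_idealD(4) [OF J' mem(3)]] by metis
  moreover have "[:[:monom r 4:]:] = scalar3 r * var_x ^ 4"
    using monom3_eq [of r 4 0 0] by (simp add: monom3_def monom_0)
  ultimately have "scalar3 r * var_x ^ 4 \<in> J'" by simp
  then have "scalar3 (1 / r) * (scalar3 r * var_x ^ 4) \<in> J'"
    by (rule is_idealD(3) [OF J'])
  then have "var_x ^ 4 \<in> J'"
    using \<open>r \<noteq> 0\<close> by (simp add: mult.assoc [symmetric] scalar3_mult [symmetric])
  then have nx: "nil_mod J' var_x" unfolding nil_mod_def by blast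
  have "var_y = l + scalar3 c * var_x" by (simp add: l_eq)
  then have ny: "nil_mod J' var_y"
    using nil_mod_add [OF J' nil_mod_in [OF mem(3)] nil_mod_mult [OF J' nx, of "scalar3 c"]] by simp
  \<comment> \<open>A polynomial in \<open>x\<close> and \<open>y\<close> without constant term lies
    in the radical of \<open>J'\<close>; hence so does
    \<open>z ^ 2 = \<phi> - a z - b\<close>.\<close>
  have nn: "nil_mod J' [:p:]" if "coeff (coeff p 0) 0 = 0" for p
  proof -
    obtain p0 p' where p: "p = pCons p0 p'" using pCons_cases by blast
    obtain q0 q' where q: "p0 = pCons q0 q'" using pCons_cases by blast
    have "[:p:] = [:[:q':]:] * var_x + [:p':] * var_y"
      using that by (simp add: p q var_x_def var_y_def)
    then show ?thesis
      using nil_mod_add [OF J' nil_mod_mult [OF J' nx] nil_mod_mult [OF J' ny]] by metis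
  qed
  have "coeff (coeff a 0) 0 = 0" "coeff (coeff b 0) 0 = 0"
    using homogeneous3_coeff_zero [OF hom(1), of 0 0 0] homogeneous3_coeff_zero [OF hom(2), of 0 0 0] by simp_all
  then have "nil_mod J' (\<phi> + (- 1) * (var_z * [:a:] + [:b:]))"
    by (intro nil_mod_add nil_mod_mult J' nil_mod_in [OF mem(1)] nn)
  moreover have "\<phi> + (- 1) * (var_z * [:a:] + [:b:]) = var_z ^ 2"
    by (simp add: \<phi> var_z_def power2_eq_square)
  ultimately have nz: "nil_mod J' var_z" by (auto intro: nil_mod_power)
  have "linear_parameter J l"
    by (rule linear_parameterI [OF J l_hom regular]) (use nx ny nz in \<open>simp_all add: J'_def\<close>)
  then show ?thesis unfolding J_def by blast
qed

text \<open>The linear form \<open>u\<close> is prime in \<open>K[x][y]\<close>, and the vanishing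
  resultant makes it divide \<open>v\<close>. With \<open>v = u w\<close> the resultant then says
  that \<open>z = - w\<close> is a root of \<open>\<phi>\<close>, so \<open>z + w\<close> is the
  common factor.\<close>

lemma common_factor_pencil_monic:
  fixes \<phi> \<gamma> :: "'k::field poly3"
  assumes \<phi>: "\<phi> = [:b, a, 1:]" "homogeneous3 2 \<phi>" and \<gamma>: "\<gamma> = [:v, u:]" "homogeneous3 2 \<gamma>" "\<gamma> \<noteq> 0"
    and res: "v ^ 2 - a * u * v + b * u ^ 2 = 0"
  shows "\<exists>l m n. homogeneous3 1 l \<and> homogeneous3 1 m \<and> homogeneous3 1 n \<and> \<phi> = l * m \<and> \<gamma> = l * n"
proof -
  have u0: "u \<noteq> 0" using res \<gamma> by auto
  have "[:a:] = [:coeff \<phi> 1:]" "[:u:] = [:coeff \<gamma> 1:]" "[:v:] = [:coeff \<gamma> 0:]"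
    by (simp_all add: \<phi> \<gamma>)
  then have hom: "homogeneous3 1 [:a:]" "homogeneous3 1 [:u:]" "homogeneous3 2 [:v:]"
    using homogeneous3_const_coeff [of 1 1 \<phi>] homogeneous3_const_coeff [of 1 1 \<gamma>] homogeneous3_const_coeff [of 2 0 \<gamma>] \<phi>(2) \<gamma>(2)
    by (metis add_0_right one_add_one)+
  define c d where "c = poly3_coeff [:u:] 1 0 0" and "d = poly3_coeff [:u:] 0 1 0"
  have "[:u:] = scalar3 c * var_x + scalar3 d * var_y"
    by (subst homogeneous3_1_eq [OF hom(2)]) (simp add: c_def d_def poly3_coeff_def)
  then have u: "u = [:[:0, c:], [:d:]:]"
    by (simp add: scalar3_def var_x_def var_y_def)
  have prime: "u dvd p \<or> u dvd q" if "u dvd p * q" for p q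
  proof (cases "d = 0")
    case True
    then have "c \<noteq> 0" using u u0 by auto
    then have "prime_elem [:0, c:]" by (rule prime_elem_linear_field_poly)
    then have "prime_elem u" using u True by (simp add: lift_prime_elem_poly)
    then show ?thesis using that by (simp add: prime_elem_dvd_mult_iff)
  next
    case False
    \<comment> \<open>Up to a unit \<open>u\<close> is \<open>y - e\<close>, so divisibility by
      \<open>u\<close> means vanishing at \<open>y = e\<close>.\<close>
    define e where "e = [:0, - c / d:]"
    have ue: "u = [:[:d:]:] * [:- e, 1:]" "[:- e, 1:] = u * [:[:1 / d:]:]"
      using False by (simp_all add: u e_def)
    have "u dvd [:- e, 1:]" by (subst ue(2)) (rule dvd_triv_left)
    moreover have "[:- e, 1:] dvd u" by (subst ue(1)) (rule dvd_triv_right)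
    ultimately have "u dvd p \<longleftrightarrow> poly p e = 0" for p
      unfolding poly_eq_0_iff_dvd by (meson dvd_trans)
    then show ?thesis using that by simp
  qed
  \<comment> \<open>Read modulo \<open>u\<close>, the resultant says that \<open>u\<close> divides
    \<open>v * (v - a * u)\<close>, and each of the two factors leads to \<open>u\<close> dividing
    \<open>v\<close>.\<close>
  have "v * (v - a * u) = u * (- b * u)"
  proof -
    have "v * (v - a * u) - u * (- b * u) = v ^ 2 - a * u * v + b * u ^ 2"
      by (simp add: algebra_simps power2_eq_square)
    then show ?thesis using res by (metis eq_iff_diff_eq_0)
  qed
  then have "u dvd v * (v - a * u)" by simp
  then have "u dvd v" using prime [of v "v - a * u"] by (metis diff_add_cancel dvd_add dvd_triv_right)
  then obtain w where w: "v = u * w" by blast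
  have "u ^ 2 * (w ^ 2 - a * w + b) = 0" using res unfolding w by (simp add: algebra_simps power2_eq_square)
  then have b: "b = a * w - w ^ 2" 
  proof -
    have "w ^ 2 - a * w + b = 0" using \<open>u ^ 2 * (w ^ 2 - a * w + b) = 0\<close> u0 by simp
    then have "(a * w - w ^ 2) + (w ^ 2 - a * w + b) = a * w - w ^ 2" by simp
    then show ?thesis by simp
  qed
  have "homogeneous3 1 [:w:]"
  proof (rule homogeneous3_factor [OF hom(2)])
    have "[:u:] * [:w:] = [:v:]" by (simp add: w)
    then show "homogeneous3 (1 + 1) ([:u:] * [:w:])" using hom(3) by (metis one_add_one)
  qed (use u0 in simp)
  moreover have "\<phi> = (var_z + [:w:]) * (var_z + [:a:] - [:w:])"
    by (simp add: \<phi> b var_z_def power2_eq_square algebra_simps)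
  moreover have "\<gamma> = (var_z + [:w:]) * [:u:]"
    by (simp add: \<gamma> w var_z_def)
  ultimately show ?thesis
    using hom by (intro exI [of _ "var_z + [:w:]"] exI [of _ "var_z + [:a:] - [:w:]"] exI [of _ "[:u:]"] conjI
      homogeneous3_simps homogeneous3_vars)
qed

section \<open>Change of coordinates and normal form of a pencil\<close>

lemma graded_autD:
  assumes "graded_aut \<sigma>"
  shows "is_ring_hom \<sigma>" "\<sigma> (scalar3 c) = scalar3 c" "bij \<sigma>" "homogeneous3 d (\<sigma> p) \<longleftrightarrow> homogeneous3 d p"
    "\<exists>q. p = \<sigma> q" "\<sigma> p = \<sigma> q \<longleftrightarrow> p = q"
proof -
  show "is_ring_hom \<sigma>" "\<sigma> (scalar3 c) = scalar3 c" and bij: "bij \<sigma>" and "homogeneous3 d (\<sigma> p) \<longleftrightarrow> homogeneous3 d p"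
    using assms unfolding graded_aut_def by blast+
  show "\<exists>q. p = \<sigma> q" using bij by (metis bij_pointE)
  show "\<sigma> p = \<sigma> q \<longleftrightarrow> p = q" using bij by (simp add: bij_def inj_eq)
qed

lemma graded_aut_inv:
  assumes "graded_aut \<sigma>"
  shows "graded_aut (inv_into UNIV \<sigma>)"
proof -
  note s = graded_autD [OF assms] and h = is_ring_homD [OF graded_autD(1) [OF assms]]
  have inv: "\<sigma> (inv_into UNIV \<sigma> p) = p" "inv_into UNIV \<sigma> (\<sigma> p) = p" for p
    using s(3) by (simp_all add: bij_def surj_f_inv_f)
  have "inv_into UNIV \<sigma> 1 = 1" "inv_into UNIV \<sigma> (scalar3 c) = scalar3 c" for c using inv(2) h(1) s(2) by metis+
  moreover have "inv_into UNIV \<sigma> (a + b) = inv_into UNIV \<sigma> a + inv_into UNIV \<sigma> b" "inv_into UNIV \<sigma> (a * b) = inv_into UNIV \<sigma> a * inv_into UNIV \<sigma> b" for a b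
    using inv h(2,3) by metis+
  moreover have "homogeneous3 d (inv_into UNIV \<sigma> p) \<longleftrightarrow> homogeneous3 d p" for d p
    using s(4) [of d "inv_into UNIV \<sigma> p"] inv by simp
  ultimately show ?thesis
    using s(3) by (simp add: graded_aut_def is_ring_hom_def bij_imp_bij_inv)
qed

lemma graded_aut_image_ideal3:
  assumes "graded_aut \<sigma>"
  shows "\<sigma> ` ideal3 f g h = ideal3 (\<sigma> f) (\<sigma> g) (\<sigma> h)"
proof
  note s = graded_autD [OF assms] and hom = is_ring_homD [OF graded_autD(1) [OF assms]]
  show "\<sigma> ` ideal3 f g h \<subseteq> ideal3 (\<sigma> f) (\<sigma> g) (\<sigma> h)"
  proof
    fix p assume "p \<in> \<sigma> ` ideal3 f g h"
    then obtain a b c where "p = \<sigma> (a * f + b * g + c * h)" by (auto simp: ideal3_def)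
    then have "p = \<sigma> a * \<sigma> f + \<sigma> b * \<sigma> g + \<sigma> c * \<sigma> h" by (simp add: hom)
    then show "p \<in> ideal3 (\<sigma> f) (\<sigma> g) (\<sigma> h)" unfolding ideal3_def by blast
  qed
  show "ideal3 (\<sigma> f) (\<sigma> g) (\<sigma> h) \<subseteq> \<sigma> ` ideal3 f g h"
  proof
    fix p assume "p \<in> ideal3 (\<sigma> f) (\<sigma> g) (\<sigma> h)"
    then obtain a b c where "p = a * \<sigma> f + b * \<sigma> g + c * \<sigma> h" by (auto simp: ideal3_def)
    moreover obtain a' b' c' where "a = \<sigma> a'" "b = \<sigma> b'" "c = \<sigma> c'" using s(5) by metis
    ultimately have "p = \<sigma> (a' * f + b' * g + c' * h)" by (simp add: hom)
    then show "p \<in> \<sigma> ` ideal3 f g h" by (auto simp: ideal3_def)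
  qed
qed

lemma graded_aut_image_ideal2:
  "graded_aut \<sigma> \<Longrightarrow> \<sigma> ` ideal2 f g = ideal2 (\<sigma> f) (\<sigma> g)"
  using graded_aut_image_ideal3 [of \<sigma> f g 0] is_ring_homD(4) [OF graded_autD(1), of \<sigma>]
  by (simp add: ideal2_eq_ideal3)

lemma linear_parameter_image:
  assumes "graded_aut \<sigma>" "linear_parameter J l"
  shows "linear_parameter (\<sigma> ` J) (\<sigma> l)"
proof -
  note s = graded_autD [OF assms(1)] and h = is_ring_homD [OF graded_autD(1) [OF assms(1)]]
  have inj: "\<sigma> p \<in> \<sigma> ` J \<longleftrightarrow> p \<in> J" for p using s(6) by auto
  have "p \<in> \<sigma> ` J" if "\<sigma> l * p \<in> \<sigma> ` J" for p
  proof -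
    obtain q where q: "p = \<sigma> q" using s(5) by blast
    then have "\<sigma> (l * q) \<in> \<sigma> ` J" using that by (simp add: h)
    then show ?thesis using assms(2) q inj by (auto simp: linear_parameter_def)
  qed
  moreover obtain T where T: "\<And>t p. t \<ge> T \<Longrightarrow> homogeneous3 t p \<Longrightarrow> \<exists>q. p - l * q \<in> J"
    using assms(2) unfolding linear_parameter_def by blast
  have "\<exists>q. p - \<sigma> l * q \<in> \<sigma> ` J" if t: "t \<ge> T" "homogeneous3 t p" for t p
  proof -
    obtain p' where p': "p = \<sigma> p'" using s(5) by blast
    then obtain q where "p' - l * q \<in> J" using T [of t p'] t s(4) by auto
    then have "\<sigma> (p' - l * q) \<in> \<sigma> ` J" by simp
    then show ?thesis unfolding p' by (auto simp: h)
  qed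
  ultimately show ?thesis
    using assms(2) s(4) unfolding linear_parameter_def by blast
qed

lemma exponents_2: "exponents 2 = {(0,0,2), (0,1,1), (0,2,0), (1,0,1), (1,1,0), (2,0,0)}"
proof
  show "exponents 2 \<subseteq> {(0,0,2), (0,1,1), (0,2,0), (1,0,1), (1,1,0), (2,0,0)}"
  proof
    fix t assume "t \<in> exponents 2"
    then obtain i j k where t: "t = (i, j, k)" "i + j + k = 2" by (auto simp: exponents_def)
    then have "i = 0 \<or> i = 1 \<or> i = 2" "j = 0 \<or> j = 1 \<or> j = 2" "k = 2 - i - j" by linarith+
    then show "t \<in> {(0,0,2), (0,1,1), (0,2,0), (1,0,1), (1,1,0), (2,0,0)}"
      using t(2) unfolding t(1) by (elim disjE) simp_all
  qed
qed (simp add: exponents_def)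

lemma poly3_coeff_linear_mult:
  assumes "homogeneous3 1 l" "homogeneous3 1 m"
  shows "poly3_coeff (l * m) 0 0 2 = poly3_coeff l 0 0 1 * poly3_coeff m 0 0 1"
proof -
  have "poly3_coeff l 0 0 0 = 0" "poly3_coeff m 0 0 0 = 0"
    using assms unfolding homogeneous3_def by fastforce+
  then show ?thesis by (simp add: poly3_coeff_mult numeral_2_eq_2)
qed

text \<open>The coefficient of \<open>z ^ 2\<close> after a substitution is the value of
  \<open>\<phi>\<close> at the vector of \<open>z\<close>-coefficients of \<open>l\<close>,
  \<open>m\<close>, \<open>n\<close>. A nonzero quadratic form is nonzero at a unit vector or, if
  its square coefficients vanish, at a sum of two unit vectors.\<close>

lemma exists_graded_aut_monic:
  fixes \<phi> :: "'k::field poly3"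
  assumes \<phi>: "homogeneous3 2 \<phi>" "\<phi> \<noteq> 0"
  shows "\<exists>\<tau>. graded_aut \<tau> \<and> poly3_coeff (\<tau> \<phi>) 0 0 2 \<noteq> 0"
proof -
  let ?c = "poly3_coeff \<phi>"
  have eval: "poly3_coeff (subst3 l m n \<phi>) 0 0 2 =
      ?c 0 0 2 * poly3_coeff n 0 0 1 ^ 2 + ?c 0 1 1 * (poly3_coeff m 0 0 1 * poly3_coeff n 0 0 1)
      + ?c 0 2 0 * poly3_coeff m 0 0 1 ^ 2 + ?c 1 0 1 * (poly3_coeff l 0 0 1 * poly3_coeff n 0 0 1)
      + ?c 1 1 0 * (poly3_coeff l 0 0 1 * poly3_coeff m 0 0 1) + ?c 2 0 0 * poly3_coeff l 0 0 1 ^ 2"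
    if lin: "homogeneous3 1 l" "homogeneous3 1 m" "homogeneous3 1 n" for l m n
  proof -
    have "subst3 l m n \<phi> = scalar3 (?c 0 0 2) * (n * n) + scalar3 (?c 0 1 1) * (m * n) + scalar3 (?c 0 2 0) * (m * m)
        + scalar3 (?c 1 0 1) * (l * n) + scalar3 (?c 1 1 0) * (l * m) + scalar3 (?c 2 0 0) * (l * l)"
      by (subst homogeneous3_eq_sum [OF \<phi>(1)])
        (simp add: exponents_2 is_ring_homD [OF is_ring_hom_subst3] power2_eq_square mult.assoc)
    then show ?thesis
      by (simp only: poly3_coeff_simps poly3_coeff_scalar_mult poly3_coeff_linear_mult lin power2_eq_square)
  qed
  have lin: "homogeneous3 1 (var_y + var_z :: 'k poly3)" "homogeneous3 1 (var_x + var_z :: 'k poly3)"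
    by (intro homogeneous3_simps homogeneous3_vars)+
  have ind: "lin_indep3 l m n"
    if "\<And>a b c. (\<And>i j k. poly3_coeff (scalar3 a * l + scalar3 b * m + scalar3 c * n) i j k = 0) \<Longrightarrow> a = 0 \<and> b = 0 \<and> c = 0"
    for l m n :: "'k poly3"
    unfolding lin_indep3_def
  proof (intro allI impI)
    fix a b c assume eq: "scalar3 a * l + scalar3 b * m + scalar3 c * n = 0"
    show "a = 0 \<and> b = 0 \<and> c = 0" by (rule that) (simp only: eq poly3_coeff_simps)
  qed
  have coord: "P" if "\<And>i j k. poly3_coeff p i j k = 0"
    "poly3_coeff p 1 0 0 = 0 \<Longrightarrow> poly3_coeff p 0 1 0 = 0 \<Longrightarrow> poly3_coeff p 0 0 1 = 0 \<Longrightarrow> P" for p :: "'k poly3" and P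
    using that by blast
  note aut = graded_aut_subst3 [OF _ _ _ ind]
  have auts: "graded_aut (subst3 var_x var_y (var_z::'k poly3))"
    "graded_aut (subst3 var_z var_y (var_x::'k poly3))"
    "graded_aut (subst3 var_x var_z (var_y::'k poly3))"
    "graded_aut (subst3 var_z (var_y + var_z) (var_x::'k poly3))"
    "graded_aut (subst3 var_z var_y (var_x + var_z::'k poly3))"
    "graded_aut (subst3 var_x var_z (var_y + var_z::'k poly3))"
    by (rule aut; (rule homogeneous3_vars lin | (erule coord, simp)))+
  have "?c 0 0 2 \<noteq> 0 \<or> ?c 0 1 1 \<noteq> 0 \<or> ?c 0 2 0 \<noteq> 0 \<or> ?c 1 0 1 \<noteq> 0 \<or> ?c 1 1 0 \<noteq> 0 \<or> ?c 2 0 0 \<noteq> 0"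
    using \<phi>(2) homogeneous3_eq_sum [OF \<phi>(1)] by (auto simp: exponents_2)
  then consider "?c 0 0 2 \<noteq> 0" | "?c 2 0 0 \<noteq> 0" | "?c 0 2 0 \<noteq> 0"
    | "?c 0 0 2 = 0" "?c 2 0 0 = 0" "?c 0 2 0 = 0" "?c 1 1 0 \<noteq> 0"
    | "?c 0 0 2 = 0" "?c 2 0 0 = 0" "?c 0 2 0 = 0" "?c 1 0 1 \<noteq> 0"
    | "?c 0 0 2 = 0" "?c 2 0 0 = 0" "?c 0 2 0 = 0" "?c 0 1 1 \<noteq> 0"
    by blast
  then show ?thesis
  proof cases
    case 1
    then show ?thesis by (intro exI [of _ "subst3 var_x var_y var_z"]) (simp add: auts eval)
  next
    case 2
    then show ?thesis by (intro exI [of _ "subst3 var_z var_y var_x"]) (simp add: auts eval)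
  next
    case 3
    then show ?thesis by (intro exI [of _ "subst3 var_x var_z var_y"]) (simp add: auts eval)
  next
    case 4
    then show ?thesis by (intro exI [of _ "subst3 var_z (var_y + var_z) var_x"]) (simp add: auts eval)
  next
    case 5
    then show ?thesis by (intro exI [of _ "subst3 var_z var_y (var_x + var_z)"]) (simp add: auts eval)
  next
    case 6
    then show ?thesis by (intro exI [of _ "subst3 var_x var_z (var_y + var_z)"]) (simp add: auts eval)
  qed
qed

lemma ideal2_change: "ideal2 (u * f) (g + c * f) = ideal2 f g" if "v * u = 1" for f g u v c :: "'a::comm_ring_1"
proof
  show "ideal2 (u * f) (g + c * f) \<subseteq> ideal2 f g"
  proof
    fix p assume "p \<in> ideal2 (u * f) (g + c * f)"
    then obtain a b where "p = a * (u * f) + b * (g + c * f)" by (auto simp: ideal2_def)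
    then have "p = (a * u + b * c) * f + b * g" by (simp add: algebra_simps)
    then show "p \<in> ideal2 f g" unfolding ideal2_def by blast
  qed
  show "ideal2 f g \<subseteq> ideal2 (u * f) (g + c * f)"
  proof
    fix p assume "p \<in> ideal2 f g"
    then obtain a b where "p = a * f + b * g" by (auto simp: ideal2_def)
    moreover have "f = (v * u) * f" using that by simp
    ultimately have "p = (a - b * c) * v * (u * f) + b * (g + c * f)" by (simp add: algebra_simps)
    then show "p \<in> ideal2 (u * f) (g + c * f)" unfolding ideal2_def by blast
  qed
qed

text \<open>After scaling, \<open>\<phi>\<close> is monic in \<open>z\<close>, and subtracting a
  multiple of it removes \<open>z ^ 2\<close> from \<open>\<gamma>\<close>. The dichotomy is whether
  the resultant vanishes.\<close>

lemma conic_pencil_monic: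
  fixes \<phi> \<gamma> :: "'k::{field, field_char_0} poly3"
  assumes \<phi>: "homogeneous3 2 \<phi>" "poly3_coeff \<phi> 0 0 2 \<noteq> 0"
    and \<gamma>: "homogeneous3 2 \<gamma>" "\<And>c. \<gamma> \<noteq> scalar3 c * \<phi>"
  shows "(\<exists>l. linear_parameter (ideal2 \<phi> \<gamma>) l) \<and>
      (\<forall>\<alpha> \<beta>. \<alpha> * \<phi> + \<beta> * \<gamma> = 0 \<longrightarrow> (\<exists>c. \<alpha> = c * \<gamma> \<and> \<beta> = - c * \<phi>)) \<or>
    (\<exists>l m n c. homogeneous3 1 l \<and> homogeneous3 1 m \<and> homogeneous3 1 n \<and> \<phi> = l * m \<and> \<gamma> = scalar3 c * \<phi> + l * n)"
proof -
  define e where "e = poly3_coeff \<phi> 0 0 2"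
  define d where "d = poly3_coeff \<gamma> 0 0 2"
  define \<phi>1 where "\<phi>1 = scalar3 (1 / e) * \<phi>"
  define \<gamma>1 where "\<gamma>1 = \<gamma> + scalar3 (- d / e) * \<phi>"
  have e: "e \<noteq> 0" using \<phi> by (simp add: e_def)
  have \<phi>_eq: "\<phi> = scalar3 e * \<phi>1"
    using e by (simp add: \<phi>1_def mult.assoc [symmetric] scalar3_mult [symmetric])
  have \<gamma>_eq: "\<gamma> = scalar3 (d / e) * \<phi> + \<gamma>1"
    by (simp add: \<gamma>1_def scalar3_minus)
  have hom: "homogeneous3 2 \<phi>1" "homogeneous3 2 \<gamma>1"
    by (simp_all add: \<phi>1_def \<gamma>1_def \<phi> \<gamma>)
  have c1: "poly3_coeff \<phi>1 0 0 2 = 1" "poly3_coeff \<gamma>1 0 0 2 = 0"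
    using e by (simp_all add: \<phi>1_def \<gamma>1_def e_def [symmetric] d_def [symmetric])
  obtain a b where ab: "\<phi>1 = [:b, a, 1:]"
    using quadratic_form_eq [OF hom(1)] c1 by (metis one_pCons)
  obtain u v where uv: "\<gamma>1 = [:v, u:]"
    using quadratic_form_eq [OF hom(2)] c1 by (metis pCons_0_0)
  have "\<gamma>1 \<noteq> 0" using \<gamma>(2) \<gamma>_eq by (metis add.right_neutral)
  have id: "ideal2 \<phi>1 \<gamma>1 = ideal2 \<phi> \<gamma>"
    unfolding \<phi>1_def \<gamma>1_def using e
    by (intro ideal2_change [of "scalar3 e"]) (simp add: scalar3_mult [symmetric])
  show ?thesis
  proof (cases "v ^ 2 - a * u * v + b * u ^ 2 = 0")
    case True
    from common_factor_pencil_monic [OF ab hom(1) uv hom(2) \<open>\<gamma>1 \<noteq> 0\<close> True]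
    obtain l m n where lmn: "homogeneous3 1 l" "homogeneous3 1 m" "homogeneous3 1 n" "\<phi>1 = l * m" "\<gamma>1 = l * n"
      by blast
    have "\<phi> = l * (scalar3 e * m)" "\<gamma> = scalar3 (d / e) * \<phi> + l * n"
      using \<phi>_eq \<gamma>_eq lmn by (simp_all add: mult.left_commute)
    moreover have "homogeneous3 1 (scalar3 e * m)" using lmn(2) by (rule homogeneous3_simps)
    ultimately show ?thesis using lmn by blast
  next
    case False
    have "\<exists>c. \<alpha> = c * \<gamma> \<and> \<beta> = - c * \<phi>" if "\<alpha> * \<phi> + \<beta> * \<gamma> = 0" for \<alpha> \<beta>
    proof -
      \<comment> \<open>A syzygy of the given forms, rewritten as one of the normalised
        pair.\<close>
      have "(\<alpha> + \<beta> * scalar3 (d / e)) * scalar3 e * \<phi>1 + \<beta> * \<gamma>1 = \<alpha> * \<phi> + \<beta> * \<gamma>"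
        unfolding \<gamma>_eq unfolding \<phi>_eq by (simp add: algebra_simps)
      then have "(\<alpha> + \<beta> * scalar3 (d / e)) * scalar3 e * [:b, a, 1:] + \<beta> * [:v, u:] = 0"
        using that ab uv by metis
      from syzygy_of_resultant_nonzero [OF False this]
      obtain k where k: "(\<alpha> + \<beta> * scalar3 (d / e)) * scalar3 e = k * \<gamma>1" "\<beta> = - k * \<phi>1"
        unfolding ab uv by blast
      define c where "c = k * scalar3 (1 / e)"
      have kc: "k = c * scalar3 e" using e by (simp add: c_def mult.assoc scalar3_mult [symmetric])
      have \<beta>: "\<beta> = - c * \<phi>" using k(2) unfolding kc \<phi>_eq by (simp add: mult.assoc)
      have "(\<alpha> + \<beta> * scalar3 (d / e)) * scalar3 e = (c * \<gamma>1) * scalar3 e"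
        unfolding k(1) kc by (simp add: mult_ac)
      then have "\<alpha> + \<beta> * scalar3 (d / e) = c * \<gamma>1" using e by simp
      then have "\<alpha> = c * \<gamma>" unfolding \<gamma>_eq \<beta> by (simp add: algebra_simps)
      with \<beta> show ?thesis by blast
    qed
    moreover have "\<exists>l. linear_parameter (ideal2 \<phi> \<gamma>) l"
      using coprime_pencil_monic [OF ab hom(1) uv hom(2) False] unfolding id .
    ultimately show ?thesis by blast
  qed
qed

text \<open>In suitable coordinates \<open>\<phi>\<close> is monic in \<open>z\<close>. Both
  alternatives are invariant under linear changes of coordinates, so they can be carried
  back.\<close>

theorem conic_pencil:
  fixes \<phi> \<gamma> :: "'k::{field, field_char_0} poly3"
  assumes \<phi>: "homogeneous3 2 \<phi>" "\<phi> \<noteq> 0"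
    and \<gamma>: "homogeneous3 2 \<gamma>" "\<And>c. \<gamma> \<noteq> scalar3 c * \<phi>"
  shows "(\<exists>l. linear_parameter (ideal2 \<phi> \<gamma>) l) \<and>
      (\<forall>\<alpha> \<beta>. \<alpha> * \<phi> + \<beta> * \<gamma> = 0 \<longrightarrow> (\<exists>c. \<alpha> = c * \<gamma> \<and> \<beta> = - c * \<phi>)) \<or>
    (\<exists>l m n c. homogeneous3 1 l \<and> homogeneous3 1 m \<and> homogeneous3 1 n \<and> \<phi> = l * m \<and> \<gamma> = scalar3 c * \<phi> + l * n)"
proof -
  obtain \<tau> where \<tau>: "graded_aut \<tau>" "poly3_coeff (\<tau> \<phi>) 0 0 2 \<noteq> 0"
    using exists_graded_aut_monic [OF \<phi>] by blast
  define \<sigma> where "\<sigma> = inv_into UNIV \<tau>"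
  have \<sigma>: "graded_aut \<sigma>" unfolding \<sigma>_def by (rule graded_aut_inv [OF \<tau>(1)])
  note t = graded_autD [OF \<tau>(1)] and s = graded_autD [OF \<sigma>]
  note ht = is_ring_homD [OF t(1)] and hs = is_ring_homD [OF s(1)]
  have st: "\<sigma> (\<tau> p) = p" for p using t(3) by (simp add: \<sigma>_def bij_def)
  have hom: "homogeneous3 2 (\<tau> \<phi>)" "homogeneous3 2 (\<tau> \<gamma>)" using \<phi> \<gamma> t(4) by blast+
  have ns: "\<tau> \<gamma> \<noteq> scalar3 c * \<tau> \<phi>" for c
  proof
    assume "\<tau> \<gamma> = scalar3 c * \<tau> \<phi>"
    then have "\<tau> \<gamma> = \<tau> (scalar3 c * \<phi>)" by (simp add: ht t(2))
    then show False using \<gamma>(2) t(6) by blast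
  qed
  from conic_pencil_monic [OF hom(1) \<tau>(2) hom(2) ns] show ?thesis
  proof (elim disjE conjE exE)
    fix l assume "linear_parameter (ideal2 (\<tau> \<phi>) (\<tau> \<gamma>)) l"
      and syz: "\<forall>\<alpha> \<beta>. \<alpha> * \<tau> \<phi> + \<beta> * \<tau> \<gamma> = 0 \<longrightarrow> (\<exists>c. \<alpha> = c * \<tau> \<gamma> \<and> \<beta> = - c * \<tau> \<phi>)"
    then have "linear_parameter (ideal2 \<phi> \<gamma>) (\<sigma> l)"
      using linear_parameter_image [OF \<sigma>] graded_aut_image_ideal2 [OF \<sigma>] st by metis
    moreover have "\<exists>c. \<alpha> = c * \<gamma> \<and> \<beta> = - c * \<phi>" if "\<alpha> * \<phi> + \<beta> * \<gamma> = 0" for \<alpha> \<beta>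
    proof -
      have "\<tau> \<alpha> * \<tau> \<phi> + \<tau> \<beta> * \<tau> \<gamma> = 0" using arg_cong [OF that, of \<tau>] by (simp add: ht)
      then obtain c where "\<tau> \<alpha> = c * \<tau> \<gamma>" "\<tau> \<beta> = - c * \<tau> \<phi>" using syz by blast
      then have "\<sigma> (\<tau> \<alpha>) = \<sigma> c * \<sigma> (\<tau> \<gamma>)" "\<sigma> (\<tau> \<beta>) = - \<sigma> c * \<sigma> (\<tau> \<phi>)" by (simp_all add: hs)
      then show ?thesis unfolding st by blast
    qed
    ultimately show ?thesis by blast
  next
    fix l m n c assume lmn: "homogeneous3 1 l" "homogeneous3 1 m" "homogeneous3 1 n"
      and "\<tau> \<phi> = l * m" "\<tau> \<gamma> = scalar3 c * \<tau> \<phi> + l * n"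
    then have "\<sigma> (\<tau> \<phi>) = \<sigma> l * \<sigma> m" "\<sigma> (\<tau> \<gamma>) = scalar3 c * \<sigma> (\<tau> \<phi>) + \<sigma> l * \<sigma> n"
      by (simp_all add: hs s(2))
    then show ?thesis unfolding st using lmn s(4) by blast
  qed
qed

section \<open>A line and a plane curve through a point\<close>

lemma var_syzygy:
  fixes a b :: "'k::field poly3"
  assumes "a * var_y + b * var_z = 0"
  shows "\<exists>c. a = c * var_z \<and> b = - c * var_y"
proof -
  obtain a0 c where a: "a = pCons a0 c" using pCons_cases by blast
  have "coeff (a * var_y + b * var_z) 0 = a0 * [:0, 1:]"
    by (simp add: a var_y_def var_z_def)
  then have "a0 = 0" using assms by simp
  then have ac: "a = c * var_z" by (simp add: a var_z_def)
  have "(b + c * var_y) * var_z = 0" using assms by (simp add: ac algebra_simps)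
  then have "b + c * var_y = 0" by (simp add: var_z_def)
  then show ?thesis using ac by (auto simp: add_eq_0_iff)
qed

text \<open>Setting \<open>y = z = 0\<close> shows that \<open>x\<close> times the part of
  \<open>a\<close> free of \<open>y\<close> and \<open>z\<close> is zero.\<close>

lemma var_regular:
  fixes a b c :: "'k::field poly3"
  assumes "var_x * a = b * var_y + c * var_z"
  shows "\<exists>b c. a = b * var_y + c * var_z"
proof -
  obtain a0 a1 where a: "a = pCons a0 a1" using pCons_cases by blast
  obtain a00 a01 where a0: "a0 = pCons a00 a01" using pCons_cases by blast
  have "coeff (coeff (var_x * a) 0) 0 = [:0, 1:] * a00"
    by (simp add: a a0 var_x_def)
  moreover have "coeff (coeff (b * var_y + c * var_z) 0) 0 = 0"
    by (simp add: var_y_def var_z_def)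
  ultimately have "a00 = 0" using assms by simp
  then have "a = [:a01:] * var_y + a1 * var_z"
    by (simp add: a a0 var_y_def var_z_def)
  then show ?thesis by blast
qed

lemma map_poly2_eval_0_decomp:
  fixes p :: "'k::field poly3"
  shows "p = var_x * map_poly (map_poly (\<lambda>r. synthetic_div r 0)) p
    + map_poly (map_poly (\<lambda>c. [:c:])) (map_poly (map_poly (\<lambda>r. poly r 0)) p)"
proof (intro poly_eqI)
  fix k j i
  have "coeff p k = [:[:0, 1:]:] * map_poly (\<lambda>r. synthetic_div r 0) (coeff p k)
      + map_poly (\<lambda>c. [:c:]) (map_poly (\<lambda>r. poly r 0) (coeff p k))"
  proof (rule poly_eqI)
    fix j
    show "coeff (coeff p k) j = coeff ([:[:0, 1:]:] * map_poly (\<lambda>r. synthetic_div r 0) (coeff p k)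
      + map_poly (\<lambda>c. [:c:]) (map_poly (\<lambda>r. poly r 0) (coeff p k))) j"
      using synthetic_div_correct' [of 0 "coeff (coeff p k) j"] by (simp add: coeff_map_poly)
  qed
  then show "coeff (coeff (coeff p k) j) i = coeff (coeff (coeff (var_x * map_poly (map_poly (\<lambda>r. synthetic_div r 0)) p
    + map_poly (map_poly (\<lambda>c. [:c:])) (map_poly (map_poly (\<lambda>r. poly r 0)) p)) k) j) i"
    by (simp add: coeff_map_poly var_x_def)
qed

text \<open>The ideal is \<open>(y, z) \<inter> (x, h)\<close>. Its parameter
  \<open>l = x + l'\<close> is congruent to \<open>x\<close> modulo \<open>(y, z)\<close> and to
  \<open>l' = z - c y\<close> modulo \<open>(x, h)\<close>. The constant \<open>c\<close> is chosen
  so that \<open>l'\<close> does not divide \<open>h(0, y, z)\<close>, which makes both residues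
  regular.\<close>

lemma linear_parameter_line_and_lines:
  fixes h :: "'k::{field, field_char_0} poly3"
  assumes h: "homogeneous3 d h" "h = h1 * var_y + h2 * var_z" "\<And>u. h \<noteq> var_x * u"
  shows "\<exists>l. linear_parameter (ideal3 (var_x * var_y) (var_x * var_z) h) l"
proof -
  let ?r = "map_poly (map_poly (\<lambda>r. poly r 0)) :: 'k poly3 \<Rightarrow> 'k poly poly"
  let ?s = "map_poly (map_poly (\<lambda>c. [:c:])) :: 'k poly poly \<Rightarrow> 'k poly3"
  have r: "is_ring_hom ?r" by (intro is_ring_hom_map_poly is_ring_hom_poly)
  have s: "is_ring_hom ?s" by (intro is_ring_hom_map_poly) (simp add: is_ring_hom_def one_pCons)
  note rD = is_ring_homD [OF r] and sD = is_ring_homD [OF s]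
  have rs: "?r (?s p) = p" for p by (simp add: poly_eq_iff coeff_map_poly)
  have decomp: "\<exists>q. p = var_x * q + ?s (?r p)" for p
    using map_poly2_eval_0_decomp [of p] by blast
  define H where "H = ?r h"
  have "H \<noteq> 0"
  proof
    assume "H = 0"
    moreover obtain q where "h = var_x * q + ?s (?r h)" using decomp by blast
    ultimately have "h = var_x * q" by (simp add: H_def)
    then show False using h(3) by blast
  qed
  let ?e = "\<lambda>c::'k. [:0, c:]"
  have "finite {x. poly H x = 0}" using \<open>H \<noteq> 0\<close> by (rule poly_roots_finite)
  moreover have "infinite (range ?e)"
    using infinite_UNIV_char_0 finite_imageD [of ?e UNIV] by (auto simp: inj_on_def)
  ultimately obtain c where c: "poly H (?e c) \<noteq> 0"
    by (metis (mono_tags, lifting) finite_subset image_subset_iff mem_Collect_eq)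
  have "\<exists>r. poly H (?e c) = monom r d"
  proof (rule homogeneous_eval_monom)
    fix i j :: nat assume "i + j \<noteq> d"
    then have "coeff (coeff (coeff h j) i) 0 = 0"
      using homogeneous3_coeff_zero [OF h(1), of 0 i j] by simp
    then show "coeff (coeff H j) i = 0"
      by (simp add: H_def coeff_map_poly poly_0_coeff_0)
  qed
  then obtain \<rho> where \<rho>: "poly H (?e c) = monom \<rho> d" by blast
  then have "\<rho> \<noteq> 0" using c by auto
  define J where "J = ideal3 (var_x * var_y) (var_x * var_z) h"
  have J: "is_ideal J" by (simp add: J_def is_ideal_ideal3)
  define l' where "l' = var_z - scalar3 c * var_y"
  define l where "l = var_x + l'"
  have l_hom: "homogeneous3 1 l"
    unfolding l_def l'_def by (intro homogeneous3_simps homogeneous3_vars)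
  have rl: "?r l' = [:- ?e c, 1:]" and sl: "?s [:- ?e c, 1:] = l'" and rx: "?r var_x = 0"
    by (simp_all add: l'_def var_x_def var_y_def var_z_def scalar3_def map_poly_pCons one_pCons)
  \<comment> \<open>Setting \<open>x = 0\<close> turns \<open>(x, h)\<close> into the ideal of
    \<open>H\<close>. As \<open>H\<close> does not vanish at \<open>z = c y\<close>, the factor
    \<open>z - c y\<close> must divide the cofactor of \<open>H\<close>.\<close>
  have mod_xh: "\<exists>a b. u = var_x * a + h * b" if u: "l' * u = var_x * a + h * b" for u a b
  proof -
    have eq: "[:- ?e c, 1:] * ?r u = H * ?r b"
      using arg_cong [OF u, of ?r] unfolding rD rl rx H_def by simp
    have "poly H (?e c) * poly (?r b) (?e c) = 0"
      using arg_cong [OF eq, of "\<lambda>p. poly p (?e c)"] unfolding poly_mult by simp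
    then have "[:- ?e c, 1:] dvd ?r b" using c by (simp add: poly_eq_0_iff_dvd)
    then obtain w where w: "?r b = [:- ?e c, 1:] * w" by blast
    have "[:- ?e c, 1:] * ?r u = [:- ?e c, 1:] * (H * w)"
      using eq unfolding w by (metis mult.left_commute)
    then have "?r u = H * w" by (metis mult_cancel_left pCons_eq_0_iff one_neq_zero)
    then have "?r (u - h * ?s w) = 0" by (simp only: rD rs H_def) simp
    moreover obtain q where "u - h * ?s w = var_x * q + ?s (?r (u - h * ?s w))" using decomp by blast
    ultimately have "u - h * ?s w = var_x * q" by simp
    then have "u = var_x * q + h * ?s w" by (simp add: algebra_simps)
    then show ?thesis by blast
  qed
  have regular: "p \<in> J" if lp: "l * p \<in> J" for p
  proof -
    obtain a b k where abk: "l * p = a * (var_x * var_y) + b * (var_x * var_z) + k * h"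
      using lp unfolding J_def ideal3_def by blast
    \<comment> \<open>Modulo \<open>(y, z)\<close> the element \<open>l * p\<close> is
      \<open>x * p\<close>, so \<open>p\<close> lies in \<open>(y, z)\<close>.\<close>
    have "var_x * p = l * p - l' * p" by (simp add: l_def algebra_simps)
    also have "\<dots> = (a * var_x + k * h1 + scalar3 c * p) * var_y + (b * var_x + k * h2 - p) * var_z"
      unfolding abk l'_def h(2) by (simp add: algebra_simps)
    finally obtain b1 c1 where p1: "p = b1 * var_y + c1 * var_z" using var_regular by blast
    \<comment> \<open>Modulo \<open>(x, h)\<close> the same element is \<open>l' * p\<close>, so
      \<open>p\<close> also lies in \<open>(x, h)\<close>.\<close>
    have "l' * p = l * p - var_x * p" by (simp add: l_def algebra_simps)
    also have "\<dots> = var_x * (a * var_y + b * var_z - p) + h * k"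
      unfolding abk by (simp add: algebra_simps)
    finally obtain a2 b2 where p2: "p = var_x * a2 + h * b2" using mod_xh by blast
    \<comment> \<open>The intersection is computed: \<open>p\<close> and \<open>h\<close> lie in
      \<open>(y, z)\<close>, hence so does \<open>x * a2\<close>, and \<open>x\<close> is regular
      there.\<close>
    have "var_x * a2 = p - h * b2" using p2 by simp
    also have "\<dots> = (b1 - h1 * b2) * var_y + (c1 - h2 * b2) * var_z"
      by (subst p1, subst h(2)) (simp add: algebra_simps)
    finally obtain b3 c3 where "a2 = b3 * var_y + c3 * var_z" using var_regular by blast
    then have "p = b3 * (var_x * var_y) + c3 * (var_x * var_z) + b2 * h"
      using p2 by (simp add: algebra_simps)
    then show ?thesis unfolding J_def ideal3_def by blast
  qed
  define J' where "J' = {p. \<exists>q. p - l * q \<in> J}"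
  have J': "is_ideal J'" unfolding J'_def by (rule is_ideal_plus_principal [OF J])
  have sub: "p \<in> J'" if "p \<in> J" for p
  proof -
    have "p - l * 0 \<in> J" using that by simp
    then show ?thesis unfolding J'_def by blast
  qed
  have "l - l * 1 \<in> J" using is_idealD(1) [OF J] by simp
  then have l_mem: "l \<in> J'" unfolding J'_def by blast
  have "var_x * var_y = 1 * (var_x * var_y) + 0 * (var_x * var_z) + 0 * h"
    "var_x * var_z = 0 * (var_x * var_y) + 1 * (var_x * var_z) + 0 * h"
    "h = 0 * (var_x * var_y) + 0 * (var_x * var_z) + 1 * h" by simp_all
  then have mem: "var_x * var_y \<in> J'" "var_x * var_z \<in> J'" "h \<in> J'"
    using sub unfolding J_def ideal3_def by blast+
  \<comment> \<open>Modulo \<open>J'\<close> all of \<open>l\<close>, \<open>x y\<close> and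
    \<open>x z\<close> vanish, hence so does \<open>x ^ 2\<close>.\<close>
  have "var_x ^ 2 = var_x * l + scalar3 c * (var_x * var_y) - var_x * var_z"
    by (simp add: l_def l'_def algebra_simps power2_eq_square)
  then have "var_x ^ 2 \<in> J'" using mem l_mem is_idealD(2,3,6) [OF J'] by metis
  then have nx: "nil_mod J' var_x" unfolding nil_mod_def by blast
  have ly: "l' * var_y \<in> J'"
  proof -
    have "l' * var_y = l * var_y - var_x * var_y" by (simp add: l_def algebra_simps)
    then show ?thesis using mem(1) is_idealD(4) [OF J' l_mem, of var_y] is_idealD(6) [OF J'] by metis
  qed
  obtain q where q: "h = var_x * q + ?s H" using decomp [of h] by (auto simp: H_def)
  have "H = [:- ?e c, 1:] * synthetic_div H (?e c) + [:monom \<rho> d:]"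
    using synthetic_div_correct' [of "?e c" H] \<rho> by metis
  then have sH: "?s H = l' * ?s (synthetic_div H (?e c)) + ?s [:monom \<rho> d:]"
    using sD(2,3) sl by metis
  have "?s [:monom \<rho> d:] = scalar3 \<rho> * var_y ^ d"
  proof -
    have "?s [:monom \<rho> d:] = monom3 \<rho> 0 d 0"
      by (simp add: monom3_def map_poly_pCons map_poly_monom monom_0)
    then show ?thesis by (simp add: monom3_eq)
  qed
  then have "scalar3 \<rho> * var_y ^ d = ?s H - l' * ?s (synthetic_div H (?e c))"
    unfolding sH by (simp only: add_diff_cancel_left')
  moreover have "?s H = h - var_x * q" by (subst q) (simp only: add_diff_cancel_left')
  ultimately have "scalar3 \<rho> * var_y ^ d = h - var_x * q - l' * ?s (synthetic_div H (?e c))" by simp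
  \<comment> \<open>The extra factor \<open>y\<close> moves the terms with \<open>x\<close> and with
    \<open>l'\<close> into \<open>J'\<close>; it raises the exponent of \<open>y\<close> to
    \<open>d + 1\<close>.\<close>
  then have "scalar3 \<rho> * var_y ^ d * var_y
      = h * var_y - var_x * var_y * q - l' * var_y * ?s (synthetic_div H (?e c))"
    by (simp only:) (simp add: algebra_simps)
  also have "\<dots> \<in> J'"
    by (intro is_idealD(6) [OF J'] is_idealD(4) [OF J'] mem ly)
  finally have "scalar3 (1 / \<rho>) * (scalar3 \<rho> * var_y ^ d * var_y) \<in> J'"
    by (rule is_idealD(3) [OF J'])
  moreover have "scalar3 (1 / \<rho>) * (scalar3 \<rho> * var_y ^ d * var_y) = var_y ^ Suc d"
  proof -
    have "scalar3 (1 / \<rho>) * (scalar3 \<rho> * var_y ^ d * var_y) = scalar3 (1 / \<rho> * \<rho>) * (var_y ^ d * var_y)"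
      by (simp only: mult.assoc scalar3_mult)
    then show ?thesis using \<open>\<rho> \<noteq> 0\<close> by (simp add: mult.commute)
  qed
  ultimately have "var_y ^ Suc d \<in> J'" by metis
  then have ny: "nil_mod J' var_y" unfolding nil_mod_def by blast
  have "nil_mod J' (l + ((- 1) * var_x + scalar3 c * var_y))"
    by (intro nil_mod_add nil_mod_mult J' nx ny nil_mod_in [OF l_mem])
  moreover have "l + ((- 1) * var_x + scalar3 c * var_y) = var_z" by (simp add: l_def l'_def)
  ultimately have nz: "nil_mod J' var_z" by metis
  have "linear_parameter J l"
    by (rule linear_parameterI [OF J l_hom regular]) (use nx ny nz in \<open>simp_all add: J'_def\<close>)
  then show ?thesis unfolding J_def by blast
qed

context
  fixes l m n :: "'k::field poly3"
  assumes lin: "homogeneous3 1 l" "homogeneous3 1 m" "homogeneous3 1 n" and ind: "lin_indep3 l m n"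
begin

lemma linear_forms_syzygy:
  assumes "a * m + b * n = 0"
  shows "\<exists>c. a = c * n \<and> b = - c * m"
proof -
  have \<sigma>: "graded_aut (subst3 l m n)" by (rule graded_aut_subst3 [OF lin ind])
  note s = graded_autD [OF \<sigma>] and h = is_ring_homD [OF is_ring_hom_subst3]
  obtain a' b' where ab: "a = subst3 l m n a'" "b = subst3 l m n b'" using s(5) by metis
  have "subst3 l m n (a' * var_y + b' * var_z) = subst3 l m n 0" using assms by (simp add: ab h)
  then have "a' * var_y + b' * var_z = 0" using s(6) by blast
  then obtain c where "a' = c * var_z" "b' = - c * var_y" using var_syzygy by blast
  then have "a = subst3 l m n c * n" "b = - subst3 l m n c * m" by (simp_all add: ab h)
  then show ?thesis by blast
qed

lemma linear_forms_regular:
  assumes "l * a = b * m + c * n"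
  shows "\<exists>b c. a = b * m + c * n"
proof -
  have \<sigma>: "graded_aut (subst3 l m n)" by (rule graded_aut_subst3 [OF lin ind])
  note s = graded_autD [OF \<sigma>] and h = is_ring_homD [OF is_ring_hom_subst3]
  obtain a' b' c' where ab: "a = subst3 l m n a'" "b = subst3 l m n b'" "c = subst3 l m n c'" using s(5) by metis
  have "subst3 l m n (var_x * a') = subst3 l m n (b' * var_y + c' * var_z)" using assms by (simp add: ab h)
  then have "var_x * a' = b' * var_y + c' * var_z" using s(6) by blast
  then obtain d e where "a' = d * var_y + e * var_z" using var_regular by blast
  then have "a = subst3 l m n d * m + subst3 l m n e * n" by (simp add: ab h)
  then show ?thesis by blast
qed

end

lemma linear_parameter_linear_forms:
  fixes l m n :: "'k::{field, field_char_0} poly3"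
  assumes lin: "homogeneous3 1 l" "homogeneous3 1 m" "homogeneous3 1 n" and ind: "lin_indep3 l m n"
    and h: "homogeneous3 d h" "h = h1 * m + h2 * n" "\<And>u. h \<noteq> l * u"
  shows "\<exists>k. linear_parameter (ideal3 (l * m) (l * n) h) k"
proof -
  have \<sigma>: "graded_aut (subst3 l m n)" by (rule graded_aut_subst3 [OF lin ind])
  note s = graded_autD [OF \<sigma>] and hm = is_ring_homD [OF is_ring_hom_subst3]
  obtain h' h1' h2' where h': "h = subst3 l m n h'" "h1 = subst3 l m n h1'" "h2 = subst3 l m n h2'"
    using s(5) by metis
  have "subst3 l m n h' = subst3 l m n (h1' * var_y + h2' * var_z)"
    using h(2) by (simp add: h'[symmetric] hm)
  then have "h' = h1' * var_y + h2' * var_z" using s(6) by blast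
  moreover have "homogeneous3 d h'" using h(1) s(4) h' by metis
  moreover have "h' \<noteq> var_x * u" for u
  proof
    assume "h' = var_x * u"
    then have "h = l * subst3 l m n u" by (simp add: h' hm)
    then show False using h(3) by blast
  qed
  ultimately obtain k where "linear_parameter (ideal3 (var_x * var_y) (var_x * var_z) h') k"
    using linear_parameter_line_and_lines by blast
  from linear_parameter_image [OF \<sigma> this] show ?thesis
    unfolding graded_aut_image_ideal3 [OF \<sigma>] by (auto simp: hm h')
qed

declare One_nat_def [simp del]

lemma ord_ge_mult': "ord_ge a f \<Longrightarrow> ord_ge b g \<Longrightarrow> n = a + b \<Longrightarrow> ord_ge n (f * g)"
  by (simp add: ord_ge_mult)

lemma ord_ge_Suc_diff:
  "ord_ge w f \<Longrightarrow> ord_ge w g \<Longrightarrow> fps3_comp w f = fps3_comp w g \<Longrightarrow> ord_ge (Suc w) (f - g)"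
  by (simp add: ord_ge_Suc)

text \<open>In coordinates where \<open>l\<close> is \<open>x\<close>, this is primality of a
  variable.\<close>

lemma linear_form_prime:
  fixes l m n :: "'k::field poly3"
  assumes lin: "homogeneous3 1 l" "homogeneous3 1 m" "homogeneous3 1 n" and ind: "lin_indep3 l m n"
    and dvd: "l * u = a * b"
  shows "(\<exists>v. a = l * v) \<or> (\<exists>v. b = l * v)"
proof -
  have \<sigma>: "graded_aut (subst3 l m n)" by (rule graded_aut_subst3 [OF lin ind])
  note s = graded_autD [OF \<sigma>] and h = is_ring_homD [OF is_ring_hom_subst3]
  obtain u' a' b' where ab: "u = subst3 l m n u'" "a = subst3 l m n a'" "b = subst3 l m n b'" using s(5) by metis
  have "prime_elem [:0, 1 :: 'k:]" by (rule prime_elem_linear_field_poly) simp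
  then have "prime_elem (var_x :: 'k poly3)" by (simp add: var_x_def lift_prime_elem_poly)
  moreover have "subst3 l m n (var_x * u') = subst3 l m n (a' * b')" using dvd by (simp add: ab h)
  then have "var_x * u' = a' * b'" using s(6) by blast
  then have "var_x dvd a' * b'" by (metis dvd_triv_left)
  ultimately have "var_x dvd a' \<or> var_x dvd b'" by (simp add: prime_elem_dvd_mult_iff)
  then obtain v where "a' = var_x * v \<or> b' = var_x * v" by blast
  then have "a = l * subst3 l m n v \<or> b = l * subst3 l m n v" by (auto simp: ab h)
  then show ?thesis by blast
qed

section \<open>The ideal of initial forms\<close>

text \<open>Series of order above \<open>t\<close> contribute the zero form, so that each degree
  gives a vector space when \<open>I\<close> is an ideal.\<close>

definition leading_forms :: "'k::field fps3 set \<Rightarrow> nat \<Rightarrow> 'k poly3 set" where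
  "leading_forms I t = {fps3_comp t f | f. f \<in> I \<and> ord_ge t f}"

text \<open>For an ideal \<open>I\<close> this is \<open>I^*\<close>, described degree by degree: a
  homogeneous member comes from a single series in \<open>I\<close>, so sums of initial forms never
  have to be handled.\<close>

definition tangent_ideal :: "'k::field fps3 set \<Rightarrow> 'k poly3 set" where
  "tangent_ideal I = {p. \<forall>t. poly3_comp t p \<in> leading_forms I t}"

lemma leading_forms_0: "is_ideal I \<Longrightarrow> 0 \<in> leading_forms I t"
  unfolding leading_forms_def by (rule CollectI, rule exI [of _ 0]) (simp add: is_idealD)

lemma leading_forms_add:
  assumes I: "is_ideal I" and "p \<in> leading_forms I t" "q \<in> leading_forms I t"
  shows "p + q \<in> leading_forms I t"
proof -
  obtain f g where "p = fps3_comp t f" "f \<in> I" "ord_ge t f" "q = fps3_comp t g" "g \<in> I" "ord_ge t g"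
    using assms by (auto simp: leading_forms_def)
  then show ?thesis unfolding leading_forms_def
    by (intro CollectI exI [of _ "f + g"]) (simp add: is_idealD [OF I])
qed

lemma leading_forms_mult:
  assumes I: "is_ideal I" and p: "homogeneous3 s p" and q: "q \<in> leading_forms I t"
  shows "p * q \<in> leading_forms I (s + t)"
proof -
  obtain f where f: "q = fps3_comp t f" "f \<in> I" "ord_ge t f"
    using q by (auto simp: leading_forms_def)
  have "fps3_comp (s + t) (fps3_of_poly3 p * f) = p * q"
    using p f by (subst fps3_comp_mult_leading [of s _ t]) simp_all
  moreover have "ord_ge (s + t) (fps3_of_poly3 p * f)" using p f by (intro ord_ge_mult) simp_all
  ultimately show ?thesis unfolding leading_forms_def
    using is_idealD(3) [OF I f(2)] by (intro CollectI exI [of _ "fps3_of_poly3 p * f"]) simp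
qed

lemma leading_forms_sum:
  "is_ideal I \<Longrightarrow> (\<And>a. a \<in> A \<Longrightarrow> f a \<in> leading_forms I t) \<Longrightarrow> sum f A \<in> leading_forms I t"
  by (induction A rule: infinite_finite_induct) (auto simp: leading_forms_0 leading_forms_add)

lemma is_ideal_tangent_ideal:
  assumes I: "is_ideal I"
  shows "is_ideal (tangent_ideal I)"
proof (rule is_idealI)
  show "0 \<in> tangent_ideal I" by (simp add: tangent_ideal_def leading_forms_0 I)
  show "a + b \<in> tangent_ideal I" if "a \<in> tangent_ideal I" "b \<in> tangent_ideal I" for a b
    using that by (simp add: tangent_ideal_def leading_forms_add I)
  show "r * a \<in> tangent_ideal I" if a: "a \<in> tangent_ideal I" for r a
  proof -
    have "poly3_comp s r * poly3_comp (t - s) a \<in> leading_forms I t" if "s \<le> t" for s t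
      using leading_forms_mult [OF I homogeneous3_comp, of "poly3_comp (t - s) a" "t - s" s r] a that
      by (simp add: tangent_ideal_def)
    then show ?thesis
      by (auto simp: tangent_ideal_def poly3_comp_mult intro!: leading_forms_sum I)
  qed
qed

lemma tangent_ideal_homogeneous:
  assumes I: "is_ideal I" and p: "homogeneous3 t p"
  shows "p \<in> tangent_ideal I \<longleftrightarrow> p \<in> leading_forms I t"
  using leading_forms_0 [OF I] by (auto simp: tangent_ideal_def poly3_comp_homogeneous [OF p])

lemma leading_forms_subset_imp_tangent_subset:
  assumes J: "is_ideal J" and sub: "\<And>t. leading_forms I t \<subseteq> J"
  shows "tangent_ideal I \<subseteq> J"
proof
  fix p assume p: "p \<in> tangent_ideal I"
  obtain D where D: "p = (\<Sum>n\<le>D. poly3_comp n p)" using poly3_eq_sum_comp by blast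
  have "(\<Sum>n\<le>D. poly3_comp n p) \<in> J"
    using p sub by (intro is_ideal_sum [OF J]) (auto simp: tangent_ideal_def)
  then show "p \<in> J" using D by simp
qed

lemma ideal3_subset: "is_ideal J \<Longrightarrow> f \<in> J \<Longrightarrow> g \<in> J \<Longrightarrow> h \<in> J \<Longrightarrow> ideal3 f g h \<subseteq> J"
  by (auto simp: ideal3_def is_idealD)

lemma generators_in_ideal2: "f \<in> ideal2 f g" "g \<in> ideal2 f g"
proof -
  have "f = 1 * f + 0 * g" "g = 0 * f + 1 * g" by simp_all
  then show "f \<in> ideal2 f g" "g \<in> ideal2 f g" unfolding ideal2_def by blast+
qed

lemma leading_formsI: "f \<in> I \<Longrightarrow> ord_ge t f \<Longrightarrow> fps3_comp t f \<in> leading_forms I t"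
  by (auto simp: leading_forms_def)

text \<open>Every syzygy of the initial forms is a Koszul syzygy, so cancellations in \<open>\<alpha> f + \<beta> g\<close> can be
  removed degree by degree.\<close>

lemma tangent_ideal_coprime:
  fixes f g :: "'k::field fps3"
  defines "\<phi> \<equiv> fps3_comp 2 f" and "\<gamma> \<equiv> fps3_comp 2 g"
  assumes f: "ord_ge 2 f" and g: "ord_ge 2 g"
    and syz: "\<And>\<alpha> \<beta>. \<alpha> * \<phi> + \<beta> * \<gamma> = 0 \<Longrightarrow> \<exists>c. \<alpha> = c * \<gamma> \<and> \<beta> = - c * \<phi>"
  shows "tangent_ideal (ideal2 f g) = ideal2 \<phi> \<gamma>"
proof
  note I = is_ideal_ideal2 [of f g]
  have hom: "homogeneous3 2 \<phi>" "homogeneous3 2 \<gamma>" by (simp_all add: \<phi>_def \<gamma>_def)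
  have "\<phi> \<in> tangent_ideal (ideal2 f g)" "\<gamma> \<in> tangent_ideal (ideal2 f g)"
    unfolding tangent_ideal_homogeneous [OF I hom(1)] tangent_ideal_homogeneous [OF I hom(2)]
    unfolding \<phi>_def \<gamma>_def using f g generators_in_ideal2 by (auto intro!: leading_formsI)
  then show "ideal2 \<phi> \<gamma> \<subseteq> tangent_ideal (ideal2 f g)"
    unfolding ideal2_eq_ideal3 [of \<phi>] using is_ideal_tangent_ideal [OF I] is_idealD(1)
    by (intro ideal3_subset) auto
  show "tangent_ideal (ideal2 f g) \<subseteq> ideal2 \<phi> \<gamma>"
  proof (rule leading_forms_subset_imp_tangent_subset [OF is_ideal_ideal2])
    fix t
    show "leading_forms (ideal2 f g) t \<subseteq> ideal2 \<phi> \<gamma>"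
    proof
      fix x assume "x \<in> leading_forms (ideal2 f g) t"
      then obtain F where F: "x = fps3_comp t F" "F \<in> ideal2 f g" "ord_ge t F"
        by (auto simp: leading_forms_def)
      then obtain \<alpha>0 \<beta>0 where F0: "F = \<alpha>0 * f + \<beta>0 * g" by (auto simp: ideal2_def)
      have lead: "fps3_comp w (\<alpha> * f + \<beta> * g) = fps3_comp (w - 2) \<alpha> * \<phi> + fps3_comp (w - 2) \<beta> * \<gamma>"
        if "2 \<le> w" "ord_ge (w - 2) \<alpha>" "ord_ge (w - 2) \<beta>" for w \<alpha> \<beta>
        using fps3_comp_mult_leading [OF that(2) f, of w] fps3_comp_mult_leading [OF that(3) g, of w] that(1)
        by (simp add: \<phi>_def \<gamma>_def)
      show "x \<in> ideal2 \<phi> \<gamma>"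
      proof (cases "2 \<le> t")
        case False
        then have "x = 0" using F(1) F0 f g
          by (metis ord_ge_iff_comp ord_ge_mult2 ord_ge_simps(3) not_le)
        then show ?thesis by (simp add: is_idealD is_ideal_ideal2)
      next
        case True
        \<comment> \<open>Once both coefficients have order at least \<open>t - 2\<close>, the
          component of degree \<open>t\<close> is visibly a combination of \<open>\<phi>\<close> and
          \<open>\<gamma>\<close>.\<close>
        have "\<exists>\<alpha> \<beta>. F = \<alpha> * f + \<beta> * g \<and> ord_ge (t - 2) \<alpha> \<and> ord_ge (t - 2) \<beta>"
          using True F(3)
        proof (induction t rule: dec_induct)
          case base
          then show ?case using F0 by auto
        next
          case (step w)
          then obtain \<alpha> \<beta> where \<alpha>\<beta>: "F = \<alpha> * f + \<beta> * g" "ord_ge (w - 2) \<alpha>" "ord_ge (w - 2) \<beta>"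
            by (auto simp: ord_ge_Suc)
          define a b where "a = fps3_comp (w - 2) \<alpha>" and "b = fps3_comp (w - 2) \<beta>"
          have hab: "homogeneous3 (w - 2) a" "homogeneous3 (w - 2) b" by (simp_all add: a_def b_def)
          have "a * \<phi> + b * \<gamma> = 0"
            using lead [OF \<open>2 \<le> w\<close> \<alpha>\<beta>(2,3)] step.prems \<alpha>\<beta>(1) by (simp add: ord_ge_Suc a_def b_def)
          then obtain c where c: "a = c * \<gamma>" "b = - c * \<phi>" using syz by blast
          \<comment> \<open>Since \<open>a\<close> and \<open>b\<close> have degree
            \<open>w - 2\<close>, only the component of \<open>c\<close> in degree
            \<open>w - 4\<close> matters. For \<open>w < 4\<close> there is none, and both
            \<open>a\<close> and \<open>b\<close> vanish.\<close>
          define e where "e = (if 2 \<le> w - 2 then poly3_comp (w - 2 - 2) c else 0)"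
          have ab: "a = e * \<gamma>" "b = - e * \<phi>"
            using poly3_comp_mult_homogeneous [OF hom(2), of "w - 2" c]
              poly3_comp_mult_homogeneous [OF hom(1), of "w - 2" "- c"] hab
            unfolding homogeneous3_iff_comp e_def c [symmetric] by auto
          define E where "E = fps3_of_poly3 e"
          have E: "ord_ge (w - 2) (E * h) \<and> fps3_comp (w - 2) (E * h) = e * fps3_comp 2 h" if "ord_ge 2 h" for h
          proof (cases "2 \<le> w - 2")
            case True
            then have "homogeneous3 (w - 2 - 2) e" by (simp add: e_def)
            then have E: "ord_ge (w - 2 - 2) E" "fps3_comp (w - 2 - 2) E = e" by (simp_all add: E_def)
            have w: "w - 2 = w - 2 - 2 + 2" using True by simp
            show ?thesis
              using ord_ge_mult' [OF E(1) that w] fps3_comp_mult_leading [OF E(1) that w] E(2) by metis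
          qed (simp add: E_def e_def)
          \<comment> \<open>Adding a multiple of the trivial relation \<open>f g - g f = 0\<close>
            removes the leading forms \<open>a\<close> and \<open>b\<close>.\<close>
          have "F = (\<alpha> - E * g) * f + (\<beta> + E * f) * g" by (simp add: \<alpha>\<beta>(1) algebra_simps)
          moreover have "ord_ge (Suc (w - 2)) (\<alpha> - E * g)" "ord_ge (Suc (w - 2)) (\<beta> + E * f)"
            using \<alpha>\<beta>(2,3) E [OF f] E [OF g] ab
            by (simp_all add: ord_ge_Suc a_def [symmetric] b_def [symmetric] \<phi>_def [symmetric] \<gamma>_def [symmetric])
          ultimately show ?case using \<open>2 \<le> w\<close> by (metis Suc_diff_le)
        qed
        then obtain \<alpha> \<beta> where "F = \<alpha> * f + \<beta> * g" "ord_ge (t - 2) \<alpha>" "ord_ge (t - 2) \<beta>" by blast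
        then have "x = fps3_comp (t - 2) \<alpha> * \<phi> + fps3_comp (t - 2) \<beta> * \<gamma>"
          using lead [OF True] F(1) by blast
        then show ?thesis unfolding ideal2_def by blast
      qed
    qed
  qed
qed

section \<open>Initial forms with a common linear factor\<close>

lemma ord_ge_limit:
  fixes F :: "nat \<Rightarrow> 'k::field fps3"
  assumes "\<And>k. ord_ge k (F (Suc k) - F k)"
  shows "\<exists>L. \<forall>k. ord_ge k (L - F k)"
proof -
  \<comment> \<open>A coefficient in degree \<open>i + j + k\<close> no longer changes from stage
    \<open>i + j + k + 1\<close> on, so it is read off there.\<close>
  define L where "L = Abs_fps (\<lambda>k. Abs_fps (\<lambda>j. Abs_fps (\<lambda>i. fps3_coeff (F (Suc (i + j + k))) i j k)))"
  have L: "fps3_coeff L i j k = fps3_coeff (F (Suc (i + j + k))) i j k" for i j k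
    by (simp add: L_def fps3_coeff_def)
  have "fps3_coeff (F (Suc (i + j + k) + d)) i j k = fps3_coeff (F (Suc (i + j + k))) i j k" for i j k d
  proof (induction d)
    case (Suc d)
    have "fps3_coeff (F (Suc (Suc (i + j + k) + d)) - F (Suc (i + j + k) + d)) i j k = 0"
      using assms [of "Suc (i + j + k) + d"] by (simp add: ord_ge_def)
    then show ?case using Suc by simp
  qed simp
  then have "fps3_coeff (L - F n) i j k = 0" if "i + j + k < n" for n i j k
    using that L less_iff_Suc_add [of "i + j + k" n] by (metis add_Suc diff_self fps3_coeff_simps(3))
  then show ?thesis unfolding ord_ge_def by blast
qed

lemma ord_ge_all_imp_0: "(\<And>k. ord_ge k f) \<Longrightarrow> f = 0"
  by (rule fps3_eqI) (auto simp: ord_ge_def intro: lessI)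

text \<open>The assumption \<open>coprime\<close> carries the regularity of the sequence:
  \<open>g\<close> is a nonzerodivisor modulo \<open>f\<close>.\<close>

locale common_factor_pair =
  fixes f g :: "'k::field fps3" and l m n :: "'k poly3"
  assumes f: "ord_ge 2 f" "fps3_comp 2 f = l * m" and g: "ord_ge 2 g" "fps3_comp 2 g = l * n"
    and lin: "homogeneous3 1 l" "homogeneous3 1 m" "homogeneous3 1 n" and ind: "lin_indep3 l m n"
    and coprime: "\<And>a b. a * f = b * g \<Longrightarrow> \<exists>c. b = c * f"
begin

lemma nonzero: "l \<noteq> 0" "m \<noteq> 0" "n \<noteq> 0"
proof -
  have "scalar3 1 * l + scalar3 0 * m + scalar3 0 * n \<noteq> 0" "scalar3 0 * l + scalar3 1 * m + scalar3 0 * n \<noteq> 0"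
    "scalar3 0 * l + scalar3 0 * m + scalar3 1 * n \<noteq> 0"
    using ind unfolding lin_indep3_def by (metis zero_neq_one)+
  then show "l \<noteq> 0" "m \<noteq> 0" "n \<noteq> 0" by auto
qed

text \<open>\<open>A\<close> and \<open>B\<close> lift the syzygy
  \<open>n * (l * m) = m * (l * n)\<close> of the initial forms to power series.\<close>

definition lifts :: "'k fps3 \<Rightarrow> 'k fps3 \<Rightarrow> bool" where
  "lifts A B \<longleftrightarrow> ord_ge 1 A \<and> fps3_comp 1 A = n \<and> ord_ge 1 B \<and> fps3_comp 1 B = m"

lemma lifts_ord: "lifts A B \<Longrightarrow> ord_ge 4 (A * f - B * g)"
proof -
  assume AB: "lifts A B"
  have "ord_ge 3 (A * f)" "ord_ge 3 (B * g)"
    using AB f g ord_ge_mult [of 1 A 2 f] ord_ge_mult [of 1 B 2 g] by (simp_all add: lifts_def)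
  moreover have "fps3_comp 3 (A * f) = n * (l * m)" "fps3_comp 3 (B * g) = m * (l * n)"
    using fps3_comp_mult_leading [of 1 A 2 f 3] fps3_comp_mult_leading [of 1 B 2 g 3] AB f g
    unfolding lifts_def by simp_all
  ultimately have "ord_ge (Suc 3) (A * f - B * g)"
    by (intro ord_ge_Suc_diff) (simp_all add: mult_ac)
  then show "ord_ge 4 (A * f - B * g)" by simp
qed

text \<open>A leading form in \<open>(l m, l n)\<close> is cancelled by changing \<open>A\<close>
  and \<open>B\<close> in degree \<open>k + 2\<close>. This degree is at least two, so the linear
  parts \<open>n\<close> and \<open>m\<close> stay.\<close>

lemma exists_lift_step:
  assumes AB: "lifts A B" "ord_ge (k + 4) (A * f - B * g)"
    and mem: "fps3_comp (k + 4) (A * f - B * g) \<in> ideal2 (l * m) (l * n)"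
  shows "\<exists>A' B'. lifts A' B' \<and> ord_ge (Suc k + 4) (A' * f - B' * g) \<and>
    ord_ge (k + 2) (A' - A) \<and> ord_ge (k + 2) (B' - B)"
proof -
  obtain c e where ce: "fps3_comp (k + 4) (A * f - B * g) = c * (l * m) + e * (l * n)"
    using mem by (auto simp: ideal2_def)
  have hom: "homogeneous3 2 (l * m)" "homogeneous3 2 (l * n)"
    using homogeneous3_mult [OF lin(1) lin(2)] homogeneous3_mult [OF lin(1) lin(3)]
    by (simp_all add: numeral_2_eq_2)
  \<comment> \<open>Both generators have degree two, so in degree \<open>k + 4\<close> only the
    components of degree \<open>k + 2\<close> of the cofactors count.\<close>
  define c' e' where "c' = poly3_comp (k + 2) c" and "e' = poly3_comp (k + 2) e"
  have hce: "homogeneous3 (k + 2) c'" "homogeneous3 (k + 2) e'" by (simp_all add: c'_def e'_def)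
  have "fps3_comp (k + 4) (A * f - B * g) = poly3_comp (k + 4) (c * (l * m) + e * (l * n))"
    unfolding ce [symmetric] using homogeneous3_fps3_comp homogeneous3_iff_comp by metis
  then have eq: "fps3_comp (k + 4) (A * f - B * g) = c' * (l * m) + e' * (l * n)"
  proof -
    have "poly3_comp (k + 4) (x * y) = poly3_comp (k + 2) x * y" if "homogeneous3 2 y" for x y :: "'k poly3"
      using poly3_comp_mult_homogeneous [OF that, of "k + 4" x] by simp
    then show ?thesis
      using \<open>fps3_comp (k + 4) (A * f - B * g) = poly3_comp (k + 4) (c * (l * m) + e * (l * n))\<close> hom
      by (simp only: poly3_comp_simps c'_def e'_def)
  qed
  define A' B' where "A' = A - fps3_of_poly3 c'" and "B' = B + fps3_of_poly3 e'"
  have ord: "ord_ge (k + 2) (fps3_of_poly3 c')" "ord_ge (k + 2) (fps3_of_poly3 e')"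
    using hce by simp_all
  then have "ord_ge 1 (fps3_of_poly3 c')" "ord_ge 1 (fps3_of_poly3 e')"
    "fps3_comp 1 (fps3_of_poly3 c') = 0" "fps3_comp 1 (fps3_of_poly3 e') = 0"
    using ord_ge_mono by (auto simp: ord_ge_iff_comp)
  then have "lifts A' B'" using AB(1) by (simp add: lifts_def A'_def B'_def)
  moreover have "ord_ge (Suc (k + 4)) (A' * f - B' * g)"
  proof -
    have split: "A' * f - B' * g = (A * f - B * g) - fps3_of_poly3 c' * f - fps3_of_poly3 e' * g"
      by (simp add: A'_def B'_def algebra_simps)
    have o: "ord_ge (k + 4) (fps3_of_poly3 c' * f)" "ord_ge (k + 4) (fps3_of_poly3 e' * g)"
      using ord_ge_mult [OF ord(1) f(1)] ord_ge_mult [OF ord(2) g(1)] by (simp_all add: numeral_eq_Suc)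
    have "fps3_comp (k + 4) (fps3_of_poly3 c' * f) = c' * (l * m)"
      "fps3_comp (k + 4) (fps3_of_poly3 e' * g) = e' * (l * n)"
      using fps3_comp_mult_leading [OF ord(1) f(1), of "k + 4"] fps3_comp_mult_leading [OF ord(2) g(1), of "k + 4"]
        hce f g by simp_all
    then show ?thesis unfolding ord_ge_Suc split using AB(2) o eq
      by (simp only: fps3_comp_simps ord_ge_simps) simp
  qed
  moreover have "ord_ge (k + 2) (A' - A)" "ord_ge (k + 2) (B' - B)"
    using ord by (simp_all add: A'_def B'_def)
  ultimately show ?thesis by auto
qed

text \<open>If the corrections never stopped, their limits would satisfy
  \<open>A * f = B * g\<close>. Then \<open>B\<close> is a multiple of \<open>f\<close> and has
  order at least two, although its linear part is \<open>m\<close>.\<close>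

lemma exists_lift:
  "\<exists>A B d. lifts A B \<and> 4 \<le> d \<and> ord_ge d (A * f - B * g) \<and>
    fps3_comp d (A * f - B * g) \<notin> ideal2 (l * m) (l * n)"
proof (rule ccontr)
  assume "\<not> ?thesis"
  then have mem: "fps3_comp (k + 4) (A * f - B * g) \<in> ideal2 (l * m) (l * n)"
    if "lifts A B" "ord_ge (k + 4) (A * f - B * g)" for A B k
    using that by (metis le_add2)
  let ?P = "\<lambda>k S. lifts (fst S) (snd S) \<and> ord_ge (k + 4) (fst S * f - snd S * g)"
  let ?Q = "\<lambda>k S Y. ord_ge (k + 2) (fst Y - fst S) \<and> ord_ge (k + 2) (snd Y - snd S)"
  have "\<exists>S. \<forall>k. ?P k (S k) \<and> ?Q k (S k) (S (Suc k))"
  proof (rule dependent_nat_choice)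
    have "lifts (fps3_of_poly3 n) (fps3_of_poly3 m)"
      using lin by (simp add: lifts_def ord_ge_of_homogeneous fps3_comp_of_homogeneous)
    then show "\<exists>S. ?P 0 S" using lifts_ord by (metis add_0 fst_conv snd_conv)
  next
    fix S k assume "?P k S"
    then obtain A' B' where "lifts A' B' \<and> ord_ge (Suc k + 4) (A' * f - B' * g) \<and>
      ord_ge (k + 2) (A' - fst S) \<and> ord_ge (k + 2) (B' - snd S)"
      using exists_lift_step mem by blast
    then show "\<exists>Y. ?P (Suc k) Y \<and> ?Q k S Y" by (intro exI [of _ "(A', B')"]) simp
  qed
  then obtain S where S: "\<And>k. ?P k (S k)" "\<And>k. ?Q k (S k) (S (Suc k))" by blast
  have "ord_ge k (fst (S (Suc k)) - fst (S k))" "ord_ge k (snd (S (Suc k)) - snd (S k))" for k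
    using S(2) [of k] ord_ge_mono by (auto intro: ord_ge_mono [of "k + 2"])
  then obtain A B where A: "\<And>k. ord_ge k (A - fst (S k))" and B: "\<And>k. ord_ge k (B - snd (S k))"
    using ord_ge_limit [of "\<lambda>k. fst (S k)"] ord_ge_limit [of "\<lambda>k. snd (S k)"] by blast
  have "ord_ge k (A * f - B * g)" for k
  proof -
    have "A * f - B * g = (A - fst (S k)) * f - (B - snd (S k)) * g + (fst (S k) * f - snd (S k) * g)"
      by (simp add: algebra_simps)
    moreover have "ord_ge k (fst (S k) * f - snd (S k) * g)" 
      by (rule ord_ge_mono [of "k + 4"]) (use S(1) [of k] in simp_all)
    ultimately show ?thesis using A [of k] B [of k] by (simp add: ord_ge_mult1)
  qed
  then have "A * f - B * g = 0" by (rule ord_ge_all_imp_0)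
  then have "A * f = B * g" by simp
  from coprime [OF this] obtain c where "B = c * f" by blast
  then have "ord_ge 2 B" using f(1) by (simp add: ord_ge_mult2)
  then have "fps3_comp 1 B = 0" by (simp add: ord_ge_iff_comp)
  moreover have "fps3_comp 1 (B - snd (S 2)) = 0" using B [of 2] by (simp add: ord_ge_iff_comp)
  ultimately have "m = 0" using S(1) [of 2] by (simp add: lifts_def)
  then show False using nonzero by simp
qed

text \<open>If \<open>A * f - B * g\<close> has no component in degree \<open>w + 1\<close>, the
  components \<open>p\<close> and \<open>q\<close> of degree \<open>w\<close> of the two errors
  satisfy \<open>n p = m q\<close>. They are therefore \<open>k m\<close> and \<open>k n\<close>,
  and \<open>k\<close> is absorbed into \<open>\<mu>\<close>. Each step needs
  \<open>w + 1 < d\<close>, so the orders reach \<open>d - 1\<close>.\<close>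

lemma exists_lift_l:
  assumes AB: "lifts A B" and d: "ord_ge d (A * f - B * g)" and w: "3 \<le> w" "w < d"
  shows "\<exists>\<mu>. ord_ge 1 \<mu> \<and> fps3_comp 1 \<mu> = l \<and> ord_ge w (f - \<mu> * B) \<and> ord_ge w (g - \<mu> * A)"
  using w
proof (induction w rule: dec_induct)
  case base
  let ?l = "fps3_of_poly3 l"
  have l: "ord_ge 1 ?l" "fps3_comp 1 ?l = l" using lin(1) by (simp_all only: ord_ge_of_homogeneous fps3_comp_of_homogeneous)
  have "ord_ge 2 (?l * B)" "ord_ge 2 (?l * A)" "fps3_comp 2 (?l * B) = l * m" "fps3_comp 2 (?l * A) = l * n"
    using ord_ge_mult [OF l(1), of 1 A] ord_ge_mult [OF l(1), of 1 B]
      fps3_comp_mult_leading [OF l(1), of 1 A 2] fps3_comp_mult_leading [OF l(1), of 1 B 2] AB l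
    by (simp_all add: lifts_def numeral_2_eq_2)
  then have "ord_ge (Suc 2) (f - ?l * B)" "ord_ge (Suc 2) (g - ?l * A)"
    unfolding ord_ge_Suc using f g by simp_all
  then show ?case using l by (intro exI [of _ ?l]) simp
next
  case (step w)
  then obtain \<mu> where \<mu>: "ord_ge 1 \<mu>" "fps3_comp 1 \<mu> = l" "ord_ge w (f - \<mu> * B)" "ord_ge w (g - \<mu> * A)"
    by auto
  define p q where "p = fps3_comp w (f - \<mu> * B)" and "q = fps3_comp w (g - \<mu> * A)"
  have "A * f - B * g = A * (f - \<mu> * B) - B * (g - \<mu> * A)" by (simp add: algebra_simps)
  then have "fps3_comp (w + 1) (A * f - B * g) = n * p - m * q"
    using fps3_comp_mult_leading [of 1 A w "f - \<mu> * B" "w + 1"] fps3_comp_mult_leading [of 1 B w "g - \<mu> * A" "w + 1"] AB \<mu>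
    by (simp add: lifts_def p_def q_def)
  moreover have "fps3_comp (w + 1) (A * f - B * g) = 0"
    using d step by (simp add: ord_ge_iff_comp)
  ultimately have "- q * m + p * n = 0" by (simp add: algebra_simps)
  then obtain c where c: "- q = c * n" "p = - c * m"
    using linear_forms_syzygy [OF lin ind] by blast
  have hpq: "homogeneous3 w p" "homogeneous3 w q" by (simp_all add: p_def q_def)
  define k where "k = poly3_comp (w - 1) (- c)"
  have "p = poly3_comp w (- c * m)" "q = poly3_comp w (- c * n)"
    using hpq c by (metis homogeneous3_iff_comp, metis homogeneous3_iff_comp minus_minus mult_minus_left)
  then have pq: "p = k * m" "q = k * n"
    using poly3_comp_mult_homogeneous [OF lin(2), of w "- c"] poly3_comp_mult_homogeneous [OF lin(3), of w "- c"] step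
    by (simp_all add: k_def)
  define K where "K = fps3_of_poly3 k"
  have K: "ord_ge (w - 1) K" "fps3_comp (w - 1) K = k"
    using homogeneous3_comp [of "w - 1" "- c"] by (simp_all add: K_def k_def)
  have "ord_ge 2 K" using K(1) step ord_ge_mono [of "w - 1" K 2] by simp
  then have "ord_ge 1 (\<mu> + K)" "fps3_comp 1 (\<mu> + K) = l"
    using \<mu> ord_ge_mono [of 2 K 1] by (simp_all add: ord_ge_iff_comp)
  moreover have "ord_ge (Suc w) (f - (\<mu> + K) * B)" "ord_ge (Suc w) (g - (\<mu> + K) * A)"
  proof -
    have split: "f - (\<mu> + K) * B = (f - \<mu> * B) - K * B" "g - (\<mu> + K) * A = (g - \<mu> * A) - K * A"
      by (simp_all add: algebra_simps)
    have "ord_ge w (K * B)" "ord_ge w (K * A)" "fps3_comp w (K * B) = k * m" "fps3_comp w (K * A) = k * n"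
      using ord_ge_mult [OF K(1), of 1 A] ord_ge_mult [OF K(1), of 1 B]
        fps3_comp_mult_leading [OF K(1), of 1 A w] fps3_comp_mult_leading [OF K(1), of 1 B w] AB K step
      by (simp_all add: lifts_def)
    then show "ord_ge (Suc w) (f - (\<mu> + K) * B)" "ord_ge (Suc w) (g - (\<mu> + K) * A)"
      unfolding split using \<mu> pq unfolding p_def q_def by (metis ord_ge_Suc_diff)+
  qed
  ultimately show ?case by blast
qed

text \<open>For \<open>h = A f - B g\<close> of order \<open>d\<close> and lifts \<open>A, B, \<mu>\<close> of \<open>n, m, l\<close> one has
  \<open>\<mu> h = (f - \<mu> B) g - (g - \<mu> A) f\<close>. These two relations lift generators of the syzygies of
  \<open>l m\<close>, \<open>l n\<close> and the initial form of \<open>h\<close>.\<close>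

lemma tangent_ideal_common_factor:
  "\<exists>d h h1 h2. homogeneous3 d h \<and> h = h1 * m + h2 * n \<and> (\<forall>u. h \<noteq> l * u) \<and>
    tangent_ideal (ideal2 f g) = ideal3 (l * m) (l * n) h"
proof -
  obtain A B d where AB: "lifts A B" and d: "4 \<le> d" "ord_ge d (A * f - B * g)"
    and notin: "fps3_comp d (A * f - B * g) \<notin> ideal2 (l * m) (l * n)"
    using exists_lift by blast
  obtain \<mu> where \<mu>: "ord_ge 1 \<mu>" "fps3_comp 1 \<mu> = l" "ord_ge (d - 1) (f - \<mu> * B)" "ord_ge (d - 1) (g - \<mu> * A)"
    using exists_lift_l [OF AB d(2), of "d - 1"] d(1) by fastforce
  define p q H where "p = f - \<mu> * B" and "q = g - \<mu> * A" and "H = A * f - B * g"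
  define p' q' h where "p' = fps3_comp (d - 1) p" and "q' = fps3_comp (d - 1) q" and "h = fps3_comp d H"
  note I = is_ideal_ideal2 [of f g]
  have A: "ord_ge 1 A" "fps3_comp 1 A = n" and B: "ord_ge 1 B" "fps3_comp 1 B = m" using AB by (simp_all add: lifts_def)
  have p: "ord_ge (d - 1) p" and q: "ord_ge (d - 1) q" and H: "ord_ge d H"
    using \<mu> d by (simp_all add: p_def q_def H_def)
  have H_eq: "H = A * p - B * q" and \<mu>H: "\<mu> * H = p * g - q * f"
    by (simp_all add: H_def p_def q_def algebra_simps)
  have h_eq: "h = (- q') * m + p' * n"
  proof -
    have "fps3_comp d (A * p) = n * p'" "fps3_comp d (B * q) = m * q'"
      using fps3_comp_mult_leading [OF A(1) p, of d] fps3_comp_mult_leading [OF B(1) q, of d] d A B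
      by (simp_all add: p'_def q'_def)
    then show ?thesis by (simp add: h_def H_eq algebra_simps)
  qed
  have h_notin: "h \<notin> ideal2 (l * m) (l * n)" using notin by (simp add: h_def H_def)
  \<comment> \<open>If \<open>h = l u\<close>, then \<open>u\<close> lies in \<open>(m, n)\<close>
    because \<open>h\<close> does and \<open>l\<close> is regular there; this would put
    \<open>h\<close> into \<open>(l m, l n)\<close>.\<close>
  have not_dvd: "h \<noteq> l * u" for u
  proof
    assume u: "h = l * u"
    then obtain b c where "u = b * m + c * n" using linear_forms_regular [OF lin ind] h_eq by metis
    then have "h = b * (l * m) + c * (l * n)" using u by (simp add: algebra_simps)
    then show False using h_notin unfolding ideal2_def by blast
  qed
  have hom: "homogeneous3 d h" "homogeneous3 (d - 1) p'" "homogeneous3 (d - 1) q'" by (simp_all add: h_def p'_def q'_def)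
  have homlm: "homogeneous3 2 (l * m)" "homogeneous3 2 (l * n)" by (simp_all flip: f(2) g(2))
  have H_mem: "H \<in> ideal2 f g"
  proof -
    have "H = A * f + (- B) * g" by (simp add: H_def)
    then show ?thesis unfolding ideal2_def by blast
  qed
  have "l * m \<in> tangent_ideal (ideal2 f g)" "l * n \<in> tangent_ideal (ideal2 f g)" "h \<in> tangent_ideal (ideal2 f g)"
    using leading_formsI [OF generators_in_ideal2(1) f(1), of g] leading_formsI [OF generators_in_ideal2(2) g(1), of f]
      leading_formsI [OF H_mem H] unfolding f g h_def [symmetric]
    by (simp_all only: tangent_ideal_homogeneous [OF I homlm(1)] tangent_ideal_homogeneous [OF I homlm(2)]
      tangent_ideal_homogeneous [OF I hom(1)])
  then have "ideal3 (l * m) (l * n) h \<subseteq> tangent_ideal (ideal2 f g)"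
    by (intro ideal3_subset is_ideal_tangent_ideal I)
  moreover have "tangent_ideal (ideal2 f g) \<subseteq> ideal3 (l * m) (l * n) h"
  proof (rule leading_forms_subset_imp_tangent_subset [OF is_ideal_ideal3])
    fix t
    show "leading_forms (ideal2 f g) t \<subseteq> ideal3 (l * m) (l * n) h"
    proof
      fix x assume "x \<in> leading_forms (ideal2 f g) t"
      then obtain F where F: "x = fps3_comp t F" "F \<in> ideal2 f g" "ord_ge t F"
        by (auto simp: leading_forms_def)
      then obtain \<alpha>0 \<beta>0 where F0: "F = \<alpha>0 * f + \<beta>0 * g" by (auto simp: ideal2_def)
      \<comment> \<open>For \<open>w < d\<close> the term with \<open>H\<close> does not reach
        degree \<open>w\<close>; since \<open>w - d\<close> is then truncated, the default value
        \<open>0\<close> takes its place.\<close>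
      have lead: "fps3_comp w (\<alpha> * f + \<beta> * g + \<gamma> * H) = fps3_comp (w - 2) \<alpha> * (l * m) + fps3_comp (w - 2) \<beta> * (l * n)
          + (if d \<le> w then fps3_comp (w - d) \<gamma> else 0) * h"
        if "2 \<le> w" "ord_ge (w - 2) \<alpha>" "ord_ge (w - 2) \<beta>" "ord_ge (w - d) \<gamma>" for w \<alpha> \<beta> \<gamma>
      proof -
        have "fps3_comp w (\<gamma> * H) = (if d \<le> w then fps3_comp (w - d) \<gamma> else 0) * h"
          using fps3_comp_mult_leading [OF that(4) H, of w] ord_ge_mult2 [OF H, of \<gamma>] by (auto simp: h_def ord_ge_iff_comp)
        then show ?thesis
          using fps3_comp_mult_leading [OF that(2) f(1), of w] fps3_comp_mult_leading [OF that(3) g(1), of w] that(1) f g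
          by simp
      qed
      show "x \<in> ideal3 (l * m) (l * n) h"
      proof (cases "2 \<le> t")
        case False
        then have "x = 0" using F(1) F0 f(1) g(1)
          by (metis ord_ge_iff_comp ord_ge_mult2 ord_ge_simps(3) not_le)
        then show ?thesis by (simp add: is_idealD is_ideal_ideal3)
      next
        case True
        have "\<exists>\<alpha> \<beta> \<gamma>. F = \<alpha> * f + \<beta> * g + \<gamma> * H \<and> ord_ge (t - 2) \<alpha> \<and> ord_ge (t - 2) \<beta> \<and> ord_ge (t - d) \<gamma>"
          using True F(3)
        proof (induction t rule: dec_induct)
          case base
          show ?case
            by (rule exI [of _ \<alpha>0], rule exI [of _ \<beta>0], rule exI [of _ 0]) (simp add: F0)
        next
          case (step w)
          then obtain \<alpha> \<beta> \<gamma> where F': "F = \<alpha> * f + \<beta> * g + \<gamma> * H"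
            and ord: "ord_ge (w - 2) \<alpha>" "ord_ge (w - 2) \<beta>" "ord_ge (w - d) \<gamma>"
            by (auto simp: ord_ge_Suc)
          define a b c where "a = fps3_comp (w - 2) \<alpha>" and "b = fps3_comp (w - 2) \<beta>"
            and "c = (if d \<le> w then fps3_comp (w - d) \<gamma> else 0)"
          have habc: "homogeneous3 (w - 2) a" "homogeneous3 (w - 2) b" by (simp_all add: a_def b_def)
          have zero: "a * (l * m) + b * (l * n) + c * h = 0"
            using lead [OF \<open>2 \<le> w\<close> ord] step.prems F' by (simp add: ord_ge_Suc a_def b_def c_def)
          \<comment> \<open>As \<open>l\<close> is prime and does not divide \<open>h\<close>, it
            divides \<open>c\<close>.\<close>
          then have "l * (- (a * m + b * n)) = c * h"
            by (simp add: algebra_simps) (metis add.commute add.left_commute minus_unique minus_add_distrib)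
          then obtain c1 where c1: "c = l * c1"
            using linear_form_prime [OF lin ind] not_dvd by blast
          define c2 where "c2 = (if d + 1 \<le> w then poly3_comp (w - (d + 1)) c1 else 0)"
          have "c = l * c2"
          proof (cases "d \<le> w")
            case True
            then have "c = poly3_comp (w - d) (c1 * l)"
              using homogeneous3_fps3_comp [of "w - d" \<gamma>] c1 by (simp add: c_def homogeneous3_iff_comp mult.commute)
            then show ?thesis
              unfolding poly3_comp_mult_homogeneous [OF lin(1)] c2_def using True by (auto simp: mult.commute)
          qed (simp add: c_def c2_def)
          then have "c1 = c2" using c1 nonzero by simp
          have homc2: "c2 = 0 \<or> d + 1 \<le> w \<and> homogeneous3 (w - (d + 1)) c2" by (simp add: c2_def)
          have homc2q: "homogeneous3 (w - 2) (c2 * q')" "homogeneous3 (w - 2) (c2 * p')"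
            using homc2 homogeneous3_mult [of "w - (d + 1)" c2 "d - 1"] hom d by (auto simp: Suc_diff_Suc numeral_2_eq_2)
          \<comment> \<open>Cancelling \<open>l\<close> leaves a syzygy of \<open>m\<close> and
            \<open>n\<close> alone, which is a Koszul one.\<close>
          have "l * ((a - c2 * q') * m + (b + c2 * p') * n) = a * (l * m) + b * (l * n) + c * h"
            unfolding h_eq \<open>c = l * c2\<close> by (simp add: algebra_simps)
          then have "(a - c2 * q') * m + (b + c2 * p') * n = 0" using zero nonzero by simp
          then obtain \<delta> where \<delta>: "a - c2 * q' = \<delta> * n" "b + c2 * p' = - \<delta> * m"
            using linear_forms_syzygy [OF lin ind] by blast
          define e where "e = (if 1 \<le> w - 2 then poly3_comp (w - 2 - 1) \<delta> else 0)"
          have e: "a - c2 * q' = e * n" "b + c2 * p' = - e * m"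
          proof -
            have "homogeneous3 (w - 2) (a - c2 * q')" "homogeneous3 (w - 2) (b + c2 * p')"
              using habc homc2q by simp_all
            then have "a - c2 * q' = poly3_comp (w - 2) (\<delta> * n)" "b + c2 * p' = - poly3_comp (w - 2) (\<delta> * m)"
              unfolding \<delta> homogeneous3_iff_comp by simp_all
            then show "a - c2 * q' = e * n" "b + c2 * p' = - e * m"
              unfolding poly3_comp_mult_homogeneous [OF lin(2)] poly3_comp_mult_homogeneous [OF lin(3)] e_def by auto
          qed
          define C E where "C = fps3_of_poly3 c2" and "E = fps3_of_poly3 e"
          have C: "ord_ge (w - 2) (C * r) \<and> fps3_comp (w - 2) (C * r) = c2 * fps3_comp (d - 1) r" if "ord_ge (d - 1) r" for r
            using homc2
          proof (elim disjE conjE)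
            assume w: "d + 1 \<le> w" and "homogeneous3 (w - (d + 1)) c2"
            show ?thesis
            proof -
              have C: "ord_ge (w - (d + 1)) C" "fps3_comp (w - (d + 1)) C = c2"
                using \<open>homogeneous3 (w - (d + 1)) c2\<close> by (simp_all add: C_def)
              have w': "w - 2 = w - (d + 1) + (d - 1)" using w d by simp
              show ?thesis
                using ord_ge_mult' [OF C(1) that w'] fps3_comp_mult_leading [OF C(1) that w'] C(2) by metis
            qed
          qed (simp add: C_def)
          have E: "ord_ge (w - 2) (E * r) \<and> fps3_comp (w - 2) (E * r) = e * fps3_comp 1 r" if "ord_ge 1 r" for r
          proof (cases "1 \<le> w - 2")
            case True
            then have "homogeneous3 (w - 2 - 1) e" by (simp add: e_def)
            then have E: "ord_ge (w - 2 - 1) E" "fps3_comp (w - 2 - 1) E = e" by (simp_all add: E_def)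
            have w: "w - 2 = w - 2 - 1 + 1" using True by simp
            show ?thesis
              using ord_ge_mult' [OF E(1) that w] fps3_comp_mult_leading [OF E(1) that w] E(2) by metis
          qed (simp add: E_def e_def)
          \<comment> \<open>Using \<open>C\<close> times the relation for \<open>\<mu> * H\<close>
            and \<open>E\<close> times the one defining \<open>H\<close> leaves \<open>F\<close>
            unchanged and removes the unwanted leading forms of the coefficients.\<close>
          have "F = (\<alpha> - C * q - E * A) * f + (\<beta> + C * p + E * B) * g + (\<gamma> - C * \<mu> + E) * H"
          proof -
            have "(\<alpha> - C * q - E * A) * f + (\<beta> + C * p + E * B) * g + (\<gamma> - C * \<mu> + E) * H
              = F + C * ((p * g - q * f) - \<mu> * H) + E * (H - (A * f - B * g))"
              unfolding F' by (simp add: algebra_simps)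
            then show ?thesis unfolding \<mu>H by (simp add: H_def)
          qed
          moreover have "ord_ge (Suc (w - 2)) (\<alpha> - C * q - E * A)" "ord_ge (Suc (w - 2)) (\<beta> + C * p + E * B)"
            unfolding ord_ge_Suc using C [OF p] C [OF q] E [OF A(1)] E [OF B(1)] ord e A B
            by (simp_all add: a_def [symmetric] b_def [symmetric] p'_def [symmetric] q'_def [symmetric])
          moreover have "ord_ge (Suc w - d) (\<gamma> - C * \<mu> + E)"
          proof (cases "d \<le> w")
            case True
            have "ord_ge (w - d) (C * \<mu>) \<and> fps3_comp (w - d) (C * \<mu>) = c2 * l"
              using homc2
            proof (elim disjE conjE)
              assume "d + 1 \<le> w" "homogeneous3 (w - (d + 1)) c2"
              then show ?thesis
                using ord_ge_mult [of "w - (d + 1)" C 1 \<mu>] fps3_comp_mult_leading [of "w - (d + 1)" C 1 \<mu> "w - d"] \<mu>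
                by (simp add: C_def Suc_diff_Suc)
            qed (simp add: C_def)
            \<comment> \<open>\<open>E\<close> has order at least \<open>w - 3\<close>, which
              exceeds \<open>w - d\<close> because \<open>d\<close> is at least four. So
              \<open>E\<close> does not disturb the leading form of the coefficient of
              \<open>H\<close>.\<close>
            moreover have "ord_ge (Suc (w - d)) E"
            proof -
              have "homogeneous3 (w - 2 - 1) e" by (simp add: e_def)
              then have "ord_ge (w - 2 - 1) E" by (simp add: E_def)
              then show ?thesis by (rule ord_ge_mono) (use True d in linarith)
            qed
            moreover have "fps3_comp (w - d) \<gamma> = c2 * l" using True \<open>c = l * c2\<close> by (simp add: c_def mult.commute)
            ultimately have "ord_ge (Suc (w - d)) (\<gamma> - C * \<mu> + E)"
              using ord(3) by (simp add: ord_ge_Suc)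
            then show ?thesis using True by (simp add: Suc_diff_le)
          qed simp
          ultimately show ?case using \<open>2 \<le> w\<close> by (metis Suc_diff_le)
        qed
        then obtain \<alpha> \<beta> \<gamma> where "F = \<alpha> * f + \<beta> * g + \<gamma> * H" "ord_ge (t - 2) \<alpha>" "ord_ge (t - 2) \<beta>" "ord_ge (t - d) \<gamma>" by blast
        then have "x = fps3_comp (t - 2) \<alpha> * (l * m) + fps3_comp (t - 2) \<beta> * (l * n)
          + (if d \<le> t then fps3_comp (t - d) \<gamma> else 0) * h"
          using lead [OF True] F(1) by blast
        then show ?thesis unfolding ideal3_def by blast
      qed
    qed
  qed
  ultimately have "tangent_ideal (ideal2 f g) = ideal3 (l * m) (l * n) h" by blast
  then show ?thesis using hom(1) h_eq not_dvd by blast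
qed

end

text \<open>Square-freeness enters in the case of a common factor \<open>l\<close>, where it makes
  \<open>l\<close>, \<open>m\<close>, \<open>n\<close> independent.\<close>

theorem exists_linear_parameter:
  fixes f g :: "'k::{field, field_char_0} fps3"
  defines "\<phi> \<equiv> fps3_comp 2 f" and "\<gamma> \<equiv> fps3_comp 2 g"
  assumes f: "ord_ge 2 f" and g: "ord_ge 2 g" and ne: "\<phi> \<noteq> 0" "\<And>c. \<gamma> \<noteq> scalar3 c * \<phi>"
    and coprime: "\<And>a b. a * f = b * g \<Longrightarrow> \<exists>c. b = c * f"
    and sqfree: "\<And>l. homogeneous3 1 l \<Longrightarrow> l ^ 2 \<in> tangent_ideal (ideal2 f g) \<Longrightarrow> l = 0"
  shows "\<exists>l. linear_parameter (tangent_ideal (ideal2 f g)) l"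
proof -
  note I = is_ideal_ideal2 [of f g]
  note T = is_ideal_tangent_ideal [OF I]
  have hom: "homogeneous3 2 \<phi>" "homogeneous3 2 \<gamma>" by (simp_all add: \<phi>_def \<gamma>_def)
  from conic_pencil [OF hom(1) ne(1) hom(2) ne(2)] show ?thesis
  proof (elim disjE conjE exE)
    fix l assume "linear_parameter (ideal2 \<phi> \<gamma>) l"
      and "\<forall>\<alpha> \<beta>. \<alpha> * \<phi> + \<beta> * \<gamma> = 0 \<longrightarrow> (\<exists>c. \<alpha> = c * \<gamma> \<and> \<beta> = - c * \<phi>)"
    then show ?thesis
      using tangent_ideal_coprime [OF f g] unfolding \<phi>_def \<gamma>_def by metis
  next
    fix l m n c assume lin: "homogeneous3 1 l" "homogeneous3 1 m" "homogeneous3 1 n"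
      and \<phi>: "\<phi> = l * m" and \<gamma>: "\<gamma> = scalar3 c * \<phi> + l * n"
    \<comment> \<open>Subtracting \<open>c * f\<close> from \<open>g\<close> keeps the ideal and
      makes the leading form the pure product \<open>l * n\<close>.\<close>
    define g' where "g' = g + fps3_of_poly3 (scalar3 (- c)) * f"
    have id: "ideal2 f g' = ideal2 f g"
      unfolding g'_def using ideal2_change [of 1 1 f g] by simp
    have g'_ord: "ord_ge 2 g'" using f g by (simp add: g'_def ord_ge_mult2)
    have "fps3_comp 2 (fps3_of_poly3 (scalar3 (- c)) * f) = scalar3 (- c) * \<phi>"
      using fps3_comp_mult_leading [of 0 "fps3_of_poly3 (scalar3 (- c))" 2 f 2] f by (simp add: \<phi>_def)
    then have g'_comp: "fps3_comp 2 g' = l * n"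
      unfolding g'_def fps3_comp_simps \<gamma>_def [symmetric] \<gamma> by (simp add: scalar3_minus)
    have mem: "l * m \<in> tangent_ideal (ideal2 f g)" "l * n \<in> tangent_ideal (ideal2 f g)"
    proof -
      have "fps3_comp 2 f \<in> tangent_ideal (ideal2 f g)"
        unfolding tangent_ideal_homogeneous [OF I homogeneous3_fps3_comp]
        by (rule leading_formsI [OF generators_in_ideal2(1) f])
      then show "l * m \<in> tangent_ideal (ideal2 f g)" using \<phi> by (simp add: \<phi>_def)
      have "fps3_comp 2 g' \<in> tangent_ideal (ideal2 f g)"
        unfolding tangent_ideal_homogeneous [OF I homogeneous3_fps3_comp] unfolding id [symmetric]
        by (rule leading_formsI [OF generators_in_ideal2(2) g'_ord])
      then show "l * n \<in> tangent_ideal (ideal2 f g)" by (simp add: g'_comp)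
    qed
    have l0: "l \<noteq> 0" "m \<noteq> 0" using \<phi> ne(1) by auto
    have ind: "lin_indep3 l m n"
      unfolding lin_indep3_def
    proof (intro allI impI)
      fix x y z assume eq: "scalar3 x * l + scalar3 y * m + scalar3 z * n = 0"
      have x: "x = 0"
      proof (rule ccontr)
        assume "x \<noteq> 0"
        \<comment> \<open>Multiplied by \<open>l / x\<close>, the relation expresses
          \<open>l ^ 2\<close> through \<open>l * m\<close> and \<open>l * n\<close>.\<close>
        have "scalar3 (1 / x) * l * (scalar3 x * l + scalar3 y * m + scalar3 z * n) = 0" by (simp only: eq mult_zero_right)
        moreover have "scalar3 (1 / x) * l * (scalar3 x * l + scalar3 y * m + scalar3 z * n)
          = scalar3 (1 / x * x) * (l * l) + (scalar3 (1 / x) * scalar3 y * (l * m) + scalar3 (1 / x) * scalar3 z * (l * n))"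
          by (simp only: scalar3_mult) (simp add: algebra_simps)
        ultimately have "l ^ 2 = - (scalar3 (1 / x) * scalar3 y * (l * m) + scalar3 (1 / x) * scalar3 z * (l * n))"
          unfolding power2_eq_square eq_neg_iff_add_eq_0 using \<open>x \<noteq> 0\<close> by simp
        also have "\<dots> \<in> tangent_ideal (ideal2 f g)"
          by (intro is_idealD(5) [OF T] is_idealD(2) [OF T] is_idealD(3) [OF T] mem)
        finally show False using sqfree [OF lin(1)] l0 by blast
      qed
      have z: "z = 0"
      proof (rule ccontr)
        assume z0: "z \<noteq> 0"
        \<comment> \<open>Here \<open>n\<close> would be a multiple of \<open>m\<close>, and hence
          \<open>\<gamma>\<close> one of \<open>\<phi>\<close>.\<close>
        have "scalar3 y * m + scalar3 z * n = 0" using eq x by simp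
        then have "scalar3 (1 / z) * l * (scalar3 y * m + scalar3 z * n) = 0" by simp
        moreover have "scalar3 (1 / z) * l * (scalar3 y * m + scalar3 z * n)
          = scalar3 (y / z) * (l * m) + scalar3 (1 / z * z) * (l * n)"
        proof -
          have "y / z = 1 / z * y" by simp
          then show ?thesis by (simp only: scalar3_mult) (simp add: algebra_simps)
        qed
        ultimately have "l * n = - (scalar3 (y / z) * \<phi>)" using z0 by (simp add: \<phi> add_eq_0_iff)
        then have "\<gamma> = scalar3 (c - y / z) * \<phi>" unfolding \<gamma> by (simp add: scalar3_diff algebra_simps)
        then show False using ne(2) by blast
      qed
      show "x = 0 \<and> y = 0 \<and> z = 0" using x z eq l0 by auto
    qed
    have coprime': "\<exists>c. b = c * f" if "a * f = b * g'" for a b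
    proof (rule coprime)
      show "(a - b * fps3_of_poly3 (scalar3 (- c))) * f = b * g"
        using that by (simp add: g'_def algebra_simps)
    qed
    interpret common_factor_pair f g' l m n
      using f g'_ord g'_comp lin ind coprime' \<phi> by unfold_locales (simp_all add: \<phi>_def)
    from tangent_ideal_common_factor obtain d h h1 h2 where h: "homogeneous3 d h" "h = h1 * m + h2 * n" "\<And>u. h \<noteq> l * u"
      and "tangent_ideal (ideal2 f g') = ideal3 (l * m) (l * n) h" by blast
    then show ?thesis
      using linear_parameter_linear_forms [OF lin ind h] unfolding id by metis
  qed
qed

section \<open>Prime and maximal ideals\<close>

definition is_prime_ideal :: "'a::comm_ring_1 set \<Rightarrow> bool" where
  "is_prime_ideal M \<longleftrightarrow> is_ideal M \<and> 1 \<notin> M \<and> (\<forall>a b. a * b \<in> M \<longrightarrow> a \<in> M \<or> b \<in> M)"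

definition is_maximal_ideal :: "'a::comm_ring_1 set \<Rightarrow> bool" where
  "is_maximal_ideal M \<longleftrightarrow> is_ideal M \<and> 1 \<notin> M \<and> (\<forall>K. is_ideal K \<longrightarrow> M \<subseteq> K \<longrightarrow> 1 \<notin> K \<longrightarrow> K = M)"

text \<open>If \<open>a\<close> is outside \<open>M\<close>, then \<open>M + (a)\<close> contains
  \<open>1\<close>; multiplying this by \<open>b\<close> puts \<open>b\<close> into
  \<open>M\<close>.\<close>

lemma maximal_imp_prime:
  assumes M: "is_maximal_ideal M"
  shows "is_prime_ideal M"
proof -
  have I: "is_ideal M" and "1 \<notin> M" using M by (auto simp: is_maximal_ideal_def)
  have "a \<in> M \<or> b \<in> M" if ab: "a * b \<in> M" for a b
  proof (rule ccontr)
    assume neg: "\<not> (a \<in> M \<or> b \<in> M)"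
    let ?K = "{p. \<exists>q. p - a * q \<in> M}"
    have K: "is_ideal ?K"
    proof (rule is_idealI)
      have "0 - a * 0 \<in> M" using is_idealD(1) [OF I] by simp
      then show "0 \<in> ?K" by blast
      show "x + y \<in> ?K" if x: "x \<in> ?K" and y: "y \<in> ?K" for x y
      proof -
        obtain q r where "x - a * q \<in> M" "y - a * r \<in> M" using x y by blast
        then have "(x - a * q) + (y - a * r) \<in> M" by (rule is_idealD(2) [OF I])
        moreover have "(x - a * q) + (y - a * r) = x + y - a * (q + r)" by (simp add: algebra_simps)
        ultimately show ?thesis by auto
      qed
      show "r * x \<in> ?K" if x: "x \<in> ?K" for r x
      proof -
        obtain q where "x - a * q \<in> M" using x by blast
        then have "r * (x - a * q) \<in> M" by (rule is_idealD(3) [OF I])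
        moreover have "r * (x - a * q) = r * x - a * (r * q)" by (simp add: algebra_simps)
        ultimately show ?thesis by auto
      qed
    qed
    have "M \<subseteq> ?K"
    proof
      fix x assume "x \<in> M"
      then have "x - a * 0 \<in> M" by simp
      then show "x \<in> ?K" by blast
    qed
    moreover have "1 \<notin> ?K"
    proof
      assume "1 \<in> ?K"
      then obtain q where "1 - a * q \<in> M" by blast
      then have "b * (1 - a * q) + a * b * q \<in> M"
        by (intro is_idealD(2) [OF I] is_idealD(3) [OF I] is_idealD(4) [OF I ab])
      moreover have "b * (1 - a * q) + a * b * q = b" by (simp add: algebra_simps)
      ultimately show False using neg by simp
    qed
    ultimately have "?K = M" using M K unfolding is_maximal_ideal_def by blast
    moreover have "a - a * 1 \<in> M" using is_idealD(1) [OF I] by simp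
    then have "a \<in> ?K" by blast
    ultimately show False using neg by blast
  qed
  then show ?thesis using I \<open>1 \<notin> M\<close> by (auto simp: is_prime_ideal_def)
qed

lemma exists_maximal_ideal:
  assumes K: "is_ideal K" "1 \<notin> K"
  shows "\<exists>M. is_maximal_ideal M \<and> K \<subseteq> M"
proof -
  let ?A = "{M. is_ideal M \<and> K \<subseteq> M \<and> 1 \<notin> M}"
  have "\<exists>M\<in>?A. \<forall>N\<in>?A. M \<subseteq> N \<longrightarrow> N = M"
  proof (rule subset_Zorn_nonempty)
    show "?A \<noteq> {}" using K by blast
    fix C assume C: "C \<noteq> {}" "subset.chain ?A C"
    then have CA: "M \<in> C \<Longrightarrow> is_ideal M \<and> K \<subseteq> M \<and> 1 \<notin> M" for M
      unfolding subset.chain_def by blast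
    have "is_ideal (\<Union>C)"
    proof (rule is_idealI)
      show "0 \<in> \<Union>C" using C(1) CA is_idealD(1) by blast
      show "a + b \<in> \<Union>C" if ab: "a \<in> \<Union>C" "b \<in> \<Union>C" for a b
      proof -
        obtain M N where MN: "M \<in> C" "N \<in> C" "a \<in> M" "b \<in> N" using ab by blast
        then have "M \<subseteq> N \<or> N \<subseteq> M" using C(2) unfolding subset.chain_def by blast
        then obtain L where "L \<in> C" "a \<in> L" "b \<in> L" using MN by blast
        then show ?thesis using CA is_idealD(2) by blast
      qed
      show "r * a \<in> \<Union>C" if a: "a \<in> \<Union>C" for r a
        using a CA is_idealD(3) by blast
    qed
    then show "\<Union>C \<in> ?A" using C(1) CA by blast
  qed
  then obtain M where M: "is_ideal M" "K \<subseteq> M" "1 \<notin> M" "\<forall>N\<in>?A. M \<subseteq> N \<longrightarrow> N = M" by blast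
  then have "is_maximal_ideal M" unfolding is_maximal_ideal_def by blast
  then show ?thesis using M by blast
qed

section \<open>Hilbert's basis theorem\<close>

text \<open>Generation is expressed through all ideals above \<open>S\<close>, so no generated ideal
  has to be constructed.\<close>

definition fin_gen_ideal :: "'a::comm_ring_1 set \<Rightarrow> bool" where
  "fin_gen_ideal I \<longleftrightarrow> (\<exists>S. finite S \<and> S \<subseteq> I \<and> (\<forall>K. is_ideal K \<longrightarrow> S \<subseteq> K \<longrightarrow> I \<subseteq> K))"

lemma fin_gen_idealE:
  assumes "fin_gen_ideal I"
  obtains S where "finite S" "S \<subseteq> I" "\<And>K. is_ideal K \<Longrightarrow> S \<subseteq> K \<Longrightarrow> I \<subseteq> K"
  using assms unfolding fin_gen_ideal_def by metis

lemma fin_gen_ideal_field: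
  assumes "is_ideal (I :: 'a::field set)"
  shows "fin_gen_ideal I"
proof (cases "I \<subseteq> {0}")
  case True
  then show ?thesis unfolding fin_gen_ideal_def
    by (intro exI [of _ "{}"]) (use is_idealD(1) in blast)
next
  case False
  then obtain a where a: "a \<in> I" "a \<noteq> 0" by blast
  have "I \<subseteq> K" if "is_ideal K" "{a} \<subseteq> K" for K
  proof
    fix x
    have "x / a * a \<in> K" using that is_idealD(3) by blast
    then show "x \<in> K" using a by simp
  qed
  then show ?thesis unfolding fin_gen_ideal_def using a by (intro exI [of _ "{a}"]) simp
qed

text \<open>Hilbert's argument: the ideals of leading coefficients in degree \<open>n\<close> grow
  to a final one at some \<open>N\<close>, and polynomials realising their generators in degrees up
  to \<open>N\<close> generate \<open>I\<close>.\<close>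

lemma fin_gen_ideal_poly:
  fixes I :: "'a::comm_ring_1 poly set"
  assumes noeth: "\<And>I :: 'a set. is_ideal I \<Longrightarrow> fin_gen_ideal I" and I: "is_ideal I"
  shows "fin_gen_ideal I"
proof -
  \<comment> \<open>Degrees smaller than \<open>n\<close> are allowed, so that zero is included and
    the coefficients form an ideal.\<close>
  define LC :: "'a poly set \<Rightarrow> nat \<Rightarrow> 'a set" where "LC = (\<lambda>Q n. {coeff p n | p. p \<in> Q \<and> degree p \<le> n})"
  have LC: "is_ideal (LC Q n)" if Q: "is_ideal Q" for Q :: "'a poly set" and n
  proof (rule is_idealI)
    show "0 \<in> LC Q n" unfolding LC_def
      by (rule CollectI, rule exI [of _ 0]) (simp add: is_idealD(1) [OF Q])
    fix a assume "a \<in> LC Q n"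
    then obtain p where p: "a = coeff p n" "p \<in> Q" "degree p \<le> n" by (auto simp: LC_def)
    show "r * a \<in> LC Q n" for r
    proof -
      have "smult r p = [:r:] * p" by simp
      then have "smult r p \<in> Q" using is_idealD(3) [OF Q p(2)] by metis
      moreover have "degree (smult r p) \<le> n" using p(3) degree_smult_le le_trans by blast
      ultimately show ?thesis unfolding LC_def using p(1)
        by (intro CollectI exI [of _ "smult r p"]) simp
    qed
    fix b assume "b \<in> LC Q n"
    then obtain q where q: "b = coeff q n" "q \<in> Q" "degree q \<le> n" by (auto simp: LC_def)
    show "a + b \<in> LC Q n" unfolding LC_def
      by (rule CollectI, rule exI [of _ "p + q"]) (use p q is_idealD(2) [OF Q] in \<open>simp add: degree_add_le\<close>)
  qed
  have LC_shift: "coeff p n \<in> LC Q (n + k)" if "p \<in> Q" "degree p \<le> n" "is_ideal Q" for Q :: "'a poly set" and p n k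
  proof -
    have "monom 1 k * p \<in> Q" using that is_idealD(3) by blast
    moreover have "degree (monom 1 k * p) \<le> n + k"
      using degree_mult_le [of "monom 1 k" p] degree_monom_le [of "1::'a" k] that(2) by linarith
    moreover have "coeff (monom 1 k * p) (n + k) = coeff p n" by (simp add: coeff_monom_mult)
    ultimately show ?thesis unfolding LC_def by (metis (mono_tags, lifting) mem_Collect_eq)
  qed
  have mono: "LC I n \<subseteq> LC I m" if "n \<le> m" for n m
  proof
    fix a assume "a \<in> LC I n"
    then obtain p where "a = coeff p n" "p \<in> I" "degree p \<le> n" by (auto simp: LC_def)
    then show "a \<in> LC I m" using LC_shift [of p I n "m - n"] I that by simp
  qed
  let ?U = "\<Union>n. LC I n"
  have "is_ideal ?U"
  proof (rule is_idealI)
    show "0 \<in> ?U" using is_idealD(1) [OF LC [OF I]] by blast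
    show "a + b \<in> ?U" if ab: "a \<in> ?U" "b \<in> ?U" for a b
    proof -
      obtain n m where "a \<in> LC I n" "b \<in> LC I m" using ab by blast
      then have "a \<in> LC I (max n m)" "b \<in> LC I (max n m)"
        using mono [of n "max n m"] mono [of m "max n m"] by auto
      then show ?thesis using is_idealD(2) [OF LC [OF I]] by blast
    qed
    show "r * a \<in> ?U" if "a \<in> ?U" for r a using that is_idealD(3) [OF LC [OF I]] by blast
  qed
  then obtain S where S: "finite S" "S \<subseteq> ?U" "\<And>K. is_ideal K \<Longrightarrow> S \<subseteq> K \<Longrightarrow> ?U \<subseteq> K"
    using noeth fin_gen_idealE by metis
  have "\<exists>N. S \<subseteq> LC I N"
    using S(1,2)
  proof (induction S rule: finite_induct)
    case (insert a S)
    then obtain N n where "S \<subseteq> LC I N" "a \<in> LC I n" by blast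
    then have "insert a S \<subseteq> LC I (max N n)" using mono [of N "max N n"] mono [of n "max N n"] by auto
    then show ?case by blast
  qed simp
  then obtain N where "S \<subseteq> LC I N" by blast
  then have U: "LC I n \<subseteq> LC I N" for n using S(3) [OF LC [OF I]] by blast
  \<comment> \<open>The intersection with \<open>I\<close> provides, for each leading coefficient, a
    polynomial in both ideals, so that the difference formed below remains in
    \<open>I\<close>.\<close>
  have "\<exists>T. finite T \<and> T \<subseteq> I \<and> (\<forall>Q. is_ideal Q \<longrightarrow> T \<subseteq> Q \<longrightarrow> LC I n \<subseteq> LC (Q \<inter> I) n)" for n
  proof -
    obtain S where S: "finite S" "S \<subseteq> LC I n" "\<And>K. is_ideal K \<Longrightarrow> S \<subseteq> K \<Longrightarrow> LC I n \<subseteq> K"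
      using fin_gen_idealE [OF noeth [OF LC [OF I]]] by metis
    have "\<forall>a\<in>S. \<exists>p. a = coeff p n \<and> p \<in> I \<and> degree p \<le> n" using S(2) by (auto simp: LC_def)
    then obtain F where F: "\<And>a. a \<in> S \<Longrightarrow> a = coeff (F a) n \<and> F a \<in> I \<and> degree (F a) \<le> n" by metis
    have "LC I n \<subseteq> LC (Q \<inter> I) n" if Q: "is_ideal Q" "F ` S \<subseteq> Q" for Q
    proof (rule S(3))
      show "is_ideal (LC (Q \<inter> I) n)"
        by (rule LC) (use Q(1) I in \<open>auto simp: is_ideal_def\<close>)
      show "S \<subseteq> LC (Q \<inter> I) n"
      proof
        fix a assume "a \<in> S"
        then show "a \<in> LC (Q \<inter> I) n" unfolding LC_def
          by (intro CollectI exI [of _ "F a"]) (use F Q(2) in auto)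
      qed
    qed
    then show ?thesis using S(1) F by (intro exI [of _ "F ` S"]) auto
  qed
  then obtain T where T: "\<And>n. finite (T n)" "\<And>n. T n \<subseteq> I"
    "\<And>n Q. is_ideal Q \<Longrightarrow> T n \<subseteq> Q \<Longrightarrow> LC I n \<subseteq> LC (Q \<inter> I) n" by metis
  have "I \<subseteq> Q" if Q: "is_ideal Q" "(\<Union>n\<le>N. T n) \<subseteq> Q" for Q
  proof -
    have "p \<in> I \<longrightarrow> degree p < n \<longrightarrow> p \<in> Q" for p n
    proof (induction n arbitrary: p)
      case (Suc n)
      show ?case
      proof (intro impI)
        assume p: "p \<in> I" "degree p < Suc n"
        \<comment> \<open>Beyond \<open>N\<close> no new leading coefficients appear, so a
          polynomial of degree at most \<open>m\<close>, shifted by \<open>n - m\<close>, cancels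
          the top coefficient.\<close>
        define m where "m = min n N"
        have "coeff p n \<in> LC I n" using p by (auto simp: LC_def)
        then have "coeff p n \<in> LC I m" using U [of n] by (auto simp: m_def min_def)
        moreover have "T m \<subseteq> Q"
          using Q(2) UN_upper [of m "{..N}" T] by (auto simp: m_def)
        ultimately have "coeff p n \<in> LC (Q \<inter> I) m" using T(3) [OF Q(1)] by blast
        then obtain q where q: "coeff p n = coeff q m" "q \<in> Q" "q \<in> I" "degree q \<le> m"
          by (auto simp: LC_def)
        define r where "r = p - monom 1 (n - m) * q"
        have mem: "monom 1 (n - m) * q \<in> Q" "monom 1 (n - m) * q \<in> I"
          using q is_idealD(3) Q(1) I by blast+
        have "m \<le> n" by (simp add: m_def)
        have "degree (monom 1 (n - m) * q) \<le> n"
          using degree_mult_le [of "monom 1 (n - m)" q] degree_monom_le [of "1::'a" "n - m"] q(4) \<open>m \<le> n\<close> by linarith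
        then have "degree r \<le> n" unfolding r_def using p(2) by (intro degree_diff_le) auto
        moreover have "coeff r n = 0" using q(1) \<open>m \<le> n\<close> by (simp add: r_def coeff_monom_mult)
        ultimately have "r = 0 \<or> degree r < n" by (metis eq_zero_or_degree_less)
        moreover have "r \<in> I" unfolding r_def using mem p I is_idealD(6) by blast
        ultimately have "r \<in> Q" using Suc.IH is_idealD(1) [OF Q(1)] by blast
        then have "r + monom 1 (n - m) * q \<in> Q" using mem is_idealD(2) [OF Q(1)] by blast
        then show "p \<in> Q" by (simp add: r_def)
      qed
    qed simp
    then show ?thesis by blast
  qed
  then show ?thesis unfolding fin_gen_ideal_def using T
    by (intro exI [of _ "\<Union>n\<le>N. T n"]) blast
qed

lemma fin_gen_ideal_poly3:
  "is_ideal (I :: 'k::field poly3 set) \<Longrightarrow> fin_gen_ideal I"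
  by (intro fin_gen_ideal_poly fin_gen_ideal_field)

section \<open>Algebraic dependence modulo an ideal of dimension one\<close>

definition tdeg_le :: "nat \<Rightarrow> 'k::field poly3 \<Rightarrow> bool" where
  "tdeg_le D p \<longleftrightarrow> (\<forall>t>D. poly3_comp t p = 0)"

lemma tdeg_le_mono: "tdeg_le D p \<Longrightarrow> D \<le> E \<Longrightarrow> tdeg_le E p"
  by (auto simp: tdeg_le_def)

lemma tdeg_le_mult:
  assumes "tdeg_le D p" "tdeg_le E q"
  shows "tdeg_le (D + E) (p * q)"
  unfolding tdeg_le_def poly3_comp_mult
proof (intro allI impI sum.neutral ballI)
  fix t s assume "t > D + E" "s \<in> {..t}"
  then have "s > D \<or> t - s > E" by auto
  then show "poly3_comp s p * poly3_comp (t - s) q = 0" using assms by (auto simp: tdeg_le_def)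
qed

lemma tdeg_le_power: "tdeg_le D p \<Longrightarrow> tdeg_le (n * D) (p ^ n)"
proof (induction n)
  case 0
  show ?case by (simp add: tdeg_le_def poly3_comp_homogeneous [OF homogeneous3_one])
next
  case (Suc n)
  then show ?case using tdeg_le_mult [of D p "n * D" "p ^ n"] by simp
qed

lemma exists_tdeg_le: "\<exists>D. tdeg_le D p"
proof -
  obtain D where "\<And>n. n > D \<Longrightarrow> poly3_comp n p = 0" using poly3_eq_sum_comp by blast
  then show ?thesis by (auto simp: tdeg_le_def)
qed

lemma tdeg_le_eq_sum:
  assumes "tdeg_le D p"
  shows "p = (\<Sum>t\<le>D. poly3_comp t p)"
proof (rule poly3_eqI)
  fix i j k :: nat
  have "poly3_coeff p i j k = 0" if "\<not> i + j + k \<le> D"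
    using assms that poly3_coeff_comp [of "i + j + k" p i j k] by (simp add: tdeg_le_def)
  then show "poly3_coeff p i j k = poly3_coeff (\<Sum>t\<le>D. poly3_comp t p) i j k"
    by (auto simp: poly3_coeff_sum poly3_coeff_comp)
qed

abbreviation eval_at :: "'k::field poly3 \<Rightarrow> 'k poly \<Rightarrow> 'k poly3" where
  "eval_at b u \<equiv> poly (map_poly scalar3 u) b"

lemma is_ring_hom_eval_at: "is_ring_hom (eval_at b)"
  by (rule is_ring_hom_eval [OF is_ring_hom_scalar3])

lemma eval_at_pCons: "eval_at b (pCons c u) = scalar3 c + b * eval_at b u"
  by (simp add: map_poly_pCons)

lemma is_ideal_scalar:
  assumes "is_ideal K" "scalar3 c \<in> K" "1 \<notin> K"
  shows "c = 0"
proof (rule ccontr)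
  assume "c \<noteq> 0"
  have "scalar3 (1 / c) * scalar3 c \<in> K" using is_idealD(3) [OF assms(1,2)] by blast
  then show False using assms(3) \<open>c \<noteq> 0\<close> by (simp add: scalar3_mult [symmetric])
qed

text \<open>Over an algebraically closed field \<open>u\<close> splits into linear factors, and a
  prime ideal containing their product at \<open>b\<close> contains one of them.\<close>

lemma eval_at_in_prime:
  fixes u :: "'k::alg_closed_field poly"
  assumes M: "is_prime_ideal M" and "u \<noteq> 0" "eval_at b u \<in> M"
  shows "\<exists>c. b - scalar3 c \<in> M"
proof -
  note h = is_ring_homD [OF is_ring_hom_eval_at [of b]]
  have I: "is_ideal M" "1 \<notin> M" using M by (auto simp: is_prime_ideal_def)
  obtain A where A: "u = smult (lead_coeff u) (\<Prod>x\<in>#A. [:- x, 1:])"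
    using alg_closed_imp_factorization [OF \<open>u \<noteq> 0\<close>] by blast
  then have "u = [:lead_coeff u:] * (\<Prod>x\<in>#A. [:- x, 1:])" by simp
  then have "eval_at b u = scalar3 (lead_coeff u) * eval_at b (\<Prod>x\<in>#A. [:- x, 1:])"
    using h(3) by (metis add.right_neutral eval_at_pCons mult_zero_right h(4))
  moreover have "scalar3 (lead_coeff u) \<notin> M"
    using is_ideal_scalar [OF I(1) _ I(2)] \<open>u \<noteq> 0\<close> by (metis leading_coeff_0_iff)
  ultimately have "eval_at b (\<Prod>x\<in>#A. [:- x, 1:]) \<in> M"
    using M assms(3) unfolding is_prime_ideal_def by metis
  then show ?thesis
  proof (induction A)
    case empty
    then show ?case using I(2) h(1) by simp
  next
    case (add x A)
    have "eval_at b [:- x, 1:] = b - scalar3 x"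
      by (simp add: map_poly_pCons scalar3_minus)
    moreover have "(\<Prod>x\<in>#add_mset x A. [:- x, 1:]) = [:- x, 1:] * (\<Prod>x\<in>#A. [:- x, 1:])"
      by (simp del: mult_pCons_left)
    ultimately have "(b - scalar3 x) * eval_at b (\<Prod>x\<in>#A. [:- x, 1:]) \<in> M"
      using add.prems h(3) by metis
    then have "b - scalar3 x \<in> M \<or> eval_at b (\<Prod>x\<in>#A. [:- x, 1:]) \<in> M"
      using M unfolding is_prime_ideal_def by blast
    then show ?case using add.IH by blast
  qed
qed

text \<open>Regularity strips factors \<open>b\<close> from \<open>u(b)\<close> until the constant
  term is nonzero, and such a relation makes \<open>b\<close> a unit modulo
  \<open>L\<close>.\<close>

lemma regular_eval_at_unit:
  assumes L: "is_ideal L" and reg: "\<And>x. b * x \<in> L \<Longrightarrow> x \<in> L" and "u \<noteq> 0" "eval_at b u \<in> L"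
  shows "\<exists>x. 1 - b * x \<in> L"
  using assms(3,4)
proof (induction u)
  case (pCons c u)
  show ?case
  proof (cases "c = 0")
    case True
    then have "eval_at b u \<in> L" using reg pCons.prems by (simp add: eval_at_pCons)
    moreover have "u \<noteq> 0" using pCons.prems True by auto
    ultimately show ?thesis using pCons.IH by blast
  next
    case False
    have "scalar3 (1 / c) * (scalar3 c + b * eval_at b u) \<in> L"
      using is_idealD(3) [OF L] pCons.prems by (simp add: eval_at_pCons)
    moreover have "scalar3 (1 / c) * (scalar3 c + b * eval_at b u) = 1 - b * (- scalar3 (1 / c) * eval_at b u)"
      using False by (simp add: algebra_simps scalar3_mult [symmetric])
    ultimately show ?thesis by metis
  qed
qed simp

locale graded_parameter =
  fixes J :: "'k::alg_closed_field poly3 set" and l :: "'k poly3"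
  assumes J: "is_ideal J" and graded: "\<And>p t. p \<in> J \<Longrightarrow> poly3_comp t p \<in> J"
    and parameter: "linear_parameter J l" and proper: "1 \<notin> J"
begin

lemma l_hom: "homogeneous3 1 l"
  using parameter by (simp add: linear_parameter_def)

lemma l_regular: "l * p \<in> J \<Longrightarrow> p \<in> J"
  using parameter by (simp add: linear_parameter_def)

text \<open>Taking the component of degree \<open>t + 1\<close> of \<open>p - l * q\<close>, which
  stays in the graded ideal, makes \<open>q\<close> homogeneous.\<close>

lemma exists_degree_surjective:
  "\<exists>T. \<forall>t\<ge>T. \<forall>p. homogeneous3 (Suc t) p \<longrightarrow> (\<exists>q. homogeneous3 t q \<and> p - l * q \<in> J)"
proof -
  obtain T where T: "\<And>t p. t \<ge> T \<Longrightarrow> homogeneous3 t p \<Longrightarrow> \<exists>q. p - l * q \<in> J"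
    using parameter unfolding linear_parameter_def by blast
  have "\<exists>q. homogeneous3 t q \<and> p - l * q \<in> J" if t: "t \<ge> T" and p: "homogeneous3 (Suc t) p" for t p
  proof -
    obtain q where "p - l * q \<in> J" using T [of "Suc t" p] t p by auto
    then have "p - q * l \<in> J" by (simp add: mult.commute)
    then have "poly3_comp (Suc t) (p - q * l) \<in> J" by (rule graded)
    moreover have "poly3_comp (Suc t) (p - q * l) = p - l * poly3_comp t q"
      using p poly3_comp_mult_homogeneous [OF l_hom, of "Suc t" q]
      by (simp add: homogeneous3_iff_comp mult.commute)
    ultimately show ?thesis by (intro exI [of _ "poly3_comp t q"]) simp
  qed
  then show ?thesis by blast
qed

text \<open>Boundedness of the Hilbert function in inhomogeneous form: polynomials of degree at most
  \<open>D\<close> are spanned modulo \<open>J\<close> by \<open>D + 1\<close> powers of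
  \<open>l\<close> times a fixed finite set of monomials, a number that is linear in
  \<open>D\<close>.\<close>

lemma exists_linear_spanning:
  "\<exists>E w. finite (E :: (nat \<times> nat \<times> nat) set) \<and> (\<forall>D p. tdeg_le D p \<longrightarrow>
    (\<exists>a. p - (\<Sum>x\<in>{..D} \<times> E. scalar3 (a x) * w x) \<in> J))"
proof -
  obtain T where T: "\<And>t p. t \<ge> T \<Longrightarrow> homogeneous3 (Suc t) p \<Longrightarrow> \<exists>q. homogeneous3 t q \<and> p - l * q \<in> J"
    using exists_degree_surjective by blast
  define E where "E = (\<Union>t\<le>T. exponents t)"
  define mon :: "nat \<times> nat \<times> nat \<Rightarrow> 'k poly3" where "mon = (\<lambda>(i, j, k). var_x ^ i * var_y ^ j * var_z ^ k)"
  define w where "w = (\<lambda>(s, e). l ^ s * mon e)"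
  have finE: "finite E" by (simp add: E_def)
  define Sp where "Sp = (\<lambda>D. {p. \<exists>a. p - (\<Sum>x\<in>{..D} \<times> E. scalar3 (a x) * w x) \<in> J})"
  have Sp_add: "p + q \<in> Sp D" if p: "p \<in> Sp D" and q: "q \<in> Sp D" for p q D
  proof -
    obtain a b where "p - (\<Sum>x\<in>{..D} \<times> E. scalar3 (a x) * w x) \<in> J"
      "q - (\<Sum>x\<in>{..D} \<times> E. scalar3 (b x) * w x) \<in> J" using p q by (auto simp: Sp_def)
    then have "(p - (\<Sum>x\<in>{..D} \<times> E. scalar3 (a x) * w x)) + (q - (\<Sum>x\<in>{..D} \<times> E. scalar3 (b x) * w x)) \<in> J"
      by (rule is_idealD(2) [OF J])
    moreover have "(p - (\<Sum>x\<in>{..D} \<times> E. scalar3 (a x) * w x)) + (q - (\<Sum>x\<in>{..D} \<times> E. scalar3 (b x) * w x))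
      = p + q - (\<Sum>x\<in>{..D} \<times> E. scalar3 (a x + b x) * w x)"
      by (simp add: scalar3_add distrib_right sum.distrib algebra_simps)
    ultimately show ?thesis unfolding Sp_def by (intro CollectI exI [of _ "\<lambda>x. a x + b x"]) simp
  qed
  have Sp_0: "p \<in> Sp D" if "p \<in> J" for p D
    unfolding Sp_def by (rule CollectI, rule exI [of _ "\<lambda>_. 0"]) (use that in simp)
  have Sp_sum: "sum f A \<in> Sp D" if "\<And>i. i \<in> A \<Longrightarrow> f i \<in> Sp D" for f :: "'i \<Rightarrow> 'k poly3" and A D
    using that by (induction A rule: infinite_finite_induct) (auto simp: Sp_add Sp_0 is_idealD(1) [OF J])
  have Sp_w: "scalar3 c * w (s, e) \<in> Sp D" if "s \<le> D" "e \<in> E" for c s e D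
  proof -
    have "(\<Sum>x\<in>{..D} \<times> E. scalar3 (if x = (s, e) then c else 0) * w x)
      = (\<Sum>x\<in>{..D} \<times> E. if x = (s, e) then scalar3 c * w (s, e) else 0)"
      by (rule sum.cong) auto
    also have "\<dots> = scalar3 c * w (s, e)" using that finE by (simp add: finite_cartesian_product)
    finally show ?thesis unfolding Sp_def
      by (intro CollectI exI [of _ "\<lambda>x. if x = (s, e) then c else 0"]) (simp add: is_idealD(1) [OF J])
  qed
  have Sp_decomp: "q \<in> Sp D" if "p \<in> Sp D" "q - p \<in> J" for p q D
    using Sp_add [OF that(1) Sp_0 [OF that(2)]] by simp
  have Sp_l: "l * p \<in> Sp (Suc D)" if p: "p \<in> Sp D" for p D
  proof -
    obtain a where "p - (\<Sum>x\<in>{..D} \<times> E. scalar3 (a x) * w x) \<in> J" using p by (auto simp: Sp_def)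
    then have "l * (p - (\<Sum>x\<in>{..D} \<times> E. scalar3 (a x) * w x)) \<in> J" by (rule is_idealD(3) [OF J])
    moreover have "l * (p - (\<Sum>x\<in>{..D} \<times> E. scalar3 (a x) * w x))
      = l * p - (\<Sum>(s, e)\<in>{..D} \<times> E. scalar3 (a (s, e)) * w (Suc s, e))"
      by (simp add: right_diff_distrib sum_distrib_left w_def case_prod_unfold mult_ac)
    moreover have "(\<Sum>(s, e)\<in>{..D} \<times> E. scalar3 (a (s, e)) * w (Suc s, e)) \<in> Sp (Suc D)"
      by (rule Sp_sum) (auto intro!: Sp_w)
    ultimately show ?thesis using Sp_decomp by auto
  qed
  have hom: "p \<in> Sp D" if "homogeneous3 t p" "t \<le> D" for t p D
    using that
  proof (induction t arbitrary: p D)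
    case 0
    have "exponents 0 \<subseteq> E" by (auto simp: E_def)
    then show ?case
      by (subst homogeneous3_eq_sum [OF 0(1)])
        (auto intro!: Sp_sum simp: mult.assoc dest!: Sp_w [of 0 D, rotated, of _ "poly3_coeff p _ _ _"] simp: w_def mon_def)
  next
    case (Suc t)
    show ?case
    proof (cases "t \<ge> T")
      case True
      \<comment> \<open>Above degree \<open>T\<close> a form is congruent to \<open>l\<close> times
        a form of one degree less, and the bound on the exponent of \<open>l\<close> grows along
        with \<open>D\<close>.\<close>
      then obtain q where q: "homogeneous3 t q" "p - l * q \<in> J" using T Suc.prems by blast
      obtain D' where "D = Suc D'" "t \<le> D'" using Suc.prems by (metis Suc_le_D Suc_le_mono)
      then show ?thesis using Sp_l [OF Suc.IH [OF q(1)]] q(2) Sp_decomp by blast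
    next
      case False
      then have "exponents (Suc t) \<subseteq> E" unfolding E_def by (intro UN_upper) simp
      then show ?thesis
        by (subst homogeneous3_eq_sum [OF Suc.prems(1)])
          (auto intro!: Sp_sum simp: mult.assoc dest!: Sp_w [of 0 D, rotated, of _ "poly3_coeff p _ _ _"] simp: w_def mon_def)
    qed
  qed
  have "p \<in> Sp D" if "tdeg_le D p" for D p
    by (subst tdeg_le_eq_sum [OF that], rule Sp_sum, rule hom [OF homogeneous3_comp]) simp
  then show ?thesis using finE unfolding Sp_def by blast
qed

text \<open>The \<open>(n + 1) ^ 2\<close> products \<open>b ^ j * a ^ i\<close> have degree linear
  in \<open>n\<close>, hence lie modulo \<open>J\<close> in a space of dimension linear in
  \<open>n\<close>. For large \<open>n\<close> there is a linear relation.\<close>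

lemma algebraic_dependence:
  "\<exists>u n. (\<exists>i\<le>n. u i \<noteq> 0) \<and> (\<Sum>i\<le>n. eval_at b (u i) * a ^ i) \<in> J"
proof -
  obtain E and w :: "nat \<times> nat \<times> nat \<times> nat \<Rightarrow> 'k poly3" where E: "finite E"
    "\<And>D p. tdeg_le D p \<Longrightarrow> \<exists>m. p - (\<Sum>x\<in>{..D} \<times> E. scalar3 (m x) * w x) \<in> J"
    using exists_linear_spanning by blast
  obtain Da Db where "tdeg_le Da a" "tdeg_le Db b" using exists_tdeg_le by metis
  define s where "s = max Da Db"
  have s: "tdeg_le s a" "tdeg_le s b"
    using \<open>tdeg_le Da a\<close> \<open>tdeg_le Db b\<close> tdeg_le_mono unfolding s_def by (metis max.cobounded1, metis max.cobounded2)
  define e where "e = card E"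
  \<comment> \<open>With \<open>s\<close> bounding both degrees the spanning family has
    \<open>(2 * n * s + 1) * e\<close> members; this \<open>n\<close> makes that smaller than
    \<open>(n + 1) ^ 2\<close>.\<close>
  define n where "n = e * (2 * s + 1)"
  define D where "D = n * s + n * s"
  let ?N = "{..n} \<times> {..n}"
  have "tdeg_le D (b ^ j * a ^ i)" if "i \<le> n" "j \<le> n" for i j
  proof (rule tdeg_le_mono [OF tdeg_le_mult [OF tdeg_le_power [OF s(2)] tdeg_le_power [OF s(1)]]])
    show "j * s + i * s \<le> D" unfolding D_def using that by (intro add_mono mult_le_mono1)
  qed
  then have "\<forall>x\<in>?N. \<exists>m. b ^ snd x * a ^ fst x - (\<Sum>y\<in>{..D} \<times> E. scalar3 (m y) * w y) \<in> J"
    using E(2) by auto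
  from bchoice [OF this] obtain m where m: "\<And>x. x \<in> ?N \<Longrightarrow> b ^ snd x * a ^ fst x - (\<Sum>y\<in>{..D} \<times> E. scalar3 (m x y) * w y) \<in> J"
    by blast
  have "card ({..D} \<times> E) < card ?N"
  proof -
    have "card ({..D} \<times> E) = (2 * n * s + 1) * e" by (simp add: card_cartesian_product D_def e_def algebra_simps)
    also have "\<dots> \<le> n * n + e" unfolding n_def by (simp add: algebra_simps)
    also have "\<dots> \<le> n * n + n" by (simp add: n_def)
    also have "\<dots> < (n + 1) * (n + 1)" by (simp add: algebra_simps)
    finally have "card ({..D} \<times> E) < (n + 1) * (n + 1)" .
    moreover have "card ?N = (n + 1) * (n + 1)" by (simp add: card_cartesian_product algebra_simps)
    ultimately show ?thesis by metis
  qed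
  then obtain c where c: "\<exists>x\<in>?N. c x \<noteq> 0" "\<And>y. y \<in> {..D} \<times> E \<Longrightarrow> (\<Sum>x\<in>?N. c x * m x y) = 0"
    using underdetermined_system [of "{..D} \<times> E" ?N m] E(1) by (auto simp: finite_cartesian_product)
  have "(\<Sum>x\<in>?N. scalar3 (c x) * (b ^ snd x * a ^ fst x - (\<Sum>y\<in>{..D} \<times> E. scalar3 (m x y) * w y))) \<in> J"
    by (intro is_ideal_sum J is_idealD(3) [OF J] m)
  moreover have "(\<Sum>x\<in>?N. scalar3 (c x) * (b ^ snd x * a ^ fst x - (\<Sum>y\<in>{..D} \<times> E. scalar3 (m x y) * w y)))
    = (\<Sum>x\<in>?N. scalar3 (c x) * (b ^ snd x * a ^ fst x))"
  proof -
    have "(\<Sum>x\<in>?N. scalar3 (c x) * (\<Sum>y\<in>{..D} \<times> E. scalar3 (m x y) * w y))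
      = (\<Sum>y\<in>{..D} \<times> E. \<Sum>x\<in>?N. scalar3 (c x) * (scalar3 (m x y) * w y))"
      unfolding sum_distrib_left by (rule sum.swap)
    also have "\<dots> = (\<Sum>y\<in>{..D} \<times> E. scalar3 (\<Sum>x\<in>?N. c x * m x y) * w y)"
      by (simp add: is_ring_hom_sum [OF is_ring_hom_scalar3] scalar3_mult sum_distrib_right mult.assoc)
    also have "\<dots> = 0" 
    proof (intro sum.neutral ballI)
      fix y assume "y \<in> {..D} \<times> E"
      from c(2) [OF this] show "scalar3 (\<Sum>x\<in>?N. c x * m x y) * w y = 0"
        by (simp only: scalar3_simps mult_zero_left)
    qed
    finally show ?thesis by (simp add: right_diff_distrib sum_subtractf)
  qed
  ultimately have mem: "(\<Sum>x\<in>?N. scalar3 (c x) * (b ^ snd x * a ^ fst x)) \<in> J" by simp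
  \<comment> \<open>The relation is sorted by powers of \<open>a\<close>, with polynomials in
    \<open>b\<close> as coefficients.\<close>
  define u where "u i = (\<Sum>j\<le>n. monom (c (i, j)) j)" for i
  have "eval_at b (monom x j) = scalar3 x * b ^ j" for x j
    by (simp add: map_poly_monom poly_monom)
  then have "eval_at b (u i) * a ^ i = (\<Sum>j\<le>n. scalar3 (c (i, j)) * (b ^ j * a ^ i))" for i
    by (simp add: u_def is_ring_hom_sum [OF is_ring_hom_eval_at] sum_distrib_right mult.assoc)
  then have "(\<Sum>i\<le>n. eval_at b (u i) * a ^ i) = (\<Sum>x\<in>?N. scalar3 (c x) * (b ^ snd x * a ^ fst x))"
    by (simp add: sum.cartesian_product case_prod_unfold)
  moreover have "\<exists>i\<le>n. u i \<noteq> 0"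
  proof -
    obtain i j where ij: "i \<le> n" "j \<le> n" "c (i, j) \<noteq> 0" using c(1) by auto
    then have "coeff (u i) j = c (i, j)" by (simp add: u_def coeff_sum)
    then have "u i \<noteq> 0" using ij by auto
    then show ?thesis using ij by blast
  qed
  ultimately show ?thesis using mem by (intro exI [of _ u] exI [of _ n]) simp
qed

text \<open>Cancelling powers of \<open>a\<close> in an algebraic relation between \<open>a\<close> and \<open>b\<close>.\<close>

lemma exists_eval_at_mod_regular:
  assumes K: "is_ideal K" "J \<subseteq> K" and reg: "\<And>x. a * x \<in> K \<Longrightarrow> x \<in> K"
  shows "\<exists>u x. u \<noteq> 0 \<and> eval_at b u - a * x \<in> K"
proof -
  obtain u n where u: "\<exists>i\<le>n. u i \<noteq> 0" "(\<Sum>i\<le>n. eval_at b (u i) * a ^ i) \<in> K"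
    using algebraic_dependence K(2) by blast
  from u show ?thesis
  proof (induction n arbitrary: u)
    case 0
    then show ?case by (intro exI [of _ "u 0"] exI [of _ 0]) simp
  next
    case (Suc n)
    have eq: "(\<Sum>i\<le>Suc n. eval_at b (u i) * a ^ i) = eval_at b (u 0) + a * (\<Sum>i\<le>n. eval_at b (u (Suc i)) * a ^ i)"
      by (subst sum.atMost_Suc_shift) (simp add: sum_distrib_left mult_ac)
    show ?case
    proof (cases "u 0 = 0")
      case True
      then have "a * (\<Sum>i\<le>n. eval_at b (u (Suc i)) * a ^ i) \<in> K" using Suc.prems(2) unfolding eq by simp
      then have "(\<Sum>i\<le>n. eval_at b (u (Suc i)) * a ^ i) \<in> K" by (rule reg)
      moreover obtain i where "i \<le> Suc n" "u i \<noteq> 0" using Suc.prems(1) by blast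
      then obtain i' where "i' \<le> n" "u (Suc i') \<noteq> 0" using True by (cases i) auto
      ultimately show ?thesis using Suc.IH [of "\<lambda>i. u (Suc i)"] by blast
    next
      case False
      then show ?thesis using Suc.prems(2) unfolding eq
        by (intro exI [of _ "u 0"] exI [of _ "- (\<Sum>i\<le>n. eval_at b (u (Suc i)) * a ^ i)"]) simp
    qed
  qed
qed

text \<open>An element \<open>a\<close> of \<open>q\<close> outside \<open>p\<close> is regular
  modulo \<open>p\<close>, so some \<open>u(b)\<close> is a multiple of \<open>a\<close> modulo
  \<open>p\<close> and lies in \<open>q\<close>. Thus the quotient by \<open>q\<close> is
  \<open>K\<close> itself.\<close>

lemma prime_chain_constant:
  assumes p: "is_prime_ideal p" "J \<subseteq> p" and q: "is_prime_ideal q" "p \<subset> q"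
  shows "\<exists>c. b - scalar3 c \<in> q"
proof -
  obtain a where a: "a \<in> q" "a \<notin> p" using q by blast
  have Ip: "is_ideal p" and Iq: "is_ideal q" using p q by (auto simp: is_prime_ideal_def)
  have "a * x \<in> p \<Longrightarrow> x \<in> p" for x using p(1) a(2) by (auto simp: is_prime_ideal_def)
  then obtain u x where u: "u \<noteq> 0" "eval_at b u - a * x \<in> p"
    using exists_eval_at_mod_regular [OF Ip p(2), of a b] by blast
  then have "eval_at b u - a * x + a * x \<in> q"
    using q(2) a(1) is_idealD(2,4) [OF Iq] by blast
  then show ?thesis using eval_at_in_prime [OF q(1) u(1)] by simp
qed

text \<open>By \<open>prime_chain_constant\<close> every polynomial is constant modulo
  \<open>q\<close>, so \<open>q\<close> is already maximal.\<close>

lemma no_prime_chain_of_length_two: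
  assumes p: "is_prime_ideal p" "J \<subseteq> p" and q: "is_prime_ideal q" "p \<subset> q" and r: "is_prime_ideal r"
  shows "\<not> q \<subset> r"
proof
  assume "q \<subset> r"
  then obtain b where b: "b \<in> r" "b \<notin> q" by blast
  obtain c where c: "b - scalar3 c \<in> q" using prime_chain_constant [OF p q] by blast
  have Ir: "is_ideal r" "1 \<notin> r" using r by (auto simp: is_prime_ideal_def)
  have "b - (b - scalar3 c) \<in> r" using is_idealD(6) [OF Ir(1) b(1)] c \<open>q \<subset> r\<close> by blast
  then have "c = 0" using is_ideal_scalar Ir by auto
  then show False using c b by simp
qed

text \<open>This bounds the depth: some \<open>u(b)\<close> with \<open>u \<noteq> 0\<close> lies in
  \<open>J + (a)\<close>, and since \<open>b\<close> is regular modulo that ideal, it is a unit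
  there.\<close>

lemma regular_pair_generates:
  assumes a: "\<And>x. a * x \<in> J \<Longrightarrow> x \<in> J"
    and b: "\<And>x y. b * x - a * y \<in> J \<Longrightarrow> \<exists>z. x - a * z \<in> J"
  shows "\<exists>x y. 1 - b * x - a * y \<in> J"
proof -
  let ?L = "{p. \<exists>q. p - a * q \<in> J}"
  have L: "is_ideal ?L" by (rule is_ideal_plus_principal [OF J])
  have "\<exists>u x. u \<noteq> 0 \<and> eval_at b u - a * x \<in> J"
    by (rule exists_eval_at_mod_regular [OF J subset_refl]) (rule a)
  then obtain u x where "u \<noteq> 0" "eval_at b u - a * x \<in> J" by blast
  then have "eval_at b u \<in> ?L" by blast
  moreover have "x \<in> ?L" if "b * x \<in> ?L" for x using that b by blast
  ultimately obtain x where "1 - b * x \<in> ?L" using regular_eval_at_unit [OF L] \<open>u \<noteq> 0\<close> by blast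
  then show ?thesis by blast
qed

section \<open>Homogeneous parts and maximal ideals\<close>

definition homogeneous_part :: "'k poly3 set \<Rightarrow> 'k poly3 set" where
  "homogeneous_part M = {p. \<forall>t. poly3_comp t p \<in> M}"

lemma homogeneous_part_subset:
  assumes "is_ideal M"
  shows "homogeneous_part M \<subseteq> M"
proof
  fix p assume p: "p \<in> homogeneous_part M"
  obtain D where D: "p = (\<Sum>n\<le>D. poly3_comp n p)" using poly3_eq_sum_comp by blast
  show "p \<in> M"
    by (subst D, rule is_ideal_sum [OF assms]) (use p in \<open>simp add: homogeneous_part_def\<close>)
qed

text \<open>For \<open>a\<close> and \<open>b\<close> outside, take their lowest components not in
  \<open>M\<close>. In the sum of the two degrees every other term of the product lies in
  \<open>M\<close>.\<close>

lemma homogeneous_part_prime: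
  assumes M: "is_prime_ideal M"
  shows "is_prime_ideal (homogeneous_part M)"
proof -
  have I: "is_ideal M" "1 \<notin> M" using M by (auto simp: is_prime_ideal_def)
  have "is_ideal (homogeneous_part M)"
  proof (rule is_idealI)
    show "0 \<in> homogeneous_part M" by (simp add: homogeneous_part_def is_idealD(1) [OF I(1)])
    show "a + b \<in> homogeneous_part M" if "a \<in> homogeneous_part M" "b \<in> homogeneous_part M" for a b
      using that is_idealD(2) [OF I(1)] by (simp add: homogeneous_part_def)
    show "r * a \<in> homogeneous_part M" if "a \<in> homogeneous_part M" for r a
      using that by (auto simp: homogeneous_part_def poly3_comp_mult intro!: is_ideal_sum [OF I(1)] is_idealD(3) [OF I(1)])
  qed
  moreover have "1 \<notin> homogeneous_part M" using homogeneous_part_subset [OF I(1)] I(2) by blast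
  moreover have "a \<in> homogeneous_part M \<or> b \<in> homogeneous_part M" if ab: "a * b \<in> homogeneous_part M" for a b
  proof (rule ccontr)
    assume "\<not> ?thesis"
    then have ex: "\<exists>t. poly3_comp t a \<notin> M" "\<exists>t. poly3_comp t b \<notin> M" by (auto simp: homogeneous_part_def)
    define i j where "i = (LEAST t. poly3_comp t a \<notin> M)" and "j = (LEAST t. poly3_comp t b \<notin> M)"
    have ij: "poly3_comp i a \<notin> M" "poly3_comp j b \<notin> M"
      using LeastI_ex [OF ex(1)] LeastI_ex [OF ex(2)] unfolding i_def j_def by blast+
    have less: "t < i \<Longrightarrow> poly3_comp t a \<in> M" "t < j \<Longrightarrow> poly3_comp t b \<in> M" for t
      using not_less_Least unfolding i_def j_def by blast+
    have "poly3_comp (i + j) (a * b) = (\<Sum>s\<in>{..i + j}. poly3_comp s a * poly3_comp (i + j - s) b)"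
      by (rule poly3_comp_mult)
    also have "\<dots> = poly3_comp i a * poly3_comp j b + (\<Sum>s\<in>{..i + j} - {i}. poly3_comp s a * poly3_comp (i + j - s) b)"
      by (subst sum.remove [of _ i]) auto
    finally have eq: "poly3_comp (i + j) (a * b) = \<dots>" .
    have "(\<Sum>s\<in>{..i + j} - {i}. poly3_comp s a * poly3_comp (i + j - s) b) \<in> M"
    proof (rule is_ideal_sum [OF I(1)])
      fix s assume "s \<in> {..i + j} - {i}"
      then have "s < i \<or> i + j - s < j" by auto
      then show "poly3_comp s a * poly3_comp (i + j - s) b \<in> M"
        using less is_idealD(3,4) [OF I(1)] by blast
    qed
    moreover have "poly3_comp (i + j) (a * b) \<in> M" using ab by (simp add: homogeneous_part_def)
    ultimately have "poly3_comp i a * poly3_comp j b \<in> M"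
      using is_ideal_add_cancel(1) [OF I(1)] unfolding eq by blast
    then show False using M ij unfolding is_prime_ideal_def by blast
  qed
  ultimately show ?thesis unfolding is_prime_ideal_def by blast
qed

lemma J_subset_homogeneous_part: "J \<subseteq> M \<Longrightarrow> J \<subseteq> homogeneous_part M"
  using graded by (auto simp: homogeneous_part_def)

text \<open>In degree \<open>t\<close> the product is \<open>l\<close> times the component of
  \<open>p\<close> of degree \<open>t - 1\<close> minus \<open>c\<close> times that of degree
  \<open>t\<close>. For \<open>c \<noteq> 0\<close> the components of \<open>p\<close> thus enter
  \<open>J\<close> one after the other.\<close>

lemma l_minus_scalar_regular:
  assumes "(l - scalar3 c) * p \<in> J"
  shows "p \<in> J"
proof (cases "c = 0")
  case True
  then show ?thesis using assms l_regular by simp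
next
  case False
  have "poly3_comp t p \<in> J" for t
  proof (induction t rule: less_induct)
    case (less t)
    have "(l - scalar3 c) * p = p * l - scalar3 c * p" by (simp add: algebra_simps)
    then have "poly3_comp t (p * l - scalar3 c * p) \<in> J" using graded [OF assms] by metis
    moreover have "poly3_comp t (scalar3 c * p) = scalar3 c * poly3_comp t p"
      using poly3_comp_mult_homogeneous [OF homogeneous3_scalar, of t p c] by (simp add: mult.commute)
    moreover have "poly3_comp t (p * l) \<in> J"
      using poly3_comp_mult_homogeneous [OF l_hom, of t p] less [of "t - 1"] is_idealD(1,4) [OF J] by auto
    ultimately have "scalar3 c * poly3_comp t p \<in> J"
      using is_ideal_add_cancel(4) [OF J] by (metis poly3_comp_simps(3))
    then have "scalar3 (1 / c) * (scalar3 c * poly3_comp t p) \<in> J" by (rule is_idealD(3) [OF J])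
    then show ?case using False by (simp add: mult.assoc [symmetric] scalar3_mult [symmetric])
  qed
  then have "p \<in> homogeneous_part J" by (simp add: homogeneous_part_def)
  then show ?thesis using homogeneous_part_subset [OF J] by blast
qed

text \<open>If \<open>1 = (l - 1) q\<close> modulo \<open>J\<close>, comparing components shows that
  \<open>q\<close> is \<open>- l ^ t\<close> modulo \<open>J\<close> in every degree
  \<open>t\<close>. As \<open>q\<close> is a polynomial, a power of \<open>l\<close> lies in
  \<open>J\<close>, and regularity of \<open>l\<close> brings this down to \<open>1\<close>.\<close>

lemma l_minus_one_proper: "1 \<notin> {p. \<exists>q. p - (l - 1) * q \<in> J}"
proof
  assume "1 \<in> {p. \<exists>q. p - (l - 1) * q \<in> J}"
  then obtain q where q: "1 - (l - 1) * q \<in> J" by blast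
  have eq: "1 - (l - 1) * q = 1 - q * l + q" by (simp add: algebra_simps)
  note one = homogeneous3_one [where 'a = 'k]
  have c: "poly3_comp t (1 - q * l + q) \<in> J" for t using graded [OF q] unfolding eq .
  have "l ^ t + poly3_comp t q \<in> J" for t
  proof (induction t)
    case 0
    then show ?case using c [of 0] poly3_comp_mult_homogeneous [OF l_hom, of 0 q]
      by (simp add: poly3_comp_homogeneous [OF one])
  next
    case (Suc t)
    have "l * (l ^ t + poly3_comp t q) + poly3_comp (Suc t) (1 - q * l + q) \<in> J"
      by (intro is_idealD(2,3) [OF J] Suc c)
    then show ?case using poly3_comp_mult_homogeneous [OF l_hom, of "Suc t" q]
      by (simp add: poly3_comp_homogeneous [OF one] algebra_simps)
  qed
  moreover obtain D where "\<And>n. n > D \<Longrightarrow> poly3_comp n q = 0" using poly3_eq_sum_comp by blast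
  ultimately have "l ^ Suc D \<in> J" by (metis add.right_neutral lessI)
  then have "1 \<in> J"
  proof (induction "Suc D" arbitrary: D)
    case (Suc D)
    then show ?case using l_regular [of "l ^ D"] by (cases D) auto
  qed
  then show False using proper by simp
qed

text \<open>Supplies the lower bounds for depth and height. If \<open>M\<close> is not homogeneous,
  its homogeneous part is the smaller prime and some \<open>l - c\<close> the regular element. If it
  is, then \<open>l\<close> is the regular element and the smaller prime must avoid
  \<open>l\<close>.\<close>

lemma maximal_ideal_structure:
  assumes M: "is_maximal_ideal M" "J \<subseteq> M"
  shows "(\<exists>a\<in>M. \<forall>x. a * x \<in> J \<longrightarrow> x \<in> J) \<and> (\<exists>p. is_prime_ideal p \<and> J \<subseteq> p \<and> p \<subset> M)"
proof -
  have prime: "is_prime_ideal M" by (rule maximal_imp_prime [OF M(1)])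
  then have I: "is_ideal M" "1 \<notin> M" by (auto simp: is_prime_ideal_def)
  show ?thesis
  proof (cases "homogeneous_part M = M")
    case False
    then have ss: "homogeneous_part M \<subset> M" using homogeneous_part_subset [OF I(1)] by blast
    note hp = homogeneous_part_prime [OF prime] J_subset_homogeneous_part [OF M(2)]
    obtain c where "l - scalar3 c \<in> M" using prime_chain_constant [OF hp prime ss] by blast
    then show ?thesis using l_minus_scalar_regular hp ss by blast
  next
    case True
    \<comment> \<open>A proper homogeneous ideal contains no polynomial with nonzero constant term,
      so maximality makes \<open>M\<close> the irrelevant ideal.\<close>
    let ?P = "{p :: 'k poly3. poly3_comp 0 p = 0}"
    note one = homogeneous3_one [where 'a = 'k]
    have const: "poly3_comp 0 p = 0" if "p \<in> homogeneous_part N" "is_ideal N" "1 \<notin> N" for p N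
    proof -
      have "poly3_comp 0 p = scalar3 (poly3_coeff (poly3_comp 0 p) 0 0 0)"
        by (rule homogeneous3_0_eq) simp
      moreover have "poly3_comp 0 p \<in> N" using that by (simp add: homogeneous_part_def)
      ultimately show ?thesis using is_ideal_scalar that by (metis scalar3_simps(1))
    qed
    have "is_ideal ?P" by (rule is_idealI) (auto simp: poly3_comp_mult)
    moreover have "M \<subseteq> ?P" using const I True by blast
    moreover have "1 \<notin> ?P" using poly3_comp_homogeneous [OF one, of 0] by simp
    ultimately have MP: "M = ?P" using M(1) unfolding is_maximal_ideal_def by blast
    have l_mem: "l \<in> M" unfolding MP using poly3_comp_homogeneous [OF l_hom, of 0] by simp
    \<comment> \<open>A maximal ideal over \<open>J + (l - 1)\<close> misses \<open>l\<close>, and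
      so does its homogeneous part, which therefore differs from \<open>M\<close>.\<close>
    obtain N where N: "is_maximal_ideal N" "{p. \<exists>q. p - (l - 1) * q \<in> J} \<subseteq> N"
      using exists_maximal_ideal [OF is_ideal_plus_principal [OF J] l_minus_one_proper] by blast
    have primeN: "is_prime_ideal N" by (rule maximal_imp_prime [OF N(1)])
    then have IN: "is_ideal N" "1 \<notin> N" by (auto simp: is_prime_ideal_def)
    have JN: "J \<subseteq> N"
    proof
      fix x assume "x \<in> J"
      then have "x - (l - 1) * 0 \<in> J" by simp
      then show "x \<in> N" using N(2) by blast
    qed
    have "(l - 1) - (l - 1) * 1 \<in> J" using is_idealD(1) [OF J] by simp
    then have "l - 1 \<in> N" using N(2) by blast
    then have "l \<notin> N" using is_idealD(6) [OF IN(1), of l "l - 1"] IN(2) by auto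
    then have "homogeneous_part N \<noteq> M" using l_mem homogeneous_part_subset [OF IN(1)] by blast
    moreover have "homogeneous_part N \<subseteq> M" unfolding MP using const IN by blast
    ultimately have "homogeneous_part N \<subset> M" by blast
    then show ?thesis
      using l_mem l_regular homogeneous_part_prime [OF primeN] J_subset_homogeneous_part [OF JN] by blast
  qed
qed

end

section \<open>Cohen--Macaulayness of the quotient\<close>

lemma (in ring) genideal_empty: "Idl {} = {\<zero>}"
proof
  show "Idl {} \<subseteq> {\<zero>}" by (rule genideal_minimal [OF zeroideal]) simp
  show "{\<zero>} \<subseteq> Idl {}"
    using additive_subgroup.zero_closed [OF ideal.axioms(1) [OF genideal_ideal [of "{}"]]] by simp
qed

text \<open>A ring record identified with \<open>'r / J\<close> by a surjection from a type. Ideals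
  are transported along \<open>\<psi>\<close>, so that the algebra can be done in the type
  class.\<close>

locale cring_quotient = cring G
  for G :: "('a, 'm) ring_scheme" (structure) and \<psi> :: "'r::comm_ring_1 \<Rightarrow> 'a" and J :: "'r set" +
  assumes J: "is_ideal J"
    and \<psi>_add: "\<psi> (p + q) = \<psi> p \<oplus> \<psi> q" and \<psi>_mult: "\<psi> (p * q) = \<psi> p \<otimes> \<psi> q"
    and \<psi>_one: "\<psi> 1 = \<one>" and \<psi>_surj: "range \<psi> = carrier G" and \<psi>_ker: "\<psi> p = \<zero> \<longleftrightarrow> p \<in> J"
begin

lemma \<psi>_closed [simp]: "\<psi> p \<in> carrier G"
  using \<psi>_surj by blast

lemma \<psi>_zero: "\<psi> 0 = \<zero>"
  using \<psi>_ker is_idealD(1) [OF J] by blast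

lemma \<psi>_minus: "\<psi> (- p) = \<ominus> \<psi> p"
proof -
  have "\<psi> (- p) \<oplus> \<psi> p = \<zero>" using \<psi>_add [of "- p" p] \<psi>_zero by simp
  then show ?thesis using minus_equality by simp
qed

lemma \<psi>_diff: "\<psi> (p - q) = \<psi> p \<ominus> \<psi> q"
  using \<psi>_add [of p "- q"] by (simp add: \<psi>_minus a_minus_def)

lemma \<psi>_eq_iff: "\<psi> p = \<psi> q \<longleftrightarrow> p - q \<in> J"
  using \<psi>_ker [of "p - q"] by (simp add: \<psi>_diff)

lemma \<psi>_cases: "a \<in> carrier G \<Longrightarrow> \<exists>p. a = \<psi> p"
  using \<psi>_surj by blast

lemma ideal_vimage:
  assumes "ideal P G"
  shows "is_ideal (\<psi> -` P)" "J \<subseteq> \<psi> -` P"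
proof -
  interpret P: ideal P G by fact
  show "is_ideal (\<psi> -` P)"
    by (rule is_idealI) (auto simp: \<psi>_add \<psi>_mult \<psi>_zero P.I_l_closed)
  show "J \<subseteq> \<psi> -` P"
    using \<psi>_ker additive_subgroup.zero_closed [OF ideal.axioms(1) [OF assms]] by (metis subsetI vimageI)
qed

lemma ideal_image:
  assumes K: "is_ideal K"
  shows "ideal (\<psi> ` K) G"
proof (rule idealI)
  show "ring G" by (rule ring_axioms)
  show "subgroup (\<psi> ` K) (add_monoid G)"
  proof (rule add.subgroupI)
    show "\<psi> ` K \<subseteq> carrier G" by auto
    show "\<psi> ` K \<noteq> {}" using is_idealD(1) [OF K] by blast
    show "\<ominus> a \<in> \<psi> ` K" if "a \<in> \<psi> ` K" for a
      using that is_idealD(5) [OF K] by (auto simp: \<psi>_minus [symmetric])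
    show "a \<oplus> b \<in> \<psi> ` K" if "a \<in> \<psi> ` K" "b \<in> \<psi> ` K" for a b
      using that is_idealD(2) [OF K] by (auto simp: \<psi>_add [symmetric])
  qed
  fix a x assume ax: "a \<in> \<psi> ` K" "x \<in> carrier G"
  then obtain p q where pq: "a = \<psi> p" "p \<in> K" "x = \<psi> q" using \<psi>_cases by blast
  then show "x \<otimes> a \<in> \<psi> ` K" using is_idealD(3) [OF K pq(2), of q] by (auto simp: \<psi>_mult [symmetric])
  show "a \<otimes> x \<in> \<psi> ` K" using is_idealD(4) [OF K pq(2), of q] pq by (auto simp: \<psi>_mult [symmetric])
qed

lemma image_mem_iff: "is_ideal K \<Longrightarrow> J \<subseteq> K \<Longrightarrow> \<psi> p \<in> \<psi> ` K \<longleftrightarrow> p \<in> K"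
proof
  assume K: "is_ideal K" "J \<subseteq> K" and "\<psi> p \<in> \<psi> ` K"
  then obtain q where q: "q \<in> K" "p - q \<in> J" by (auto simp: \<psi>_eq_iff)
  then have "(p - q) + q \<in> K" using K is_idealD(2) by blast
  then show "p \<in> K" by simp
qed simp

lemma primeideal_vimage:
  assumes "primeideal P G"
  shows "is_prime_ideal (\<psi> -` P)"
proof -
  interpret P: primeideal P G by fact
  have "1 \<notin> \<psi> -` P" using P.one_imp_carrier P.I_notcarr by (auto simp: \<psi>_one)
  moreover have "a \<in> \<psi> -` P \<or> b \<in> \<psi> -` P" if "a * b \<in> \<psi> -` P" for a b
    using P.I_prime [of "\<psi> a" "\<psi> b"] that by (simp add: \<psi>_mult)
  ultimately show ?thesis
    using ideal_vimage [OF P.is_ideal] by (auto simp: is_prime_ideal_def)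
qed

lemma primeideal_image:
  assumes p: "is_prime_ideal p" "J \<subseteq> p"
  shows "primeideal (\<psi> ` p) G"
proof (rule primeidealI)
  have I: "is_ideal p" "1 \<notin> p" using p by (auto simp: is_prime_ideal_def)
  show "ideal (\<psi> ` p) G" by (rule ideal_image [OF I(1)])
  show "cring G" by (rule is_cring)
  have "\<psi> 1 \<notin> \<psi> ` p" using image_mem_iff [OF I(1) p(2)] I(2) by blast
  then show "carrier G \<noteq> \<psi> ` p" using \<psi>_closed by blast
  fix a b assume ab: "a \<in> carrier G" "b \<in> carrier G" "a \<otimes> b \<in> \<psi> ` p"
  then obtain x y where xy: "a = \<psi> x" "b = \<psi> y" using \<psi>_cases by blast
  then have "x * y \<in> p" using ab(3) image_mem_iff [OF I(1) p(2), of "x * y"] by (simp add: \<psi>_mult)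
  then show "a \<in> \<psi> ` p \<or> b \<in> \<psi> ` p" using p(1) xy by (auto simp: is_prime_ideal_def)
qed

lemma maximalideal_vimage:
  assumes "maximalideal P G"
  shows "is_maximal_ideal (\<psi> -` P)"
proof -
  interpret P: maximalideal P G by fact
  have "1 \<notin> \<psi> -` P" using P.one_imp_carrier P.I_notcarr by (auto simp: \<psi>_one)
  moreover have "K = \<psi> -` P" if K: "is_ideal K" "\<psi> -` P \<subseteq> K" "1 \<notin> K" for K
  proof -
    have JK: "J \<subseteq> K" using ideal_vimage(2) [OF P.is_ideal] K(2) by blast
    have "P \<subseteq> \<psi> ` K"
    proof
      fix a assume a: "a \<in> P"
      then obtain p where "a = \<psi> p" using \<psi>_cases P.a_subset by blast
      then show "a \<in> \<psi> ` K" using a K(2) by auto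
    qed
    moreover have "\<psi> ` K \<subseteq> carrier G" by auto
    ultimately have "\<psi> ` K = P \<or> \<psi> ` K = carrier G"
      using P.I_maximal [OF ideal_image [OF K(1)]] by blast
    moreover have "\<psi> 1 \<notin> \<psi> ` K" using image_mem_iff [OF K(1) JK] K(3) by blast
    ultimately have "\<psi> ` K = P" using \<psi>_closed by blast
    then show ?thesis using K(2) by auto
  qed
  ultimately show ?thesis
    using ideal_vimage [OF P.is_ideal] by (auto simp: is_maximal_ideal_def)
qed

end

locale poly3_quotient = graded_parameter J l + cring_quotient G \<psi> J
  for J :: "'k::alg_closed_field poly3 set" and l and G :: "('a, 'm) ring_scheme" (structure) and \<psi>
begin

lemma noetherian_quotient: "noetherian_ring G"
proof (rule noetherian_ringI)
  fix P assume P: "ideal P G"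
  interpret P: ideal P G by fact
  obtain S where S: "finite S" "S \<subseteq> \<psi> -` P" "\<And>K. is_ideal K \<Longrightarrow> S \<subseteq> K \<Longrightarrow> \<psi> -` P \<subseteq> K"
    using fin_gen_idealE [OF fin_gen_ideal_poly3 [OF ideal_vimage(1) [OF P]]] by metis
  have sub: "\<psi> ` S \<subseteq> carrier G" by auto
  have "\<psi> -` P \<subseteq> \<psi> -` (Idl (\<psi> ` S))"
    using ideal_vimage(1) [OF genideal_ideal [OF sub]] genideal_self [OF sub] by (intro S(3)) auto
  have "P \<subseteq> Idl (\<psi> ` S)"
  proof
    fix c assume c: "c \<in> P"
    then obtain p where "c = \<psi> p" using \<psi>_cases [OF P.Icarr] by blast
    then show "c \<in> Idl (\<psi> ` S)" using c \<open>\<psi> -` P \<subseteq> \<psi> -` (Idl (\<psi> ` S))\<close> by auto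
  qed
  moreover have "Idl (\<psi> ` S) \<subseteq> P" using S(2) by (intro genideal_minimal [OF P]) auto
  ultimately show "\<exists>A\<subseteq>carrier G. finite A \<and> P = Idl A"
    using S(1) sub by (intro exI [of _ "\<psi> ` S"]) auto
qed

text \<open>The first two elements would generate the unit ideal by
  \<open>regular_pair_generates\<close>, against the last clause of
  \<open>regular_sequence\<close>.\<close>

lemma regular_sequence_length_le_1:
  assumes "regular_sequence G xs"
  shows "length xs \<le> 1"
proof (rule ccontr)
  assume long: "\<not> length xs \<le> 1"
  then have "\<exists>a b ys. xs = a # b # ys"
  proof (cases xs)
    case (Cons a zs)
    then show ?thesis using long by (cases zs) (simp_all add: One_nat_def)
  qed simp
  then obtain a b ys where xs: "xs = a # b # ys" by blast
  have carr: "a \<in> carrier G" "b \<in> carrier G" "set xs \<subseteq> carrier G"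
    and reg: "\<And>i c. i < length xs \<Longrightarrow> c \<in> carrier G \<Longrightarrow> xs ! i \<otimes> c \<in> Idl (set (take i xs)) \<Longrightarrow> c \<in> Idl (set (take i xs))"
    and ne: "Idl (set xs) \<noteq> carrier G"
    using assms unfolding regular_sequence_def xs by auto
  obtain a' b' where ab: "a = \<psi> a'" "b = \<psi> b'" using carr \<psi>_cases by blast
  have PIdl: "c \<in> Idl {a} \<longleftrightarrow> (\<exists>q. c = \<psi> (a' * q))" for c
    unfolding cgenideal_eq_genideal [OF carr(1), symmetric] cgenideal_def
    using \<psi>_cases \<psi>_closed by (auto simp: ab \<psi>_mult m_comm)
  have reg0: "x \<in> J" if "a' * x \<in> J" for x
    using reg [of 0 "\<psi> x"] that by (simp add: xs genideal_empty ab \<psi>_mult [symmetric] \<psi>_ker)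
  have reg1: "\<exists>z. x - a' * z \<in> J" if "b' * x - a' * y \<in> J" for x y
  proof -
    have "b \<otimes> \<psi> x = \<psi> (a' * y)" using that by (simp add: ab \<psi>_mult [symmetric] \<psi>_eq_iff)
    then have "b \<otimes> \<psi> x \<in> Idl {a}" unfolding PIdl by blast
    then have "\<psi> x \<in> Idl {a}" using reg [of "Suc 0" "\<psi> x"] by (simp add: xs)
    then obtain z where "\<psi> x = \<psi> (a' * z)" unfolding PIdl by blast
    then show ?thesis by (auto simp: \<psi>_eq_iff)
  qed
  have "\<exists>x y. 1 - b' * x - a' * y \<in> J"
    by (rule regular_pair_generates) (fact reg0, fact reg1)
  then obtain x y where "1 - b' * x - a' * y \<in> J" by blast
  then have "1 - (b' * x + a' * y) \<in> J" by (simp add: algebra_simps)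
  then have one_eq: "\<one> = b \<otimes> \<psi> x \<oplus> a \<otimes> \<psi> y" using \<psi>_eq_iff [of 1 "b' * x + a' * y"] by (simp add: \<psi>_one \<psi>_add \<psi>_mult ab)
  interpret I: ideal "Idl (set xs)" G by (rule genideal_ideal [OF carr(3)])
  have "a \<in> Idl (set xs)" "b \<in> Idl (set xs)" using genideal_self [OF carr(3)] by (auto simp: xs)
  then have "b \<otimes> \<psi> x \<oplus> a \<otimes> \<psi> y \<in> Idl (set xs)" by (intro I.a_closed I.I_r_closed) auto
  then have "\<one> \<in> Idl (set xs)" by (simp only: one_eq)
  then show False using I.one_imp_carrier ne by blast
qed

theorem cohen_macaulay_quotient: "cohen_macaulay_ring G"
  unfolding cohen_macaulay_ring_def
proof (intro conjI allI impI)
  show "cring G" by (rule is_cring)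
  show "noetherian_ring G" by (rule noetherian_quotient)
  fix P assume P: "maximalideal P G"
  interpret P: maximalideal P G by fact
  let ?M = "\<psi> -` P"
  have M: "is_maximal_ideal ?M" by (rule maximalideal_vimage [OF P])
  have JM: "J \<subseteq> ?M" by (rule ideal_vimage(2) [OF P.is_ideal])
  obtain a p where a: "a \<in> ?M" "\<And>x. a * x \<in> J \<Longrightarrow> x \<in> J"
    and p: "is_prime_ideal p" "J \<subseteq> p" "p \<subset> ?M"
    using maximal_ideal_structure [OF M JM] by blast
  have "ideal_depth G P = 1"
    unfolding ideal_depth_def
  proof (rule antisym)
    show "Sup {enat (length xs) |xs. regular_sequence G xs \<and> set xs \<subseteq> P} \<le> 1"
      using regular_sequence_length_le_1 by (intro Sup_least) (auto simp: one_enat_def)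
    have "regular_sequence G [\<psi> a]"
    proof -
      have "c \<in> Idl {}" if c: "c \<in> carrier G" "\<psi> a \<otimes> c \<in> Idl {}" for c
      proof -
        obtain x where x: "c = \<psi> x" using \<psi>_cases c by blast
        then have "a * x \<in> J" using c(2) by (simp add: genideal_empty \<psi>_mult [symmetric] \<psi>_ker)
        then show ?thesis using a(2) by (simp add: genideal_empty x \<psi>_ker)
      qed
      moreover have "Idl {\<psi> a} \<noteq> carrier G"
      proof
        assume "Idl {\<psi> a} = carrier G"
        moreover have "Idl {\<psi> a} \<subseteq> P" using a(1) by (intro genideal_minimal [OF P.is_ideal]) auto
        ultimately show False using P.a_subset P.I_notcarr by blast
      qed
      ultimately show ?thesis by (simp add: regular_sequence_def)
    qed
    then have "enat (length [\<psi> a]) \<in> {enat (length xs) |xs. regular_sequence G xs \<and> set xs \<subseteq> P}"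
      using a(1) by (intro CollectI exI [of _ "[\<psi> a]"]) auto
    then show "1 \<le> Sup {enat (length xs) |xs. regular_sequence G xs \<and> set xs \<subseteq> P}"
      by (intro Sup_upper) (simp add: one_enat_def One_nat_def)
  qed
  moreover have "prime_height G P = 1"
    unfolding prime_height_def
  proof (rule antisym)
    let ?S = "{enat n |n. \<exists>p. (\<forall>i\<le>n. primeideal (p i) G) \<and> (\<forall>i<n. p i \<subset> p (Suc i)) \<and> p n = P}"
    show "Sup ?S \<le> 1"
    proof (rule Sup_least)
      fix s assume "s \<in> ?S"
      then obtain n q where s: "s = enat n" and q: "\<And>i. i \<le> n \<Longrightarrow> primeideal (q i) G" "\<And>i. i < n \<Longrightarrow> q i \<subset> q (Suc i)"
        by blast
      have "n \<le> 1"
      proof (rule ccontr)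
        assume "\<not> n \<le> 1"
        then have n: "0 \<le> n" "Suc 0 \<le> n" "Suc (Suc 0) \<le> n" by auto
        \<comment> \<open>Strict inclusions survive the pullback because \<open>\<psi>\<close> is
          surjective.\<close>
        have sub: "\<psi> -` (q i) \<subset> \<psi> -` (q (Suc i))" if i: "i < n" for i
        proof -
          have "q (Suc i) \<subseteq> carrier G"
            using q(1) [of "Suc i"] i ideal.Icarr primeideal.axioms(1) by fastforce
          then obtain x where "\<psi> x \<in> q (Suc i)" "\<psi> x \<notin> q i" using q(2) [OF i] \<psi>_cases by blast
          then show ?thesis using q(2) [OF i] by blast
        qed
        have "\<not> \<psi> -` (q (Suc 0)) \<subset> \<psi> -` (q (Suc (Suc 0)))"
        proof (rule no_prime_chain_of_length_two)
          show "J \<subseteq> \<psi> -` (q 0)" using q(1) [OF n(1)] by (intro ideal_vimage(2)) (rule primeideal.axioms(1))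
        qed (use n q(1) sub in \<open>auto intro!: primeideal_vimage\<close>)
        then show False using sub [of "Suc 0"] n by simp
      qed
      then show "s \<le> 1" by (simp add: s one_enat_def)
    qed
    have "primeideal P G" by (rule maximalideal_prime [OF P])
    moreover have "\<psi> ` p \<subset> P"
    proof -
      have Ip: "is_ideal p" using p by (simp add: is_prime_ideal_def)
      obtain x where "x \<in> ?M" "x \<notin> p" using p(3) by blast
      then have "\<psi> x \<in> P" "\<psi> x \<notin> \<psi> ` p" using image_mem_iff [OF Ip p(2)] by auto
      then show ?thesis using p(3) by blast
    qed
    ultimately have "enat 1 \<in> ?S"
      using primeideal_image [OF p(1,2)]
      by (intro CollectI exI [of _ 1] conjI exI [of _ "\<lambda>i. if i = 0 then \<psi> ` p else P"]) auto
    then show "1 \<le> Sup ?S" by (intro Sup_upper) (simp add: one_enat_def)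
  qed
  ultimately show "ideal_depth G P = prime_height G P" by simp
qed

end

section \<open>Passing between type classes and ring records\<close>

lemma type_ring_simps [simp]:
  "carrier ring_of_type_algebra = UNIV"
  "monoid.mult ring_of_type_algebra = (*)" "monoid.one ring_of_type_algebra = 1"
  "ring.zero ring_of_type_algebra = 0" "ring.add ring_of_type_algebra = (+)"
  by (simp_all add: ring_of_type_algebra_def fun_eq_iff)

text \<open>The base case from which quotients are built: a type is its own quotient by
  zero.\<close>

lemma cring_quotient_self: "cring_quotient (ring_of_type_algebra :: 'r::comm_ring_1 ring) (\<lambda>x. x) {0}"
proof -
  interpret cring "ring_of_type_algebra :: 'r ring" by (rule cring_from_type_algebra)
  show ?thesis by unfold_locales (auto simp: is_ideal_def)
qed

text \<open>The surjection is composed with the residue map. Iterating this gives first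
  \<open>A\<close> and then its quotients by powers of the maximal ideal.\<close>

lemma (in cring_quotient) quotient:
  assumes K: "is_ideal K" "J \<subseteq> K"
  shows "cring_quotient (G Quot (\<psi> ` K)) (\<lambda>x. \<psi> ` K +> \<psi> x) K"
proof -
  interpret I: ideal "\<psi> ` K" G by (rule ideal_image [OF K(1)])
  interpret Q: cring "G Quot (\<psi> ` K)" by (rule I.quotient_is_cring [OF is_cring])
  note h = I.rcos_ring_hom
  show ?thesis
  proof unfold_locales
    show "is_ideal K" by (rule K(1))
    show "\<psi> ` K +> \<psi> (p + q) = (\<psi> ` K +> \<psi> p) \<oplus>\<^bsub>G Quot \<psi> ` K\<^esub> (\<psi> ` K +> \<psi> q)" for p q
      using ring_hom_add [OF h, of "\<psi> p" "\<psi> q"] by (simp add: \<psi>_add)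
    show "\<psi> ` K +> \<psi> (p * q) = (\<psi> ` K +> \<psi> p) \<otimes>\<^bsub>G Quot \<psi> ` K\<^esub> (\<psi> ` K +> \<psi> q)" for p q
      using ring_hom_mult [OF h, of "\<psi> p" "\<psi> q"] by (simp add: \<psi>_mult)
    show "\<psi> ` K +> \<psi> 1 = \<one>\<^bsub>G Quot \<psi> ` K\<^esub>"
      by (simp add: \<psi>_one FactRing_def)
    have "range (\<lambda>x. \<psi> ` K +> \<psi> x) = (\<lambda>a. \<psi> ` K +> a) ` carrier G"
      unfolding \<psi>_surj [symmetric] by (simp add: image_image)
    then show "range (\<lambda>x. \<psi> ` K +> \<psi> x) = carrier (G Quot \<psi> ` K)"
      by (auto simp: FactRing_simps)
    show "(\<psi> ` K +> \<psi> p = \<zero>\<^bsub>G Quot \<psi> ` K\<^esub>) = (p \<in> K)" for p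
    proof -
      have "\<psi> ` K +> \<psi> p = \<psi> ` K \<longleftrightarrow> \<psi> p \<in> \<psi> ` K"
        using I.a_rcos_self [of "\<psi> p"] I.a_rcos_const [of "\<psi> p"] by auto
      then show ?thesis using image_mem_iff [OF K] by (simp add: FactRing_def)
    qed
  qed
qed

lemma (in cring_quotient) \<psi>_sum:
  "finite A \<Longrightarrow> \<psi> (sum f A) = (\<Oplus>i\<in>A. \<psi> (f i))"
  by (induction A rule: finite_induct) (auto simp: \<psi>_zero \<psi>_add)

lemma (in cring_quotient) combine_eq:
  "combine (map \<psi> cs) (map \<psi> fs) = \<psi> (sum_list (map2 (*) cs fs))"
proof (induction cs arbitrary: fs)
  case (Cons c cs)
  then show ?case by (cases fs) (auto simp: \<psi>_zero \<psi>_add \<psi>_mult)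
qed (simp add: \<psi>_zero)

text \<open>The ring axioms are inherited from \<open>'r\<close> along the surjection. This avoids
  checking associativity and distributivity directly in \<open>assoc_graded_ring\<close>.\<close>

lemma cring_quotientI:
  fixes G (structure) and \<psi> :: "'r::comm_ring_1 \<Rightarrow> 'a"
  assumes J: "is_ideal J" and add: "\<And>p q. \<psi> (p + q) = \<psi> p \<oplus> \<psi> q" and mult: "\<And>p q. \<psi> (p * q) = \<psi> p \<otimes> \<psi> q"
    and one: "\<psi> 1 = \<one>" and zero: "\<psi> 0 = \<zero>" and surj: "range \<psi> = carrier G"
    and ker: "\<And>p. \<psi> p = \<zero> \<longleftrightarrow> p \<in> J"
  shows "cring_quotient G \<psi> J"
proof -
  have c: "\<psi> p \<in> carrier G" for p using surj by blast
  have ex: "a \<in> carrier G \<Longrightarrow> \<exists>p. a = \<psi> p" for a using surj by blast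
  have "cring G"
  proof (rule cringI)
    show "abelian_group G"
    proof (rule abelian_groupI)
      show "x \<oplus> y \<in> carrier G" if "x \<in> carrier G" "y \<in> carrier G" for x y
        using ex [OF that(1)] ex [OF that(2)] c by (auto simp: add [symmetric])
      show "\<zero> \<in> carrier G" using c zero by metis
      show "x \<oplus> y \<oplus> z = x \<oplus> (y \<oplus> z)" if "x \<in> carrier G" "y \<in> carrier G" "z \<in> carrier G" for x y z
        using ex [OF that(1)] ex [OF that(2)] ex [OF that(3)] by (auto simp: add [symmetric] add.assoc)
      show "x \<oplus> y = y \<oplus> x" if "x \<in> carrier G" "y \<in> carrier G" for x y
        using ex [OF that(1)] ex [OF that(2)] by (auto simp: add [symmetric] add.commute)
      show "\<zero> \<oplus> x = x" if "x \<in> carrier G" for x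
        using ex [OF that] by (auto simp: add [symmetric] zero [symmetric])
      show "\<exists>y\<in>carrier G. y \<oplus> x = \<zero>" if x: "x \<in> carrier G" for x
      proof -
        obtain p where "x = \<psi> p" using ex [OF x] by blast
        then have "\<psi> (- p) \<oplus> x = \<zero>" by (simp add: add [symmetric] zero)
        then show ?thesis using c by blast
      qed
    qed
    show "comm_monoid G"
    proof (rule comm_monoidI)
      show "x \<otimes> y \<in> carrier G" if "x \<in> carrier G" "y \<in> carrier G" for x y
        using ex [OF that(1)] ex [OF that(2)] c by (auto simp: mult [symmetric])
      show "\<one> \<in> carrier G" using c one by metis
      show "x \<otimes> y \<otimes> z = x \<otimes> (y \<otimes> z)" if "x \<in> carrier G" "y \<in> carrier G" "z \<in> carrier G" for x y z
        using ex [OF that(1)] ex [OF that(2)] ex [OF that(3)] by (auto simp: mult [symmetric] mult.assoc)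
      show "x \<otimes> y = y \<otimes> x" if "x \<in> carrier G" "y \<in> carrier G" for x y
        using ex [OF that(1)] ex [OF that(2)] by (auto simp: mult [symmetric] mult.commute)
      show "\<one> \<otimes> x = x" if "x \<in> carrier G" for x
        using ex [OF that] by (auto simp: mult [symmetric] one [symmetric])
    qed
    show "(x \<oplus> y) \<otimes> z = x \<otimes> z \<oplus> y \<otimes> z" if "x \<in> carrier G" "y \<in> carrier G" "z \<in> carrier G" for x y z
      using ex [OF that(1)] ex [OF that(2)] ex [OF that(3)]
      by (auto simp: add [symmetric] mult [symmetric] distrib_right)
  qed
  then show ?thesis
    using assms by (simp add: cring_quotient_def cring_quotient_axioms_def)
qed

lemma type_ring_ideal_iff: "ideal K ring_of_type_algebra \<longleftrightarrow> is_ideal K"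
proof
  interpret cring_quotient ring_of_type_algebra "\<lambda>x::'a. x" "{0}" by (rule cring_quotient_self)
  show "ideal K ring_of_type_algebra \<Longrightarrow> is_ideal K" using ideal_vimage(1) [of K] by simp
  show "is_ideal K \<Longrightarrow> ideal K ring_of_type_algebra" using ideal_image [of K] by simp
qed

lemma type_ring_genideal:
  fixes S :: "'r::comm_ring_1 set"
  shows "is_ideal (Idl\<^bsub>ring_of_type_algebra\<^esub> S)" "S \<subseteq> Idl\<^bsub>ring_of_type_algebra\<^esub> S"
    "is_ideal K \<Longrightarrow> S \<subseteq> K \<Longrightarrow> Idl\<^bsub>ring_of_type_algebra\<^esub> S \<subseteq> K"
proof -
  interpret cring "ring_of_type_algebra :: 'r ring" by (rule cring_from_type_algebra)
  show "is_ideal (Idl\<^bsub>ring_of_type_algebra\<^esub> S)" "S \<subseteq> Idl\<^bsub>ring_of_type_algebra\<^esub> S"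
    using genideal_ideal [of S] genideal_self [of S] by (simp_all add: type_ring_ideal_iff)
  show "is_ideal K \<Longrightarrow> S \<subseteq> K \<Longrightarrow> Idl\<^bsub>ring_of_type_algebra\<^esub> S \<subseteq> K"
    using genideal_minimal [of K S] by (simp add: type_ring_ideal_iff)
qed

section \<open>Powers of the maximal ideal\<close>

lemma is_ideal_ord_ge: "is_ideal {f. ord_ge n f}"
  by (rule is_idealI) (auto simp: ord_ge_mult2)

lemma fps3_coeff_mult_vars:
  "fps3_coeff (fps_const (fps_const fps_X) * f) i j k = (if i = 0 then 0 else fps3_coeff f (i - 1) j k)"
  "fps3_coeff (fps_const fps_X * f) i j k = (if j = 0 then 0 else fps3_coeff f i (j - 1) k)"
  "fps3_coeff (fps_X * f) i j k = (if k = 0 then 0 else fps3_coeff f i j (k - 1))"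
  by (simp_all add: fps3_coeff_def)

lemma ord_ge_vars:
  "ord_ge 1 (fps_const (fps_const fps_X))" "ord_ge 1 (fps_const fps_X)" "ord_ge 1 fps_X"
  by (auto simp: ord_ge_def fps3_coeff_def)

text \<open>Each monomial is divided by one variable: by \<open>z\<close> if \<open>z\<close>
  occurs, otherwise by \<open>y\<close> if \<open>y\<close> occurs, otherwise by
  \<open>x\<close>.\<close>

lemma ord_ge_Suc_decomp:
  assumes "ord_ge (Suc n) f"
  shows "\<exists>f1 f2 f3. ord_ge n f1 \<and> ord_ge n f2 \<and> ord_ge n f3 \<and>
    f = fps_const (fps_const fps_X) * f1 + fps_const fps_X * f2 + fps_X * f3"
proof -
  let ?mk = "\<lambda>c. Abs_fps (\<lambda>k. Abs_fps (\<lambda>j. Abs_fps (\<lambda>i. c i j k)))"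
  have mk: "fps3_coeff (?mk c) i j k = c i j k" for c i j k by (simp add: fps3_coeff_def)
  define f1 f2 f3 where "f1 = ?mk (\<lambda>i j k. if j = 0 \<and> k = 0 then fps3_coeff f (Suc i) j k else 0)"
    and "f2 = ?mk (\<lambda>i j k. if k = 0 then fps3_coeff f i (Suc j) k else 0)"
    and "f3 = ?mk (\<lambda>i j k. fps3_coeff f i j (Suc k))"
  have "ord_ge n f1" "ord_ge n f2" "ord_ge n f3"
    using assms by (auto simp: ord_ge_def f1_def f2_def f3_def mk)
  moreover have "fps3_coeff f 0 0 0 = 0" using assms by (simp add: ord_ge_def)
  then have "f = fps_const (fps_const fps_X) * f1 + fps_const fps_X * f2 + fps_X * f3"
    by (intro fps3_eqI) (auto simp: fps3_coeff_mult_vars f1_def f2_def f3_def mk)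
  ultimately show ?thesis by blast
qed

lemma fps3_max_ideal_eq: "fps3_max_ideal = {f. ord_ge 1 f}"
proof
  show "fps3_max_ideal \<subseteq> {f. ord_ge 1 f}"
    unfolding fps3_max_ideal_def by (rule type_ring_genideal(3) [OF is_ideal_ord_ge]) (simp add: ord_ge_vars)
  note M = type_ring_genideal(1,2) [of "{fps_const (fps_const fps_X), fps_const fps_X, fps_X :: 'a fps3}"]
  show "{f. ord_ge 1 f} \<subseteq> (fps3_max_ideal :: 'a fps3 set)"
  proof
    fix f :: "'a fps3" assume "f \<in> {f. ord_ge 1 f}"
    then obtain f1 f2 f3 where "f = fps_const (fps_const fps_X) * f1 + fps_const fps_X * f2 + fps_X * f3"
      using ord_ge_Suc_decomp [of 0 f] by (auto simp: One_nat_def)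
    then show "f \<in> fps3_max_ideal"
      unfolding fps3_max_ideal_def using M(2)
      by (auto intro!: is_idealD(2) [OF M(1)] is_idealD(4) [OF M(1)])
  qed
qed

text \<open>\<open>I_ord\<close> places \<open>I\<close> inside the maximal ideal, so that the
  constants \<open>K\<close> survive in the quotients by positive powers.\<close>

locale power_series_quotient =
  fixes I :: "'k::field fps3 set"
  assumes I: "is_ideal I" and I_ord: "f \<in> I \<Longrightarrow> ord_ge 1 f"
begin

abbreviation A where "A \<equiv> quot_ring I"
abbreviation cl where "cl f \<equiv> I +>\<^bsub>fps3_ring\<^esub> f"
abbreviation pw where "pw \<equiv> ideal_power A (quot_max_ideal I)"
abbreviation \<kappa> where "\<kappa> t f \<equiv> pw (Suc t) +>\<^bsub>A\<^esub> cl f"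

text \<open>The preimage, in the power series ring, of the \<open>t\<close>-th power of the maximal
  ideal of \<open>A\<close>.\<close>

definition ord_mod :: "nat \<Rightarrow> 'k fps3 set" where
  "ord_mod t = {f. \<exists>i\<in>I. ord_ge t (f - i)}"

lemma quotient_A: "cring_quotient A cl I"
proof -
  have "cring_quotient (fps3_ring Quot ((\<lambda>x. x) ` I)) (\<lambda>x. (\<lambda>x. x) ` I +>\<^bsub>fps3_ring\<^esub> x) I"
    by (rule cring_quotient.quotient [OF cring_quotient_self I]) (use is_idealD(1) [OF I] in simp)
  then show ?thesis by (simp add: quot_ring_def)
qed

sublocale A: cring_quotient A cl I
  by (rule quotient_A)

text \<open>A series of order \<open>t + 1\<close> is a combination of the variables with
  coefficients of order \<open>t\<close>, so the powers are the images of the order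
  filtration.\<close>

lemma ideal_power_eq: "pw t = cl ` {f. ord_ge t f}"
proof (induction t)
  case 0
  then show ?case using A.\<psi>_surj by simp
next
  case (Suc t)
  have m: "quot_max_ideal I = cl ` {f. ord_ge 1 f}"
    by (simp add: quot_max_ideal_def fps3_max_ideal_eq)
  show ?case
  proof
    show "pw (Suc t) \<subseteq> cl ` {f. ord_ge (Suc t) f}"
    proof
      fix x assume "x \<in> pw (Suc t)"
      then have "x \<in> ideal_prod A (quot_max_ideal I) (pw t)" by simp
      then show "x \<in> cl ` {f. ord_ge (Suc t) f}"
      proof (induction rule: ideal_prod.induct)
        case (prod i j)
        then obtain a b where "i = cl a" "ord_ge 1 a" "j = cl b" "ord_ge t b" using m Suc by auto
        then have "i \<otimes>\<^bsub>A\<^esub> j = cl (a * b)" "ord_ge (Suc t) (a * b)"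
          using ord_ge_mult' [of 1 a t b "Suc t"] by (simp_all add: A.\<psi>_mult)
        then show ?case by blast
      next
        case (sum s1 s2)
        then obtain a b where "s1 = cl a" "ord_ge (Suc t) a" "s2 = cl b" "ord_ge (Suc t) b" by auto
        then have "s1 \<oplus>\<^bsub>A\<^esub> s2 = cl (a + b)" "ord_ge (Suc t) (a + b)"
          by (simp_all add: A.\<psi>_add)
        then show ?case by blast
      qed
    qed
    have prod: "cl (a * b) \<in> pw (Suc t)" if "ord_ge 1 a" "ord_ge t b" for a b
    proof -
      have "cl a \<otimes>\<^bsub>A\<^esub> cl b \<in> ideal_prod A (quot_max_ideal I) (pw t)"
        by (rule ideal_prod.prod) (use that m Suc in auto)
      then show ?thesis by (simp add: A.\<psi>_mult)
    qed
    have sum: "cl (a + b) \<in> pw (Suc t)" if "cl a \<in> pw (Suc t)" "cl b \<in> pw (Suc t)" for a b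
      using ideal_prod.sum [of "cl a" A "quot_max_ideal I" "pw t" "cl b"] that by (simp add: A.\<psi>_add)
    show "cl ` {f. ord_ge (Suc t) f} \<subseteq> pw (Suc t)"
    proof
      fix x assume "x \<in> cl ` {f. ord_ge (Suc t) f}"
      then obtain f where "x = cl f" "ord_ge (Suc t) f" by blast
      then obtain f1 f2 f3 where "ord_ge t f1" "ord_ge t f2" "ord_ge t f3"
        "x = cl (fps_const (fps_const fps_X) * f1 + fps_const fps_X * f2 + fps_X * f3)"
        using ord_ge_Suc_decomp by metis
      then show "x \<in> pw (Suc t)" using ord_ge_vars by (auto intro!: sum prod simp del: ideal_power.simps)
    qed
  qed
qed

lemma is_ideal_ord_mod: "is_ideal (ord_mod t)"
proof (rule is_idealI)
  show "0 \<in> ord_mod t"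
    using is_idealD(1) [OF I] unfolding ord_mod_def by (intro CollectI bexI [of _ 0]) simp_all
  show "a + b \<in> ord_mod t" if a: "a \<in> ord_mod t" and b: "b \<in> ord_mod t" for a b
  proof -
    obtain i j where "i \<in> I" "ord_ge t (a - i)" "j \<in> I" "ord_ge t (b - j)" using a b by (auto simp: ord_mod_def)
    then have "i + j \<in> I" "ord_ge t ((a - i) + (b - j))" using is_idealD(2) [OF I] by simp_all
    moreover have "(a - i) + (b - j) = a + b - (i + j)" by simp
    ultimately show ?thesis unfolding ord_mod_def by auto
  qed
  show "r * a \<in> ord_mod t" if a: "a \<in> ord_mod t" for r a
  proof -
    obtain i where "i \<in> I" "ord_ge t (a - i)" using a by (auto simp: ord_mod_def)
    then have "r * i \<in> I" "ord_ge t (r * (a - i))" by (blast intro: is_idealD(3) [OF I] ord_ge_mult2)+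
    then show ?thesis unfolding ord_mod_def by (auto simp: right_diff_distrib)
  qed
qed

lemma ord_mod_props: "I \<subseteq> ord_mod t" "ord_ge t f \<Longrightarrow> f \<in> ord_mod t" "cl ` ord_mod t = pw t"
proof -
  show 1: "I \<subseteq> ord_mod t" by (auto simp: ord_mod_def intro!: bexI)
  show 2: "ord_ge t f \<Longrightarrow> f \<in> ord_mod t" for f
    using is_idealD(1) [OF I] unfolding ord_mod_def by (intro CollectI bexI [of _ 0]) simp_all
  show "cl ` ord_mod t = pw t"
  proof
    show "cl ` ord_mod t \<subseteq> pw t"
    proof
      fix x assume "x \<in> cl ` ord_mod t"
      then obtain f i where f: "x = cl f" "i \<in> I" "ord_ge t (f - i)" by (auto simp: ord_mod_def)
      then have "cl f = cl (f - i)" by (simp add: A.\<psi>_eq_iff)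
      then show "x \<in> pw t" using f by (auto simp: ideal_power_eq)
    qed
    show "pw t \<subseteq> cl ` ord_mod t" using 2 by (auto simp: ideal_power_eq)
  qed
qed

lemma quotient_power: "cring_quotient (A Quot pw t) (\<lambda>f. pw t +>\<^bsub>A\<^esub> cl f) (ord_mod t)"
  using A.quotient [OF is_ideal_ord_mod ord_mod_props(1), of t] unfolding ord_mod_props(3) .

lemma \<kappa>_eq: "ord_ge (Suc t) (f - g) \<Longrightarrow> \<kappa> t f = \<kappa> t g"
  using cring_quotient.\<psi>_eq_iff [OF quotient_power, of "Suc t" f g] ord_mod_props(2) by blast

lemma \<kappa>_mem: "x \<in> \<kappa> t f \<longleftrightarrow> (\<exists>f'. ord_ge (Suc t) f' \<and> x = cl (f' + f))"
proof -
  have "x \<in> \<kappa> t f \<longleftrightarrow> (\<exists>h\<in>pw (Suc t). x = h \<oplus>\<^bsub>A\<^esub> cl f)"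
    by (simp only: a_r_coset_def' [of A] UN_iff singleton_iff)
  also have "\<dots> \<longleftrightarrow> (\<exists>f'. ord_ge (Suc t) f' \<and> x = cl f' \<oplus>\<^bsub>A\<^esub> cl f)"
    unfolding ideal_power_eq by blast
  finally show ?thesis unfolding A.\<psi>_add .
qed

text \<open>\<open>rcoset_mult\<close> is a union over all products of representatives; here any two
  such products agree up to terms of order \<open>t + 1\<close>.\<close>

lemma rcoset_mult_\<kappa>:
  assumes f: "ord_ge i f" and g: "ord_ge j g" and t: "t = i + j"
  shows "rcoset_mult A (pw (Suc t)) (\<kappa> i f) (\<kappa> j g) = \<kappa> t (f * g)"
proof -
  have "pw (Suc t) +>\<^bsub>A\<^esub> (a \<otimes>\<^bsub>A\<^esub> b) = \<kappa> t (f * g)" if a: "a \<in> \<kappa> i f" and b: "b \<in> \<kappa> j g" for a b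
  proof -
    obtain f' g' where fg: "ord_ge (Suc i) f'" "a = cl (f' + f)" "ord_ge (Suc j) g'" "b = cl (g' + g)"
      using a b unfolding \<kappa>_mem by blast
    have "ord_ge (Suc t) (f' * (g' + g))" "ord_ge (Suc t) (f * g')"
      using ord_ge_mult [OF fg(1), of j "g' + g"] ord_ge_mult [OF f fg(3)] g fg(3) ord_ge_mono [of "Suc j" g' j]
      by (simp_all add: t)
    then have "ord_ge (Suc t) (f' * (g' + g) + f * g')" by simp
    moreover have "(f' + f) * (g' + g) - f * g = f' * (g' + g) + f * g'" by (simp add: algebra_simps)
    ultimately have "\<kappa> t ((f' + f) * (g' + g)) = \<kappa> t (f * g)" by (intro \<kappa>_eq) simp
    then show ?thesis by (simp add: fg A.\<psi>_mult del: ideal_power.simps)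
  qed
  \<comment> \<open>Without representatives the union would be empty instead of a coset.\<close>
  moreover have "\<kappa> i f \<noteq> {}" "\<kappa> j g \<noteq> {}"
    using \<kappa>_mem [of "cl (0 + f)" i f] \<kappa>_mem [of "cl (0 + g)" j g] ord_ge_simps(1) by blast+
  ultimately show ?thesis unfolding rcoset_mult_def by (simp del: ideal_power.simps)
qed

text \<open>The link between \<open>A\<close> and \<open>I^*\<close>: a form dies in the piece of
  its degree when terms of higher order complete it to an element of \<open>I\<close>.\<close>

lemma \<kappa>_zero_iff:
  assumes "homogeneous3 t p"
  shows "\<kappa> t (fps3_of_poly3 p) = pw (Suc t) \<longleftrightarrow> p \<in> leading_forms I t"
proof -
  interpret Q: cring_quotient "A Quot pw (Suc t)" "\<kappa> t" "ord_mod (Suc t)" by (rule quotient_power)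
  have "\<kappa> t (fps3_of_poly3 p) = pw (Suc t) \<longleftrightarrow> fps3_of_poly3 p \<in> ord_mod (Suc t)"
    using Q.\<psi>_ker [of "fps3_of_poly3 p"] by (simp add: FactRing_def del: ideal_power.simps)
  also have "\<dots> \<longleftrightarrow> p \<in> leading_forms I t"
  proof
    assume "fps3_of_poly3 p \<in> ord_mod (Suc t)"
    then obtain i where i: "i \<in> I" "ord_ge (Suc t) (fps3_of_poly3 p - i)" by (auto simp: ord_mod_def)
    have "ord_ge t (fps3_of_poly3 p - (fps3_of_poly3 p - i))"
      using ord_ge_of_homogeneous [OF assms] i(2) unfolding ord_ge_Suc by (rule ord_ge_simps(4) [OF _ conjunct1])
    then have "ord_ge t i" by simp
    moreover have "p = fps3_comp t i" using i(2) assms by (simp add: ord_ge_Suc)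
    ultimately show "p \<in> leading_forms I t" using i(1) by (auto simp: leading_forms_def)
  next
    assume "p \<in> leading_forms I t"
    then obtain f where f: "p = fps3_comp t f" "f \<in> I" "ord_ge t f" by (auto simp: leading_forms_def)
    then have "ord_ge (Suc t) (fps3_of_poly3 p - f)"
      using assms by (intro ord_ge_Suc_diff) simp_all
    then show "fps3_of_poly3 p \<in> ord_mod (Suc t)" using f(2) by (auto simp: ord_mod_def)
  qed
  finally show ?thesis .
qed

lemma gr_piece_eq: "gr_piece A (quot_max_ideal I) t = (\<lambda>p. \<kappa> t (fps3_of_poly3 p)) ` {p. homogeneous3 t p}"
proof -
  let ?h = "\<lambda>p. \<kappa> t (fps3_of_poly3 p)"
  have "\<kappa> t ` {f. ord_ge t f} \<subseteq> ?h ` {p. homogeneous3 t p}"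
  proof (rule image_subsetI)
    fix f :: "'k fps3" assume f: "f \<in> {f. ord_ge t f}"
    show "\<kappa> t f \<in> ?h ` {p. homogeneous3 t p}"
    proof (rule image_eqI)
      show "\<kappa> t f = ?h (fps3_comp t f)"
        using f by (intro \<kappa>_eq ord_ge_Suc_diff) simp_all
    qed simp
  qed
  moreover have "?h ` {p. homogeneous3 t p} \<subseteq> \<kappa> t ` {f. ord_ge t f}"
  proof (rule image_subsetI)
    fix p :: "'k poly3" assume "p \<in> {p. homogeneous3 t p}"
    then show "?h p \<in> \<kappa> t ` {f. ord_ge t f}" by (intro imageI) simp
  qed
  ultimately have "\<kappa> t ` {f. ord_ge t f} = ?h ` {p. homogeneous3 t p}" by (rule subset_antisym)
  moreover have "gr_piece A (quot_max_ideal I) t = \<kappa> t ` {f. ord_ge t f}"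
    unfolding gr_piece_def ideal_power_eq [of t] by (rule image_image)
  ultimately show ?thesis by (rule trans [rotated])
qed

section \<open>The associated graded ring as a quotient of the polynomial ring\<close>

definition gr_map :: "'k poly3 \<Rightarrow> nat \<Rightarrow> 'k fps3 set set" where
  "gr_map p = (\<lambda>t. \<kappa> t (fps3_of_poly3 (poly3_comp t p)))"

text \<open>Identifies \<open>gr(A)\<close> with \<open>P / I^*\<close>. The kernel is computed in
  each degree by \<open>\<kappa>_zero_iff\<close>; a preimage is a polynomial because a graded
  element has finitely many nonzero components.\<close>

lemma assoc_graded_quotient:
  "cring_quotient (assoc_graded_ring A (quot_max_ideal I)) gr_map (tangent_ideal I)"
proof (rule cring_quotientI)
  let ?G = "assoc_graded_ring A (quot_max_ideal I)"
  show "is_ideal (tangent_ideal I)" by (rule is_ideal_tangent_ideal [OF I])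
  show "gr_map 0 = \<zero>\<^bsub>?G\<^esub>"
  proof
    fix t
    show "gr_map 0 t = \<zero>\<^bsub>?G\<^esub> t"
      using \<kappa>_zero_iff [of t 0] leading_forms_0 [OF I]
      by (simp add: gr_map_def assoc_graded_ring_def del: ideal_power.simps)
  qed
  show "gr_map (p + q) = gr_map p \<oplus>\<^bsub>?G\<^esub> gr_map q" for p q
  proof
    fix t
    interpret Q: cring_quotient "A Quot pw (Suc t)" "\<kappa> t" "ord_mod (Suc t)" by (rule quotient_power)
    show "gr_map (p + q) t = (gr_map p \<oplus>\<^bsub>?G\<^esub> gr_map q) t"
      by (simp add: gr_map_def assoc_graded_ring_def Q.\<psi>_add del: ideal_power.simps)
  qed
  show "gr_map (p * q) = gr_map p \<otimes>\<^bsub>?G\<^esub> gr_map q" for p q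
  proof
    fix t
    interpret Q: cring_quotient "A Quot pw (Suc t)" "\<kappa> t" "ord_mod (Suc t)" by (rule quotient_power)
    let ?e = "\<lambda>t p. fps3_of_poly3 (poly3_comp t p)"
    have "(gr_map p \<otimes>\<^bsub>?G\<^esub> gr_map q) t = finsum (A Quot pw (Suc t))
         (\<lambda>i. rcoset_mult A (pw (Suc t)) (gr_map p i) (gr_map q (t - i))) {..t}"
      by (simp add: assoc_graded_ring_def del: ideal_power.simps)
    also have "\<dots> = finsum (A Quot pw (Suc t)) (\<lambda>i. \<kappa> t (?e i p * ?e (t - i) q)) {..t}"
    proof (rule Q.finsum_cong' [OF refl])
      show "(\<lambda>i. \<kappa> t (?e i p * ?e (t - i) q)) \<in> {..t} \<rightarrow> carrier (A Quot pw (Suc t))"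
        using Q.\<psi>_closed by blast
      fix i assume "i \<in> {..t}"
      then show "rcoset_mult A (pw (Suc t)) (gr_map p i) (gr_map q (t - i)) = \<kappa> t (?e i p * ?e (t - i) q)"
        unfolding gr_map_def by (intro rcoset_mult_\<kappa>) simp_all
    qed
    also have "\<dots> = \<kappa> t (\<Sum>i\<le>t. ?e i p * ?e (t - i) q)"
      by (rule Q.\<psi>_sum [symmetric]) simp
    also have "(\<Sum>i\<le>t. ?e i p * ?e (t - i) q) = ?e t (p * q)"
    proof -
      have "fps3_of_poly3 (sum h B) = (\<Sum>b\<in>B. fps3_of_poly3 (h b))" for h :: "nat \<Rightarrow> 'k poly3" and B
        by (induction B rule: infinite_finite_induct) auto
      then show ?thesis by (simp add: poly3_comp_mult)
    qed
    finally show "gr_map (p * q) t = (gr_map p \<otimes>\<^bsub>?G\<^esub> gr_map q) t" by (simp add: gr_map_def)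
  qed
  note one = homogeneous3_one [where 'a = 'k]
  show "gr_map 1 = \<one>\<^bsub>?G\<^esub>"
  proof
    fix t
    show "gr_map 1 t = \<one>\<^bsub>?G\<^esub> t"
      using \<kappa>_zero_iff [of t 0] leading_forms_0 [OF I]
      by (simp add: gr_map_def assoc_graded_ring_def poly3_comp_homogeneous [OF one] A.\<psi>_one fps3_of_poly3_1 One_nat_def del: ideal_power.simps)
  qed
  show "gr_map p = \<zero>\<^bsub>?G\<^esub> \<longleftrightarrow> p \<in> tangent_ideal I" for p
  proof -
    have "gr_map p = \<zero>\<^bsub>?G\<^esub> \<longleftrightarrow> (\<forall>t. gr_map p t = pw (Suc t))"
      by (simp add: assoc_graded_ring_def fun_eq_iff del: ideal_power.simps)
    then show ?thesis
      unfolding gr_map_def tangent_ideal_def using \<kappa>_zero_iff [OF homogeneous3_comp] by blast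
  qed
  have carrier: "carrier ?G = {c. (\<forall>t. c t \<in> gr_piece A (quot_max_ideal I) t) \<and> finite {t. c t \<noteq> pw (Suc t)}}"
    by (simp add: assoc_graded_ring_def)
  show "range gr_map = carrier ?G"
  proof
    show "range gr_map \<subseteq> carrier ?G"
    proof
      fix c assume "c \<in> range gr_map"
      then obtain p where p: "c = gr_map p" by blast
      obtain D where D: "tdeg_le D p" using exists_tdeg_le by blast
      have "{t. c t \<noteq> pw (Suc t)} \<subseteq> {..D}"
      proof
        fix t assume "t \<in> {t. c t \<noteq> pw (Suc t)}"
        then have "poly3_comp t p \<noteq> 0"
          using \<kappa>_zero_iff [of t 0] leading_forms_0 [OF I] unfolding p gr_map_def by auto
        then show "t \<in> {..D}" using D unfolding tdeg_le_def by (metis atMost_iff not_le)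
      qed
      then have "finite {t. c t \<noteq> pw (Suc t)}" by (rule finite_subset) simp
      moreover have "c t \<in> gr_piece A (quot_max_ideal I) t" for t
        unfolding p gr_map_def gr_piece_eq
        by (rule imageI [of "poly3_comp t p" _ "\<lambda>p. \<kappa> t (fps3_of_poly3 p)"]) simp
      ultimately show "c \<in> carrier ?G" unfolding carrier by blast
    qed
    show "carrier ?G \<subseteq> range gr_map"
    proof
      fix c assume "c \<in> carrier ?G"
      then have c: "\<And>t. c t \<in> gr_piece A (quot_max_ideal I) t" "finite {t. c t \<noteq> pw (Suc t)}"
        unfolding carrier by blast+
      then have "\<forall>t. \<exists>p. homogeneous3 t p \<and> c t = \<kappa> t (fps3_of_poly3 p)"
        unfolding gr_piece_eq by blast
      then obtain q where q: "\<And>t. homogeneous3 t (q t)" "\<And>t. c t = \<kappa> t (fps3_of_poly3 (q t))" by metis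
      define p where "p = (\<Sum>t\<in>{t. c t \<noteq> pw (Suc t)}. q t)"
      have "gr_map p t = c t" for t
      proof -
        have "poly3_comp t p = (\<Sum>s\<in>{t. c t \<noteq> pw (Suc t)}. if s = t then q t else 0)"
          unfolding p_def poly3_comp_sum by (rule sum.cong) (auto simp: poly3_comp_homogeneous [OF q(1)])
        also have "\<dots> = (if c t \<noteq> pw (Suc t) then q t else 0)" using c(2) by simp
        finally have comp: "poly3_comp t p = (if c t \<noteq> pw (Suc t) then q t else 0)" .
        show ?thesis
        proof (cases "c t = pw (Suc t)")
          case True
          then have "poly3_comp t p = 0" using comp by (simp del: ideal_power.simps)
          then show ?thesis using \<kappa>_zero_iff [of t 0] leading_forms_0 [OF I] True
            unfolding gr_map_def by (simp del: ideal_power.simps)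
        next
          case False
          then have "poly3_comp t p = q t" using comp by (simp del: ideal_power.simps)
          then show ?thesis using q(2) unfolding gr_map_def by (simp del: ideal_power.simps)
        qed
      qed
      then have "gr_map p = c" by (rule ext)
      then show "c \<in> range gr_map" using rangeI [of gr_map p] by simp
    qed
  qed
qed

section \<open>The Hilbert function\<close>

abbreviation H where "H \<equiv> hilbert_function A (quot_scalars I) (quot_max_ideal I)"

definition \<theta> :: "nat \<Rightarrow> 'k poly3 \<Rightarrow> 'k fps3 set set" where
  "\<theta> t p = \<kappa> t (fps3_of_poly3 p)"

abbreviation scalars :: "nat \<Rightarrow> 'k fps3 set set set" where
  "scalars t \<equiv> range (\<lambda>c. \<theta> t (scalar3 c))"

abbreviation piece :: "nat \<Rightarrow> 'k fps3 set set set" where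
  "piece t \<equiv> gr_piece A (quot_max_ideal I) t"

text \<open>A list version that matches \<open>ring.combine\<close>; surplus entries of the longer
  list are ignored.\<close>

definition lin_comb :: "'k list \<Rightarrow> 'k poly3 list \<Rightarrow> 'k poly3" where
  "lin_comb cs ps = sum_list (map2 (\<lambda>c p. scalar3 c * p) cs ps)"

lemma \<theta>_props:
  "\<theta> t (p + q) = \<theta> t p \<oplus>\<^bsub>A Quot pw (Suc t)\<^esub> \<theta> t q" "\<theta> t (p * q) = \<theta> t p \<otimes>\<^bsub>A Quot pw (Suc t)\<^esub> \<theta> t q"
  "\<theta> t 1 = \<one>\<^bsub>A Quot pw (Suc t)\<^esub>" "\<theta> t p \<in> carrier (A Quot pw (Suc t))"
proof -
  interpret Q: cring_quotient "A Quot pw (Suc t)" "\<kappa> t" "ord_mod (Suc t)" by (rule quotient_power)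
  show "\<theta> t (p + q) = \<theta> t p \<oplus>\<^bsub>A Quot pw (Suc t)\<^esub> \<theta> t q" "\<theta> t (p * q) = \<theta> t p \<otimes>\<^bsub>A Quot pw (Suc t)\<^esub> \<theta> t q"
    "\<theta> t 1 = \<one>\<^bsub>A Quot pw (Suc t)\<^esub>"
    unfolding \<theta>_def fps3_of_poly3_simps fps3_of_poly3_1 by (rule Q.\<psi>_add Q.\<psi>_mult Q.\<psi>_one)+
  show "\<theta> t p \<in> carrier (A Quot pw (Suc t))"
    unfolding \<theta>_def by (rule Q.\<psi>_closed)
qed

lemma \<theta>_zero_iff:
  "homogeneous3 t p \<Longrightarrow> \<theta> t p = \<zero>\<^bsub>A Quot pw (Suc t)\<^esub> \<longleftrightarrow> p \<in> tangent_ideal I"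
  using \<kappa>_zero_iff [of t p] tangent_ideal_homogeneous [OF I, of t p]
  by (simp add: \<theta>_def FactRing_def del: ideal_power.simps)

lemma \<theta>_eq_iff:
  assumes "homogeneous3 t p" "homogeneous3 t q"
  shows "\<theta> t p = \<theta> t q \<longleftrightarrow> p - q \<in> tangent_ideal I"
proof -
  interpret Q: cring_quotient "A Quot pw (Suc t)" "\<kappa> t" "ord_mod (Suc t)" by (rule quotient_power)
  have "\<theta> t p = \<theta> t q \<longleftrightarrow> \<theta> t (p - q) = \<zero>\<^bsub>A Quot pw (Suc t)\<^esub>"
    unfolding \<theta>_def fps3_of_poly3_simps Q.\<psi>_eq_iff Q.\<psi>_ker by (rule refl)
  then show ?thesis using \<theta>_zero_iff [of t "p - q"] assms by simp
qed

lemma piece_eq: "piece t = \<theta> t ` {p. homogeneous3 t p}"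
  unfolding gr_piece_eq \<theta>_def by (rule refl)

text \<open>A homomorphism from the field \<open>K\<close> is injective once
  \<open>1 \<noteq> 0\<close> in the quotient, which holds because elements of \<open>I\<close> have
  no constant term.\<close>

lemma subfield_scalars:
  shows "subfield (scalars t) (A Quot pw (Suc t))" "inj (\<lambda>c. \<theta> t (scalar3 c))"
proof -
  interpret Q: cring_quotient "A Quot pw (Suc t)" "\<kappa> t" "ord_mod (Suc t)" by (rule quotient_power)
  interpret F: field "ring_of_type_algebra :: 'k ring" by (rule field_from_type_algebra)
  let ?h = "\<lambda>c. \<theta> t (scalar3 c)"
  interpret h: ring_hom_ring "ring_of_type_algebra :: 'k ring" "A Quot pw (Suc t)" ?h
    by (intro ring_hom_ringI2 F.ring_axioms Q.ring_axioms ring_hom_memI)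
      (simp_all add: \<theta>_props scalar3_add scalar3_mult del: ideal_power.simps)
  have "\<one>\<^bsub>A Quot pw (Suc t)\<^esub> \<noteq> \<zero>\<^bsub>A Quot pw (Suc t)\<^esub>"
  proof
    assume "\<one>\<^bsub>A Quot pw (Suc t)\<^esub> = \<zero>\<^bsub>A Quot pw (Suc t)\<^esub>"
    then have "1 \<in> ord_mod (Suc t)" using Q.\<psi>_ker [of 1] Q.\<psi>_one by (simp del: ideal_power.simps)
    then obtain i where i: "i \<in> I" "ord_ge (Suc t) (1 - i)" by (auto simp: ord_mod_def)
    then have "ord_ge 1 (1 - i)" "ord_ge 1 i" using I_ord ord_ge_mono [of "Suc t" "1 - i" 1] by simp_all
    then have "ord_ge 1 ((1 - i) + i)" by (intro ord_ge_simps(3))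
    then have "fps3_coeff (1 :: 'k fps3) 0 0 0 = 0" by (simp add: ord_ge_def)
    then show False by (simp add: fps3_coeff_def)
  qed
  then show "subfield (scalars t) (A Quot pw (Suc t))" "inj ?h"
    using h.img_is_subfield [OF F.carrier_is_subfield] by simp_all
qed

lemma combine_\<theta>:
  "ring.combine (A Quot pw (Suc t)) (map (\<lambda>c. \<theta> t (scalar3 c)) cs) (map (\<theta> t) ps) = \<theta> t (lin_comb cs ps)"
proof -
  interpret Q: cring_quotient "A Quot pw (Suc t)" "\<kappa> t" "ord_mod (Suc t)" by (rule quotient_power)
  have "map (\<lambda>c. \<theta> t (scalar3 c)) cs = map (\<kappa> t) (map (\<lambda>c. fps3_of_poly3 (scalar3 c)) cs)"
    "map (\<theta> t) ps = map (\<kappa> t) (map fps3_of_poly3 ps)" by (simp_all add: \<theta>_def del: ideal_power.simps)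
  moreover have "sum_list (map2 (*) (map (\<lambda>c. fps3_of_poly3 (scalar3 c)) cs) (map fps3_of_poly3 ps))
    = fps3_of_poly3 (lin_comb cs ps)"
  proof (induction cs arbitrary: ps)
    case (Cons c cs)
    then show ?case by (cases ps) (simp_all add: lin_comb_def)
  qed (simp add: lin_comb_def)
  ultimately show ?thesis using Q.combine_eq by (metis \<theta>_def)
qed

lemma lin_comb_mult: "lin_comb cs (map ((*) l) ps) = l * lin_comb cs ps"
proof (induction cs arbitrary: ps)
  case (Cons c cs)
  then show ?case by (cases ps) (simp_all add: lin_comb_def algebra_simps)
qed (simp add: lin_comb_def)

lemma lin_comb_homogeneous: "(\<And>p. p \<in> set ps \<Longrightarrow> homogeneous3 t p) \<Longrightarrow> homogeneous3 t (lin_comb cs ps)"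
proof (induction cs arbitrary: ps)
  case (Cons c cs)
  then show ?case by (cases ps) (simp_all add: lin_comb_def)
qed (simp add: lin_comb_def)

lemma set_subset_scalars: "set Ks \<subseteq> scalars t \<Longrightarrow> \<exists>cs. Ks = map (\<lambda>c. \<theta> t (scalar3 c)) cs"
proof (induction Ks)
  case (Cons a Ks)
  then obtain cs c where "Ks = map (\<lambda>c. \<theta> t (scalar3 c)) cs" "a = \<theta> t (scalar3 c)" by auto
  then have "a # Ks = map (\<lambda>c. \<theta> t (scalar3 c)) (c # cs)" by simp
  then show ?case by (rule exI)
qed simp

lemma Span_\<theta>:
  "ring.Span (A Quot pw (Suc t)) (scalars t) (map (\<theta> t) ps) = {\<theta> t (lin_comb cs ps) | cs. True}"
proof -
  interpret Q: cring_quotient "A Quot pw (Suc t)" "\<kappa> t" "ord_mod (Suc t)" by (rule quotient_power)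
  have "Q.Span (scalars t) (map (\<theta> t) ps) = {Q.combine Ks (map (\<theta> t) ps) | Ks. set Ks \<subseteq> scalars t}"
    by (rule Q.Span_eq_combine_set [OF subfield_scalars(1)]) (auto simp: \<theta>_props(4) simp del: ideal_power.simps)
  also have "\<dots> = {\<theta> t (lin_comb cs ps) | cs. True}"
  proof
    show "{Q.combine Ks (map (\<theta> t) ps) | Ks. set Ks \<subseteq> scalars t} \<subseteq> {\<theta> t (lin_comb cs ps) | cs. True}"
    proof
      fix x assume "x \<in> {Q.combine Ks (map (\<theta> t) ps) | Ks. set Ks \<subseteq> scalars t}"
      then obtain Ks where Ks: "x = Q.combine Ks (map (\<theta> t) ps)" "set Ks \<subseteq> scalars t" by blast
      obtain cs where "Ks = map (\<lambda>c. \<theta> t (scalar3 c)) cs" using set_subset_scalars [OF Ks(2)] by blast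
      then show "x \<in> {\<theta> t (lin_comb cs ps) | cs. True}" using Ks(1) combine_\<theta> by blast
    qed
    show "{\<theta> t (lin_comb cs ps) | cs. True} \<subseteq> {Q.combine Ks (map (\<theta> t) ps) | Ks. set Ks \<subseteq> scalars t}"
    proof
      fix x assume "x \<in> {\<theta> t (lin_comb cs ps) | cs. True}"
      then obtain cs where "x = Q.combine (map (\<lambda>c. \<theta> t (scalar3 c)) cs) (map (\<theta> t) ps)"
        using combine_\<theta> by auto
      moreover have "set (map (\<lambda>c. \<theta> t (scalar3 c)) cs) \<subseteq> scalars t" by auto
      ultimately show "x \<in> {Q.combine Ks (map (\<theta> t) ps) | Ks. set Ks \<subseteq> scalars t}" by blast
    qed
  qed
  finally show ?thesis .
qed

lemma exists_monomial_span:
  "\<exists>ps. (\<forall>p\<in>set ps. homogeneous3 t p) \<and> (\<forall>p. homogeneous3 t p \<longrightarrow> (\<exists>cs. p = lin_comb cs ps))"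
proof -
  obtain es where es: "set es = exponents t" "distinct es"
    using finite_distinct_list [OF finite_exponents] by blast
  let ?m = "\<lambda>(i, j, k). var_x ^ i * var_y ^ j * var_z ^ k :: 'k poly3"
  have "homogeneous3 t (?m e)" if "e \<in> exponents t" for e
  proof -
    from that obtain i j k where e: "e = (i, j, k)" "i + j + k = t" by (auto simp: exponents_def)
    have "homogeneous3 (1 * i + 1 * j + 1 * k) (var_x ^ i * var_y ^ j * var_z ^ k :: 'k poly3)"
      by (intro homogeneous3_mult homogeneous3_power homogeneous3_vars)
    then show ?thesis using e by simp
  qed
  moreover have "\<exists>cs. p = lin_comb cs (map ?m es)" if p: "homogeneous3 t p" for p
  proof (rule exI [of _ "map (\<lambda>(i, j, k). poly3_coeff p i j k) es"])
    have "map2 (\<lambda>c p. scalar3 c * p) (map f fs) (map g fs) = map (\<lambda>e. scalar3 (f e) * g e) fs"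
      for f :: "nat \<times> nat \<times> nat \<Rightarrow> 'k" and g and fs
      by (induction fs) auto
    then have "lin_comb (map (\<lambda>(i, j, k). poly3_coeff p i j k) es) (map ?m es)
      = (\<Sum>e\<in>set es. scalar3 ((\<lambda>(i, j, k). poly3_coeff p i j k) e) * ?m e)"
      unfolding lin_comb_def by (simp add: sum_list_distinct_conv_sum_set [OF es(2)])
    also have "\<dots> = (\<Sum>(i, j, k)\<in>exponents t. scalar3 (poly3_coeff p i j k) * var_x ^ i * var_y ^ j * var_z ^ k)"
      unfolding es(1) by (rule sum.cong) (auto simp: mult.assoc)
    finally show "p = lin_comb (map (\<lambda>(i, j, k). poly3_coeff p i j k) es) (map ?m es)"
      using homogeneous3_eq_sum [OF p] by simp
  qed
  ultimately show ?thesis using es(1) by (intro exI [of _ "map ?m es"]) auto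
qed

text \<open>The monomials of degree \<open>t\<close> span the piece. A basis of their span consists
  of elements of the piece, which lift to forms.\<close>

lemma exists_piece_basis:
  "\<exists>ps. (\<forall>p\<in>set ps. homogeneous3 t p) \<and> ring.independent (A Quot pw (Suc t)) (scalars t) (map (\<theta> t) ps) \<and>
    ring.Span (A Quot pw (Suc t)) (scalars t) (map (\<theta> t) ps) = piece t"
proof -
  interpret Q: cring_quotient "A Quot pw (Suc t)" "\<kappa> t" "ord_mod (Suc t)" by (rule quotient_power)
  obtain ms where ms: "\<And>p. p \<in> set ms \<Longrightarrow> homogeneous3 t p" "\<And>p. homogeneous3 t p \<Longrightarrow> \<exists>cs. p = lin_comb cs ms"
    using exists_monomial_span by blast
  have span: "Q.Span (scalars t) (map (\<theta> t) ms) = piece t"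
    unfolding Span_\<theta> piece_eq using ms lin_comb_homogeneous [of ms t] by blast
  have "set (map (\<theta> t) ms) \<subseteq> carrier (A Quot pw (Suc t))"
    by (auto simp: \<theta>_props(4) simp del: ideal_power.simps)
  then obtain Vs where Vs: "set Vs \<subseteq> carrier (A Quot pw (Suc t))" "Q.independent (scalars t) Vs"
    "Q.Span (scalars t) Vs = Q.Span (scalars t) (map (\<theta> t) ms)"
    by (rule Q.filter_base [OF subfield_scalars(1)]) (rule that)
  note Vs = Vs(1,2) Vs(3) [unfolded span]
  have "set Vs \<subseteq> piece t"
    using Q.Span_base_incl [OF subfield_scalars(1) Vs(1)] Vs(3) by blast
  then have "\<exists>ps. (\<forall>p\<in>set ps. homogeneous3 t p) \<and> Vs = map (\<theta> t) ps"
  proof (induction Vs)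
    case (Cons v Vs)
    then obtain ps p where "\<forall>p\<in>set ps. homogeneous3 t p" "Vs = map (\<theta> t) ps" "homogeneous3 t p" "v = \<theta> t p"
      by (auto simp: piece_eq)
    then show ?case by (intro exI [of _ "p # ps"]) simp
  qed simp
  then show ?thesis using Vs by blast
qed

lemma hilbert_function_eqI:
  assumes "ring.dimension (A Quot pw (Suc t)) n (scalars t) (piece t)"
  shows "H t = n"
proof -
  interpret Q: cring_quotient "A Quot pw (Suc t)" "\<kappa> t" "ord_mod (Suc t)" by (rule quotient_power)
  have "fps3_of_poly3 (scalar3 c) = fps3_const c" for c :: 'k
  proof (rule fps3_eqI)
    fix i j k
    have "fps3_coeff (fps3_const c) i j k = (if i = 0 \<and> j = 0 \<and> k = 0 then c else 0)"
      by (simp add: fps3_coeff_def fps3_const_def)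
    then show "fps3_coeff (fps3_of_poly3 (scalar3 c)) i j k = fps3_coeff (fps3_const c) i j k" by simp
  qed
  then have "(\<lambda>a. pw (Suc t) +>\<^bsub>A\<^esub> a) ` quot_scalars I = scalars t"
    unfolding quot_scalars_def image_image \<theta>_def by simp
  then have "H t = Q.dim (scalars t) (piece t)"
    by (simp add: hilbert_function_def del: ideal_power.simps)
  also have "\<dots> = n"
    unfolding Q.dim_def using assms Q.dimension_is_inj [OF subfield_scalars(1)] by (intro the_equality) blast+
  finally show ?thesis .
qed

text \<open>\<open>take\<close> accounts for coefficient lists longer than \<open>ps\<close>, whose
  surplus entries are arbitrary.\<close>

lemma independent_lin_comb_coeffs_zero:
  assumes "ring.independent (A Quot pw (Suc t)) (scalars t) (map (\<theta> t) ps)"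
    and "\<theta> t (lin_comb cs ps) = \<zero>\<^bsub>A Quot pw (Suc t)\<^esub>"
  shows "set (take (length ps) cs) \<subseteq> {0}"
proof -
  interpret Q: cring_quotient "A Quot pw (Suc t)" "\<kappa> t" "ord_mod (Suc t)" by (rule quotient_power)
  let ?h = "\<lambda>c. \<theta> t (scalar3 c)"
  have "set (take (length (map (\<theta> t) ps)) (map ?h cs)) \<subseteq> {\<zero>\<^bsub>A Quot pw (Suc t)\<^esub>}"
  proof (rule Q.independent_imp_trivial_combine [OF subfield_scalars(1) assms(1)])
    show "Q.combine (map ?h cs) (map (\<theta> t) ps) = \<zero>\<^bsub>A Quot pw (Suc t)\<^esub>"
      unfolding combine_\<theta> by (rule assms(2))
  qed auto
  then have "?h c = \<zero>\<^bsub>A Quot pw (Suc t)\<^esub>" if "c \<in> set (take (length ps) cs)" for c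
    using that by (auto simp: take_map simp del: ideal_power.simps)
  moreover have "?h 0 = \<zero>\<^bsub>A Quot pw (Suc t)\<^esub>"
    unfolding \<theta>_def by (simp add: Q.\<psi>_zero del: ideal_power.simps)
  ultimately show ?thesis using subfield_scalars(2) [of t] unfolding inj_def by (metis singleton_iff subsetI)
qed

section \<open>Multiplication by a regular linear form\<close>

context
  fixes l :: "'k poly3"
  assumes l: "linear_parameter (tangent_ideal I) l"
begin

definition l_surjective :: "nat \<Rightarrow> bool" where
  "l_surjective t \<longleftrightarrow> (\<forall>p. homogeneous3 (Suc t) p \<longrightarrow> (\<exists>q. homogeneous3 t q \<and> p - l * q \<in> tangent_ideal I))"

text \<open>A form of degree \<open>t + 2\<close> is a combination of the variables with
  coefficients of degree \<open>t + 1\<close>, and each coefficient is a multiple of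
  \<open>l\<close> modulo the ideal.\<close>

lemma l_surjective_Suc:
  assumes s: "l_surjective t"
  shows "l_surjective (Suc t)"
  unfolding l_surjective_def
proof (intro allI impI)
  note T = is_ideal_tangent_ideal [OF I]
  fix p :: "'k poly3" assume p: "homogeneous3 (Suc (Suc t)) p"
  \<comment> \<open>The decomposition is taken from power series; its component of degree
    \<open>t + 2\<close> is one for forms.\<close>
  have "ord_ge (Suc (Suc t)) (fps3_of_poly3 p)" using p by simp
  then obtain f1 f2 f3 where f: "ord_ge (Suc t) f1" "ord_ge (Suc t) f2" "ord_ge (Suc t) f3"
    "fps3_of_poly3 p = fps_const (fps_const fps_X) * f1 + fps_const fps_X * f2 + fps_X * f3"
    using ord_ge_Suc_decomp by blast
  have vars: "fps_const (fps_const fps_X) = fps3_of_poly3 (var_x :: 'k poly3)"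
    "fps_const fps_X = fps3_of_poly3 (var_y :: 'k poly3)" "fps_X = fps3_of_poly3 (var_z :: 'k poly3)"
    by (rule fps3_eqI; simp only: fps3_coeff_of_poly3 poly3_coeff_var; simp add: fps3_coeff_def)+
  have "fps3_comp (Suc (Suc t)) (fps3_of_poly3 p) = var_x * fps3_comp (Suc t) f1 + var_y * fps3_comp (Suc t) f2
      + var_z * fps3_comp (Suc t) f3"
    unfolding f(4) vars fps3_comp_simps using f(1-3)
    by (simp add: fps3_comp_mult_leading [of 1 _ "Suc t"])
  then have p_eq: "p = var_x * fps3_comp (Suc t) f1 + var_y * fps3_comp (Suc t) f2 + var_z * fps3_comp (Suc t) f3"
    using p by simp
  obtain q1 q2 q3 where q: "homogeneous3 t q1" "fps3_comp (Suc t) f1 - l * q1 \<in> tangent_ideal I"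
    "homogeneous3 t q2" "fps3_comp (Suc t) f2 - l * q2 \<in> tangent_ideal I"
    "homogeneous3 t q3" "fps3_comp (Suc t) f3 - l * q3 \<in> tangent_ideal I"
    using s unfolding l_surjective_def by (meson homogeneous3_fps3_comp)
  have "var_x * (fps3_comp (Suc t) f1 - l * q1) + var_y * (fps3_comp (Suc t) f2 - l * q2)
      + var_z * (fps3_comp (Suc t) f3 - l * q3) \<in> tangent_ideal I"
    by (intro is_idealD(2) [OF T] is_idealD(3) [OF T] q)
  then have "p - l * (var_x * q1 + var_y * q2 + var_z * q3) \<in> tangent_ideal I"
    unfolding p_eq by (simp add: algebra_simps)
  moreover have "homogeneous3 (1 + t) (var_x * q1)" "homogeneous3 (1 + t) (var_y * q2)" "homogeneous3 (1 + t) (var_z * q3)"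
    by (intro homogeneous3_mult homogeneous3_vars q)+
  ultimately show "\<exists>q. homogeneous3 (Suc t) q \<and> p - l * q \<in> tangent_ideal I"
    by (intro exI [of _ "var_x * q1 + var_y * q2 + var_z * q3"]) (simp add: plus_1_eq_Suc)
qed

text \<open>Regularity of \<open>l\<close> keeps a basis of the piece of degree \<open>t\<close>
  independent after multiplication by \<open>l\<close>; equal dimensions mean that it also spans the
  next piece.\<close>

lemma hilbert_function_Suc:
  shows "H t \<le> H (Suc t)" "H (Suc t) = H t \<longleftrightarrow> l_surjective t"
proof -
  interpret Q: cring_quotient "A Quot pw (Suc t)" "\<kappa> t" "ord_mod (Suc t)" by (rule quotient_power)
  interpret R: cring_quotient "A Quot pw (Suc (Suc t))" "\<kappa> (Suc t)" "ord_mod (Suc (Suc t))" by (rule quotient_power)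
  obtain ps where ps: "\<And>p. p \<in> set ps \<Longrightarrow> homogeneous3 t p" "Q.independent (scalars t) (map (\<theta> t) ps)"
    "Q.Span (scalars t) (map (\<theta> t) ps) = piece t"
    using exists_piece_basis [of t] by blast
  have Ht: "H t = length ps"
    using hilbert_function_eqI [OF Q.dimensionI [OF subfield_scalars(1) ps(2,3)]] by simp
  let ?ws = "map (\<theta> (Suc t)) (map ((*) l) ps)"
  have l_hom: "homogeneous3 1 l" and l_reg: "\<And>p. l * p \<in> tangent_ideal I \<Longrightarrow> p \<in> tangent_ideal I"
    using l by (auto simp: linear_parameter_def)
  have l_mult: "homogeneous3 t q \<Longrightarrow> homogeneous3 (Suc t) (l * q)" for q
    using homogeneous3_mult [OF l_hom, of t q] by (simp add: plus_1_eq_Suc)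
  have lc_hom: "homogeneous3 t (lin_comb cs ps)" for cs by (rule lin_comb_homogeneous [OF ps(1)])
  have ind: "R.independent (scalars (Suc t)) ?ws"
  proof (rule R.trivial_combine_imp_independent [OF subfield_scalars(1)])
    show "set ?ws \<subseteq> carrier (A Quot pw (Suc (Suc t)))" by (auto simp: \<theta>_props(4) simp del: ideal_power.simps)
    fix Ks assume Ks: "set Ks \<subseteq> scalars (Suc t)" "R.combine Ks ?ws = \<zero>\<^bsub>A Quot pw (Suc (Suc t))\<^esub>"
    obtain cs where cs: "Ks = map (\<lambda>c. \<theta> (Suc t) (scalar3 c)) cs" using set_subset_scalars [OF Ks(1)] by blast
    have "\<theta> (Suc t) (l * lin_comb cs ps) = \<zero>\<^bsub>A Quot pw (Suc (Suc t))\<^esub>"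
      using Ks(2) unfolding cs combine_\<theta> lin_comb_mult .
    then have "l * lin_comb cs ps \<in> tangent_ideal I" using \<theta>_zero_iff l_mult lc_hom by blast
    then have "\<theta> t (lin_comb cs ps) = \<zero>\<^bsub>A Quot pw (Suc t)\<^esub>" using l_reg \<theta>_zero_iff lc_hom by blast
    then have "set (take (length ps) cs) \<subseteq> {0}" by (rule independent_lin_comb_coeffs_zero [OF ps(2)])
    moreover have "\<theta> (Suc t) (scalar3 0) = \<zero>\<^bsub>A Quot pw (Suc (Suc t))\<^esub>"
      unfolding \<theta>_def by (simp add: R.\<psi>_zero del: ideal_power.simps)
    ultimately show "set (take (length ?ws) Ks) \<subseteq> {\<zero>\<^bsub>A Quot pw (Suc (Suc t))\<^esub>}"
      unfolding cs by (auto simp: take_map simp del: ideal_power.simps)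
  qed
  have sub: "set ?ws \<subseteq> piece (Suc t)"
    unfolding piece_eq using ps(1) l_mult by auto
  obtain qs where qs: "R.independent (scalars (Suc t)) (map (\<theta> (Suc t)) qs)"
    "R.Span (scalars (Suc t)) (map (\<theta> (Suc t)) qs) = piece (Suc t)"
    using exists_piece_basis [of "Suc t"] by blast
  note dim = R.dimensionI [OF subfield_scalars(1) qs]
  have HS: "H (Suc t) = length qs" using hilbert_function_eqI [OF dim] by simp
  show "H t \<le> H (Suc t)"
    using R.independent_length_le_dimension [OF subfield_scalars(1) dim ind sub] by (simp add: Ht HS)
  have "H (Suc t) = H t \<longleftrightarrow> R.Span (scalars (Suc t)) ?ws = piece (Suc t)"
    using R.independent_length_eq_dimension [OF subfield_scalars(1) dim ind sub] by (auto simp: Ht HS simp del: ideal_power.simps)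
  also have "\<dots> \<longleftrightarrow> l_surjective t"
  proof
    assume span: "R.Span (scalars (Suc t)) ?ws = piece (Suc t)"
    show "l_surjective t"
      unfolding l_surjective_def
    proof (intro allI impI)
      fix p :: "'k poly3" assume p: "homogeneous3 (Suc t) p"
      then have "\<theta> (Suc t) p \<in> R.Span (scalars (Suc t)) ?ws" unfolding span piece_eq by simp
      then obtain cs where "\<theta> (Suc t) p = \<theta> (Suc t) (l * lin_comb cs ps)"
        unfolding Span_\<theta> lin_comb_mult by blast
      then have "p - l * lin_comb cs ps \<in> tangent_ideal I"
        using \<theta>_eq_iff [OF p l_mult [OF lc_hom]] by blast
      then show "\<exists>q. homogeneous3 t q \<and> p - l * q \<in> tangent_ideal I" using lc_hom by blast
    qed
  next
    assume s: "l_surjective t"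
    show "R.Span (scalars (Suc t)) ?ws = piece (Suc t)"
    proof
      show "R.Span (scalars (Suc t)) ?ws \<subseteq> piece (Suc t)"
        unfolding Span_\<theta> lin_comb_mult piece_eq using l_mult [OF lc_hom] by blast
      show "piece (Suc t) \<subseteq> R.Span (scalars (Suc t)) ?ws"
      proof
        fix x assume "x \<in> piece (Suc t)"
        then obtain p where p: "x = \<theta> (Suc t) p" "homogeneous3 (Suc t) p" by (auto simp: piece_eq)
        then obtain q where q: "homogeneous3 t q" "p - l * q \<in> tangent_ideal I" using s unfolding l_surjective_def by blast
        have "\<theta> t q \<in> piece t" unfolding piece_eq using q(1) by simp
        then obtain cs where "\<theta> t q = \<theta> t (lin_comb cs ps)" unfolding ps(3) [symmetric] Span_\<theta> by blast
        then have "q - lin_comb cs ps \<in> tangent_ideal I" using \<theta>_eq_iff [OF q(1) lc_hom] by blast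
        then have "p - l * q + l * (q - lin_comb cs ps) \<in> tangent_ideal I"
          using is_idealD(2,3) [OF is_ideal_tangent_ideal [OF I]] q(2) by blast
        then have "p - l * lin_comb cs ps \<in> tangent_ideal I" by (simp add: algebra_simps)
        then have "x = \<theta> (Suc t) (l * lin_comb cs ps)"
          unfolding p(1) using \<theta>_eq_iff [OF p(2) l_mult [OF lc_hom]] by blast
        then show "x \<in> R.Span (scalars (Suc t)) ?ws" unfolding Span_\<theta> lin_comb_mult by blast
      qed
    qed
  qed
  finally show "H (Suc t) = H t \<longleftrightarrow> l_surjective t" .
qed

lemma hilbert_function_constant:
  assumes "l_surjective t" "t \<le> s"
  shows "H s = H t"
proof -
  have "l_surjective s \<and> H s = H t"
    using assms(2)
  proof (induction s rule: dec_induct)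
    case base
    then show ?case using assms(1) by simp
  next
    case (step n)
    then show ?case using l_surjective_Suc hilbert_function_Suc(2) by metis
  qed
  then show ?thesis by blast
qed

text \<open>Where growth stops, the value is already the multiplicity, so this cannot happen before
  the least index attaining it.\<close>

lemma hilbert_function_strictly_increasing:
  assumes ex: "\<exists>t. l_surjective t"
  shows "hf_strictly_increasing H"
proof -
  obtain T where T: "l_surjective T" using ex by blast
  have ev: "\<forall>\<^sub>F s in sequentially. H s = H t" if "l_surjective t" for t
    unfolding eventually_sequentially using hilbert_function_constant [OF that] by blast
  have mult: "hf_multiplicity H = H t" if "l_surjective t" for t
    unfolding hf_multiplicity_def
  proof (rule the_equality)
    show "\<forall>\<^sub>F s in sequentially. H s = H t" by (rule ev [OF that])
    fix e assume "\<forall>\<^sub>F s in sequentially. H s = e"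
    then have "\<forall>\<^sub>F s in sequentially. H s = e \<and> H s = H t" using ev [OF that] by (rule eventually_conj)
    then obtain N where "\<forall>n\<ge>N. H n = e \<and> H n = H t" unfolding eventually_sequentially by blast
    then have "H N = e \<and> H N = H t" using le_refl [of N] by blast
    then show "e = H t" by metis
  qed
  have "H n < H (Suc n)" if n: "n < (LEAST n. H n = hf_multiplicity H)" for n
  proof (rule ccontr)
    assume "\<not> H n < H (Suc n)"
    then have "H (Suc n) = H n" using hilbert_function_Suc(1) [of n] by simp
    then have "l_surjective n" using hilbert_function_Suc(2) by blast
    then have "H n = hf_multiplicity H" using mult by simp
    then show False using not_less_Least [OF n] by blast
  qed
  then show ?thesis by (simp add: hf_strictly_increasing_def Let_def)
qed

end

end

text \<open>Transfers square-freeness: the square of a linear form in \<open>tangent_ideal I\<close>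
  would also lie in \<open>I^*\<close>.\<close>

lemma tangent_ideal_subset_initial_ideal: "tangent_ideal I \<subseteq> initial_ideal I"
proof (rule leading_forms_subset_imp_tangent_subset)
  show J: "is_ideal (initial_ideal I)" unfolding initial_ideal_def by (rule type_ring_genideal(1))
  fix t
  show "leading_forms I t \<subseteq> initial_ideal I"
  proof
    fix p assume "p \<in> leading_forms I t"
    then obtain f where f: "p = fps3_comp t f" "f \<in> I" "ord_ge t f" by (auto simp: leading_forms_def)
    show "p \<in> initial_ideal I"
    proof (cases "p = 0")
      case True
      then show ?thesis using is_idealD(1) [OF J] by simp
    next
      case False
      then have "p = initial_form f" "f \<noteq> 0"
        using fps3_order_eqI [OF f(3)] f(1) by (auto simp: initial_form_eq)
      then have "p \<in> {initial_form f |f. f \<in> I \<and> f \<noteq> 0}" using f(2) by blast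
      then show ?thesis
        unfolding initial_ideal_def by (rule subsetD [OF type_ring_genideal(2)])
    qed
  qed
qed

lemma type_ring_genideal2:
  fixes f g :: "'r::comm_ring_1"
  shows "Idl\<^bsub>ring_of_type_algebra\<^esub> {f, g} = ideal2 f g"
proof
  show "Idl\<^bsub>ring_of_type_algebra\<^esub> {f, g} \<subseteq> ideal2 f g"
    by (rule type_ring_genideal(3) [OF is_ideal_ideal2]) (simp add: generators_in_ideal2)
  note J = type_ring_genideal(1,2) [of "{f, g}"]
  show "ideal2 f g \<subseteq> Idl\<^bsub>ring_of_type_algebra\<^esub> {f, g}"
    using ideal3_subset [OF J(1), of f g 0] J(2) is_idealD(1) [OF J(1)] by (simp add: ideal2_eq_ideal3)
qed

lemma type_ring_genideal1_iff:
  fixes f x :: "'r::comm_ring_1"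
  shows "x \<in> Idl\<^bsub>ring_of_type_algebra\<^esub> {f} \<longleftrightarrow> (\<exists>c. x = c * f)"
  using type_ring_genideal2 [of f f] by (auto simp: ideal2_def distrib_right [symmetric]) (metis add.right_neutral mult_zero_left)

theorem proposition3p8:
  fixes I :: "'k::{alg_closed_field, field_char_0} fps3 set"
  assumes "type_2_2 I"
    and "square_free_forms (initial_ideal_component I 2)"
  shows "hf_strictly_increasing
           (hilbert_function (quot_ring I) (quot_scalars I) (quot_max_ideal I)) \<and>
         cohen_macaulay_ring (assoc_graded_ring (quot_ring I) (quot_max_ideal I))"
proof -
  interpret R: cring "fps3_ring :: 'k fps3 ring" by (rule cring_from_type_algebra)
  obtain f g where fg: "I = Idl\<^bsub>fps3_ring\<^esub> {f, g}" "regular_sequence fps3_ring [f, g]"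
    "fps3_order f = 2" "fps3_order g = 2" "initial_form g \<notin> Idl\<^bsub>poly3_ring\<^esub> {initial_form f}"
    using assms(1) unfolding type_2_2_def by blast
  have I_eq: "I = ideal2 f g" unfolding fg(1) by (rule type_ring_genideal2)
  have I: "is_ideal I" unfolding I_eq by (rule is_ideal_ideal2)
  have reg: "c \<in> Idl\<^bsub>fps3_ring\<^esub> (set (take i [f, g]))"
    if "i < 2" "[f, g] ! i * c \<in> Idl\<^bsub>fps3_ring\<^esub> (set (take i [f, g]))" for i c
    using fg(2) that unfolding regular_sequence_def by simp
  \<comment> \<open>For \<open>f = 0\<close> regularity of the first element would put
    \<open>1\<close> into the zero ideal.\<close>
  have f0: "f \<noteq> 0"
  proof
    assume "f = 0"
    then have "(1 :: 'k fps3) \<in> {0}" using reg [of 0 1] R.genideal_empty by simp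
    then show False by simp
  qed
  \<comment> \<open>The second step of the regular sequence: \<open>g * b\<close> in
    \<open>(f)\<close> forces \<open>b\<close> into \<open>(f)\<close>.\<close>
  have coprime: "\<exists>c. b = c * f" if "a * f = b * g" for a b
  proof -
    have "g * b \<in> Idl\<^bsub>fps3_ring\<^esub> {f}" using that by (auto simp: type_ring_genideal1_iff mult.commute intro: sym)
    then show ?thesis using reg [of "Suc 0" b] by (simp add: type_ring_genideal1_iff)
  qed
  have f_ord: "ord_ge 2 f" using ord_ge_order [OF f0] fg(3) by simp
  \<comment> \<open>For \<open>g = 0\<close> the previous fact would make \<open>f\<close> a unit,
    although its order is two.\<close>
  have g0: "g \<noteq> 0"
  proof
    assume "g = 0"
    then obtain c where "1 = c * f" using coprime [of 0 1] by auto
    then have "ord_ge 2 (1 :: 'k fps3)" using ord_ge_mult2 [OF f_ord, of c] by simp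
    then have "fps3_coeff (1 :: 'k fps3) 0 0 0 = 0" by (simp add: ord_ge_def)
    then show False by (simp add: fps3_coeff_def)
  qed
  have g_ord: "ord_ge 2 g" using ord_ge_order [OF g0] fg(4) by simp
  have forms: "initial_form f = fps3_comp 2 f" "initial_form g = fps3_comp 2 g"
    by (simp_all add: initial_form_eq fg)
  \<comment> \<open>The condition on initial forms is used for constant cofactors: the two quadratic
    forms are linearly independent.\<close>
  have ne: "fps3_comp 2 f \<noteq> 0" "fps3_comp 2 g \<noteq> scalar3 c * fps3_comp 2 f" for c
    using initial_form_nonzero [OF f0] fg(5) by (auto simp: forms type_ring_genideal1_iff)
  have sqfree: "l = 0" if l: "homogeneous3 1 l" "l ^ 2 \<in> tangent_ideal I" for l
  proof (rule ccontr)
    assume "l \<noteq> 0"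
    have "homogeneous3 2 (l ^ 2)" using homogeneous3_power [OF l(1), of 2] by simp
    then have "l ^ 2 \<in> initial_ideal_component I 2"
      using l(2) tangent_ideal_subset_initial_ideal unfolding initial_ideal_component_def by blast
    then show False using assms(2) l(1) \<open>l \<noteq> 0\<close> unfolding square_free_forms_def by blast
  qed
  have "\<exists>l. linear_parameter (tangent_ideal (ideal2 f g)) l"
    using f_ord g_ord ne
  proof (rule exists_linear_parameter)
    show "\<exists>c. b = c * f" if "a * f = b * g" for a b by (rule coprime [OF that])
    show "l = 0" if "homogeneous3 1 l" "l ^ 2 \<in> tangent_ideal (ideal2 f g)" for l
      using sqfree that unfolding I_eq by blast
  qed
  then obtain l where l: "linear_parameter (tangent_ideal I) l" unfolding I_eq by blast
  have I_ord_2: "ord_ge 2 h" if "h \<in> I" for h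
    using that f_ord g_ord by (auto simp: I_eq ideal2_def ord_ge_mult2)
  interpret power_series_quotient I
    by unfold_locales (use I I_ord_2 ord_ge_mono [of 2 _ 1] in auto)
  interpret graded_parameter "tangent_ideal I" l
  proof
    show T: "is_ideal (tangent_ideal I)" by (rule is_ideal_tangent_ideal [OF I])
    show "linear_parameter (tangent_ideal I) l" by (rule l)
    show "poly3_comp t p \<in> tangent_ideal I" if "p \<in> tangent_ideal I" for p t
      using that unfolding tangent_ideal_homogeneous [OF I homogeneous3_comp] by (simp add: tangent_ideal_def)
    note one = homogeneous3_one [where 'a = 'k]
    show "1 \<notin> tangent_ideal I"
      unfolding tangent_ideal_homogeneous [OF I one]
    proof
      assume "1 \<in> leading_forms I 0"
      then obtain h where "1 = fps3_comp 0 h" "h \<in> I" by (auto simp: leading_forms_def)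
      moreover have "fps3_comp 0 h = 0" if "ord_ge 2 h" using that by (simp add: ord_ge_iff_comp)
      ultimately show False using I_ord_2 [of h] by simp
    qed
  qed
  interpret gr: cring_quotient "assoc_graded_ring (quot_ring I) (quot_max_ideal I)" gr_map "tangent_ideal I"
    by (rule assoc_graded_quotient)
  interpret gr: poly3_quotient "tangent_ideal I" l "assoc_graded_ring (quot_ring I) (quot_max_ideal I)" gr_map
    by unfold_locales
  \<comment> \<open>Vanishing modulo \<open>l\<close> in high degrees means that multiplication by
    \<open>l\<close> is eventually onto.\<close>
  have "\<exists>t. l_surjective l t"
    using exists_degree_surjective unfolding l_surjective_def [OF l] by blast
  then show ?thesis
    using hilbert_function_strictly_increasing [OF l] gr.cohen_macaulay_quotient by blast
qed

end
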